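(* Fix $\alpha>0$. Let $U_s:[0,\infty)\to\mathbb R$ belong to $W^{4,\infty}_\alpha(0,\infty)$ and assume there is $a\in(0,\infty)$ with $U_s(a)=U_s'(a)=0$ and $U_s''(a)\neq 0$. Consider the linearised hyperbolic Prandtl system \[ \begin{cases} (\partial_t+1)\big(\partial_t u+U_s(y)\partial_x u+v\,U_s'(y)\big)-\partial_y^2u=0, & (t,x,y)\in(0,T)\times\mathbb T\times\mathbb R_+,\\ \partial_x u+\partial_y v=0, & (t,x,y)\in(0,T)\times\mathbb T\times\mathbb R_+,\\ (u,\partial_t u)|_{t=0}=(u_{\rm in},u_{t,\rm in}), & (x,y)\in \mathbb T\times\mathbb R_+,\\ u|_{y=0}=0,\quad v|_{y=0}=0, & (t,x)\in(0,T)\times\mathbb T, \end{cases} \] where $v(t,x,y)=-\int_0^y\partial_x u(t,x,z)\,dz$. Then for all $m\ge 0$, all $\mu\in[0,1/3)$ and every (small) time $\delta>0$, there exists a pair of initial data \[ (u_{\rm in},u_{t,\rm in})\in \mathcal C^\omega(\mathbb T,W^{1,\infty}_\alpha(\mathbb R_+))\times \mathcal C^\omega(\mathbb T,W^{0,\infty}_\alpha(\mathbb R_+))\hookrightarrow H^m(\mathbb T,W^{1,\infty}_\alpha(\mathbb R_+))\times H^m(\mathbb T,W^{0,\infty}_\alpha(\mathbb R_+)) \] with $\|u_{\rm in}\|_{H^mW^{1,\infty}_\alpha}+\|u_{t,\rm in}\|_{H^mW^{0,\infty}_\alpha}\le 1$, which generates a global-in-time smooth (possibly complex-valued) solution $u$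 of the system above satisfying \[ \sup_{0\le t\le\delta}\|u(t)\|_{H^{m-\mu}W^{0,\infty}_\alpha}\ge \frac1\delta . \]
   Context: For $s\ge 0$ and $\alpha>0$, $W^{s,\infty}_\alpha(\mathbb R_+)$ is the space of $f\in W^{s,\infty}(\mathbb R_+)$ such that $y\mapsto e^{\alpha y}f(y)$ also belongs to $W^{s,\infty}(\mathbb R_+)$, with norm $\|f\|_{W^{s,\infty}_\alpha}=\|e^{\alpha\cdot}f\|_{W^{s,\infty}}$; here $\mathbb R_+=[0,\infty)$. For $f(x,y)=\sum_{k\in\mathbb Z}f_k(y)e^{ikx}$ on $\mathbb T\times\mathbb R_+$, $H^mW^{s,\infty}_\alpha=H^m(\mathbb T,W^{s,\infty}_\alpha(\mathbb R_+))$ is the space with finite norm $\|f\|_{H^mW^{s,\infty}_\alpha}=\big(\sum_{k\in\mathbb Z}(1+k^2)^m\|f_k\|_{W^{s,\infty}_\alpha}^2\big)^{1/2}$, and $\mathcal C^\omega(\mathbb T,W^{s,\infty}_\alpha(\mathbb R_+))$ is the space of such $f$ with $\sup_{k\in\mathbb Z}e^{\sigma|k|}\|f_k\|_{W^{s,\infty}_\alpha}<\infty$ for some $\sigma>0$ (analytic in $x$). Solutions and initial data are allowed to be complex-valued. *)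

theory Defs
  imports "HOL-Analysis.Analysis"
begin

definition C2_on :: "'a::real_normed_vector set \<Rightarrow> ('a \<Rightarrow> 'b::real_normed_vector) \<Rightarrow> bool" where
  "C2_on S f \<longleftrightarrow> open S \<and> f differentiable_on S \<and>
     (\<forall>v. (\<lambda>p. frechet_derivative f (at p) v) differentiable_on S) \<and>
     (\<forall>v w. continuous_on S (\<lambda>p. frechet_derivative (\<lambda>q. frechet_derivative f (at q) v) (at p) w))"

definition pd_t :: "(real \<Rightarrow> real \<Rightarrow> real \<Rightarrow> complex) \<Rightarrow> real \<Rightarrow> real \<Rightarrow> real \<Rightarrow> complex" where
  "pd_t u t x y = vector_derivative (\<lambda>s. u s x y) (at t)"
definition pd_x :: "(real \<Rightarrow> real \<Rightarrow> real \<Rightarrow> complex) \<Rightarrow> real \<Rightarrow> real \<Rightarrow> real \<Rightarrow> complex" where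
  "pd_x u t x y = vector_derivative (\<lambda>s. u t s y) (at x)"
definition pd_y :: "(real \<Rightarrow> real \<Rightarrow> real \<Rightarrow> complex) \<Rightarrow> real \<Rightarrow> real \<Rightarrow> real \<Rightarrow> complex" where
  "pd_y u t x y = vector_derivative (\<lambda>s. u t x s) (at y)"

text \<open>For s \<ge> 1: f is C^{s-1} on [0,\<infinity>) (one-sided derivative at 0), all derivatives of
  order < s are bounded, and the (s-1)-st derivative is Lipschitz (equivalently its a.e. derivative
  is in L^\<infinity>). For s = 0: bounded and Borel measurable on [0,\<infinity>).\<close>
definition W_inf :: "nat \<Rightarrow> (real \<Rightarrow> real) \<Rightarrow> bool" where
  "W_inf s f \<longleftrightarrow>
    (if s = 0 then bounded (f ` {0..}) \<and> f \<in> borel_measurable (restrict_space lborel {0..})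
     else (\<exists>D :: nat \<Rightarrow> real \<Rightarrow> real. D 0 = f \<and>
       (\<forall>j < s - 1. \<forall>y \<ge> 0. (D j has_real_derivative D (Suc j) y) (at y within {0..})) \<and>
       (\<forall>j < s. bounded (D j ` {0..})) \<and>
       (\<exists>C. C-lipschitz_on {0..} (D (s - 1)))))"

definition W_inf_alpha :: "nat \<Rightarrow> real \<Rightarrow> (real \<Rightarrow> real) \<Rightarrow> bool" where
  "W_inf_alpha s \<alpha> f \<longleftrightarrow> W_inf s f \<and> W_inf s (\<lambda>y. exp (\<alpha> * y) * f y)"

definition sup_norm :: "(real \<Rightarrow> complex) \<Rightarrow> ennreal" where
  "sup_norm h = (SUP y\<in>{0::real..}. ennreal (norm (h y)))"

text \<open>Best Lipschitz constant on [0,\<infinity>) (= ess sup |h'|); \<infinity> if h is not Lipschitz.\<close>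
definition lip_const :: "(real \<Rightarrow> complex) \<Rightarrow> ennreal" where
  "lip_const h = (SUP p\<in>{(y, z). 0 \<le> y \<and> 0 \<le> z \<and> y \<noteq> z}.
       ennreal (norm (h (fst p) - h (snd p)) / \<bar>fst p - snd p\<bar>))"

definition W0a_norm :: "real \<Rightarrow> (real \<Rightarrow> complex) \<Rightarrow> ennreal" where
  "W0a_norm \<alpha> f = sup_norm (\<lambda>y. of_real (exp (\<alpha> * y)) * f y)"

definition W1a_norm :: "real \<Rightarrow> (real \<Rightarrow> complex) \<Rightarrow> ennreal" where
  "W1a_norm \<alpha> f = sup_norm (\<lambda>y. of_real (exp (\<alpha> * y)) * f y)
                    + lip_const (\<lambda>y. of_real (exp (\<alpha> * y)) * f y)"

definition fcoef :: "(real \<Rightarrow> real \<Rightarrow> complex) \<Rightarrow> int \<Rightarrow> real \<Rightarrow> complex" where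
  "fcoef f k y = (1 / (2 * pi)) * integral {0..2*pi} (\<lambda>x. f x y * exp (- \<i> * of_int k * of_real x))"

definition Hm_norm :: "real \<Rightarrow> ((real \<Rightarrow> complex) \<Rightarrow> ennreal) \<Rightarrow> (real \<Rightarrow> real \<Rightarrow> complex) \<Rightarrow> ennreal" where
  "Hm_norm m N f =
     (let S = (\<Sum>\<^sub>\<infinity>k::int. ennreal ((1 + (real_of_int k)\<^sup>2) powr m) * (N (fcoef f k))\<^sup>2)
      in if S = \<infinity> then \<infinity> else ennreal (sqrt (enn2real S)))"

definition analytic_x :: "((real \<Rightarrow> complex) \<Rightarrow> ennreal) \<Rightarrow> (real \<Rightarrow> real \<Rightarrow> complex) \<Rightarrow> bool" where
  "analytic_x N f \<longleftrightarrow> (\<exists>\<sigma>>0. \<exists>C::real. \<forall>k::int.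
       ennreal (exp (\<sigma> * \<bar>real_of_int k\<bar>)) * N (fcoef f k) \<le> ennreal C)"

end

theory Submission
  imports Defs
begin

text \<open>
  A single Fourier mode \<open>e\<^sup>i\<^sup>k\<^sup>x \<phi>'(y) e\<^sup>\<lambda>\<^sup>t\<close> solves the system iff
  \<open>(\<lambda> + 1) i k ((U - c) \<phi>' - U' \<phi>) = \<phi>'''\<close> with \<open>c = i \<lambda> / k\<close>. Near the nondegenerate critical point \<open>a\<close>, where
  \<open>U \<approx> b (y - a)\<^sup>2\<close>, all terms balance at the scales \<open>y - a \<sim> k\<^sup>-\<^sup>1\<^sup>/\<^sup>3\<close> and \<open>\<lambda> \<sim> k\<^sup>1\<^sup>/\<^sup>3\<close>, and the limiting problem has an
  explicit solution with \<open>Re \<lambda> > 0\<close> for which \<open>\<phi>'''\<close> is a complex Gaussian. Gluing it to \<open>\<phi> = U - c\<close> above the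
  critical layer gives quasi-modes growing like \<open>e\<^sup>\<sigma>\<^sup>t\<close>, \<open>\<sigma> \<sim> k\<^sup>1\<^sup>/\<^sup>3\<close>, of size one and with a residual of size one.

  For fixed \<open>k\<close> the initial value problem is a wave equation in \<open>y\<close> with a bounded nonlocal perturbation, hence
  globally solvable. If the solution with initial data \<open>(0, residual)\<close> stays below \<open>C k\<^sup>\<mu>\<close> up to time \<open>\<delta>\<close>, then Duhamel's
  formula corrects the quasi-mode by at most \<open>C k\<^sup>\<mu> e\<^sup>\<sigma>\<^sup>t / \<sigma>\<close>, which is of lower order for \<open>\<mu> < 1/3\<close>, and the corrected
  solution is exponentially large in \<open>k\<^sup>1\<^sup>/\<^sup>3\<close>. Otherwise that solution itself inflates.
\<close>

text \<open>With \<phi> = (U - c) \<psi>, the expression (U - c) \<phi>' - U' \<phi> equals (U -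
  c)^2 \<psi>': the nonlocal term disappears on the left. For U - c close to b \<xi>^2 - c, the
  balances \<xi>^2 ~ \<lambda>/k and \<lambda> k \<xi>^4 ~ 1 force \<xi> ~ k^(-1/3) and \<lambda> ~
  k^(1/3). So \<psi>' is a spike of width 1/N and height N, N ~ k^(1/3), and \<psi> is a smoothed
  step. Zero below the layer, it meets the boundary conditions for free; above, a constant \<psi>
  gives an inviscid solution whose defect is a third derivative of U, of size one. A step of height
  zero would be useless, so the integral of the spike must be shown not to vanish; it reduces to a
  complex Gaussian integral. The other obstacle is regularity: solving the initial value problem
  uses a y-derivative of the residual, hence one derivative of U too many. Therefore U is averaged
  in the quasi-mode, though not in the equation. No uniform estimate of the evolution is needed: the
  dichotomy replaces it, and as Duhamel's formula is pointwise in y, a bound on one line y = y1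
  suffices.\<close>

section \<open>Signed primitives\<close>

text \<open>The integral of \<open>f\<close> from \<open>0\<close> to \<open>t\<close>, rescaled to \<open>[0,1]\<close> so that it also has the right value for
  \<open>t < 0\<close>: classical solutions have to be \<open>C\<^sup>2\<close> in a full neighbourhood of \<open>t = 0\<close> and \<open>y = 0\<close>.\<close>
definition prim :: "(real \<Rightarrow> complex) \<Rightarrow> real \<Rightarrow> complex" where
  "prim f t = integral {0..1} (\<lambda>r. t *\<^sub>R f (t * r))"

lemma prim_unique:
  assumes "\<And>s. (F has_vector_derivative f s) (at s)"
  shows "prim f t = F t - F 0"
proof -
  have "((\<lambda>r. F (t * r)) has_vector_derivative t *\<^sub>R f (t * r)) (at r within {0..1})" for r :: real
  proof -
    have "((\<lambda>r. t * r) has_vector_derivative t) (at r)"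
      by (auto intro!: derivative_eq_intros simp: has_vector_derivative_def)
    from vector_diff_chain_at[OF this assms] show ?thesis
      by (simp add: o_def has_vector_derivative_at_within)
  qed
  then have "((\<lambda>r. t *\<^sub>R f (t * r)) has_integral (F (t * 1) - F (t * 0))) {0..1}"
    by (intro fundamental_theorem_of_calculus) auto
  from integral_unique[OF this] show ?thesis
    unfolding prim_def by simp
qed

lemma ex_primitive:
  fixes f :: "real \<Rightarrow> complex"
  assumes "continuous_on UNIV f"
  obtains F where "\<And>s. s \<in> {-T<..<T} \<Longrightarrow> (F has_vector_derivative f s) (at s)"
proof -
  have "continuous_on {-T..T} f" using assms continuous_on_subset by blast
  from antiderivative_continuous[OF this]
  obtain F where F: "\<And>x. x \<in> {-T..T} \<Longrightarrow> (F has_vector_derivative f x) (at x within {-T..T})"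
    by blast
  have "(F has_vector_derivative f s) (at s)" if "s \<in> {-T<..<T}" for s
    using F[of s] that at_within_Icc_at[of "-T" s T] by simp
  with that show ?thesis by blast
qed

text \<open>The antiderivative at hand lives on a bounded interval, so it is taken on (-T, T) around
  \<open>t\<close>; the rescaled argument \<open>s * r\<close> stays there because |s r| <=
  |s|.\<close>

lemma prim_has_vector_derivative:
  assumes f: "continuous_on UNIV f"
  shows "(prim f has_vector_derivative f t) (at t)"
proof -
  define T where "T = \<bar>t\<bar> + 1"
  obtain F where F: "\<And>s. s \<in> {-T<..<T} \<Longrightarrow> (F has_vector_derivative f s) (at s)"
    using ex_primitive[OF f] by blast
  have eq: "prim f s = F s - F 0" if s: "s \<in> {-T<..<T}" for s
  proof -
    have "((\<lambda>r. F (s * r)) has_vector_derivative s *\<^sub>R f (s * r)) (at r within {0..1})"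
      if r: "r \<in> {0..1}" for r
    proof -
      have "((\<lambda>r. s * r) has_vector_derivative s) (at r)"
        by (auto intro!: derivative_eq_intros simp: has_vector_derivative_def)
      moreover have "\<bar>s * r\<bar> \<le> \<bar>s\<bar>"
        using r by (simp add: abs_mult mult_left_le)
      then have "s * r \<in> {-T<..<T}" using s by auto
      ultimately show ?thesis
        using vector_diff_chain_at[OF _ F, of "\<lambda>r. s * r" s r]
        by (simp add: o_def has_vector_derivative_at_within)
    qed
    then have "((\<lambda>r. s *\<^sub>R f (s * r)) has_integral (F (s * 1) - F (s * 0))) {0..1}"
      by (intro fundamental_theorem_of_calculus) auto
    from integral_unique[OF this] show ?thesis
      unfolding prim_def by simp
  qed
  have t: "t \<in> {-T<..<T}" by (auto simp: T_def)
  have "((\<lambda>s. F s - F 0) has_vector_derivative f t) (at t)"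
    using has_vector_derivative_diff[OF F[OF t] has_vector_derivative_const[of "F 0"]] by simp
  then show ?thesis
    by (rule has_vector_derivative_transform_within_open[of _ _ _ "{-T<..<T}"]) (use eq t in auto)
qed

lemma prim_zero [simp]: "prim f 0 = 0"
  by (simp add: prim_def)

lemma prim_eq_integral:
  assumes "continuous_on UNIV f" "0 \<le> t"
  shows "prim f t = integral {0..t} f"
proof -
  have "(f has_integral (prim f t - prim f 0)) {0..t}"
    using assms by (intro fundamental_theorem_of_calculus
        has_vector_derivative_at_within[OF prim_has_vector_derivative])
  then show ?thesis by (simp add: integral_unique)
qed

lemma prim_cong:
  assumes "\<And>s. s \<in> closed_segment 0 t \<Longrightarrow> f s = g s"
  shows "prim f t = prim g t"
proof -
  have "f (t * r) = g (t * r)" if "r \<in> {0..1}" for r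
    using assms[of "t * r"] that by (auto simp: closed_segment_def mult.commute)
  then show ?thesis unfolding prim_def by (intro integral_cong) auto
qed

lemma integrable_prim:
  fixes f :: "real \<Rightarrow> complex"
  assumes "continuous_on UNIV f"
  shows "(\<lambda>r. t *\<^sub>R f (t * r)) integrable_on {0..1::real}"
  by (rule integrable_continuous_real) (intro continuous_intros continuous_on_compose2[OF assms]; auto)

lemma prim_add:
  assumes "continuous_on UNIV f" "continuous_on UNIV g"
  shows "prim (\<lambda>s. f s + g s) t = prim f t + prim g t"
  using integral_add[OF integrable_prim[OF assms(1), of t] integrable_prim[OF assms(2), of t]]
  by (simp add: prim_def scaleR_add_right)

lemma prim_mult_left: "prim (\<lambda>s. c * f s) t = c * prim f t"
proof -
  have "prim (\<lambda>s. c * f s) t = integral {0..1} (\<lambda>r. c * (t *\<^sub>R f (t * r)))"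
    unfolding prim_def by (intro integral_cong) simp
  then show ?thesis by (simp only: prim_def integral_mult_right)
qed

lemma prim_diff:
  assumes "continuous_on UNIV f" "continuous_on UNIV g"
  shows "prim (\<lambda>s. f s - g s) t = prim f t - prim g t"
  using integral_diff[OF integrable_prim[OF assms(1), of t] integrable_prim[OF assms(2), of t]]
  by (simp add: prim_def scaleR_diff_right)

lemma prim_minus_arg: "prim f (- t) = - prim (\<lambda>s. f (- s)) t"
  by (simp add: prim_def)

text \<open>Rescaling to [0,1] makes the domain of integration independent of the endpoint, so a
  moving endpoint \<open>\<tau> x\<close> is just another parameter of a continuous
  integrand.\<close>

lemma continuous_on_prim:
  fixes f :: "'a::topological_space \<Rightarrow> real \<Rightarrow> complex"
  assumes f: "continuous_on UNIV (\<lambda>(x, s). f x s)" and \<tau>: "continuous_on UNIV \<tau>"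
  shows "continuous_on UNIV (\<lambda>x. prim (f x) (\<tau> x))"
proof -
  have "continuous_on (UNIV \<times> {0..1}) (\<lambda>z. (\<lambda>(x, s). f x s) (fst z, \<tau> (fst z) * snd z))"
    by (intro continuous_on_compose2[OF f] continuous_intros continuous_on_compose2[OF \<tau>]) auto
  moreover have "continuous_on (UNIV \<times> {0..1::real}) (\<lambda>z. \<tau> (fst z))"
    by (intro continuous_on_compose2[OF \<tau>] continuous_intros) auto
  ultimately have "continuous_on (UNIV \<times> {0..1}) (\<lambda>(x, r). \<tau> x *\<^sub>R f x (\<tau> x * r))"
    by (auto intro!: continuous_intros simp: case_prod_unfold)
  then show ?thesis
    using integral_continuous_on_param[of UNIV 0 "1::real" "\<lambda>x r. \<tau> x *\<^sub>R f x (\<tau> x * r)"]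
    by (simp add: prim_def)
qed

lemma prim_norm_bound:
  assumes f: "continuous_on UNIV f" and "\<And>s. \<bar>s\<bar> \<le> \<bar>t\<bar> \<Longrightarrow> norm (f s) \<le> B"
  shows "norm (prim f t) \<le> B * \<bar>t\<bar>"
proof -
  have "norm (integral {0..1} (\<lambda>r. t *\<^sub>R f (t * r))) \<le> \<bar>t\<bar> * B * (1 - 0)"
  proof (rule integral_bound)
    show "continuous_on {0..1} (\<lambda>r. t *\<^sub>R f (t * r))"
      by (intro continuous_intros continuous_on_compose2[OF f]) auto
  next
    fix r :: real assume "r \<in> {0..1}"
    then have "\<bar>t * r\<bar> \<le> \<bar>t\<bar>" by (simp add: abs_mult mult_left_le)
    then show "norm (t *\<^sub>R f (t * r)) \<le> \<bar>t\<bar> * B"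
      using assms(2) by (auto intro: mult_left_mono)
  qed simp
  then show ?thesis by (simp add: prim_def mult.commute)
qed

text \<open>Integration in time gains the factor 1/L on functions of size e^(L|t|); this gain makes
  the map in \<open>wave_fixed_point\<close> contract.\<close>

lemma prim_exp_bound:
  assumes f: "continuous_on UNIV f" and L: "L > 0"
    and B: "\<And>s. norm (f s) \<le> B * exp (L * \<bar>s\<bar>)"
  shows "norm (prim f t) \<le> B / L * exp (L * \<bar>t\<bar>)"
proof -
  have B0: "B \<ge> 0" using order_trans[OF norm_ge_zero B[of 0]] by simp
  have "((\<lambda>r. B / L * exp (L * \<bar>t\<bar> * r)) has_vector_derivative B / L * (exp (L * \<bar>t\<bar> * r) * (L * \<bar>t\<bar>)))
      (at r within {0..1})" for r
    by (auto intro!: derivative_eq_intros simp: has_vector_derivative_def)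
  then have I: "((\<lambda>r. B / L * (exp (L * \<bar>t\<bar> * r) * (L * \<bar>t\<bar>))) has_integral
      (B / L * exp (L * \<bar>t\<bar> * 1) - B / L * exp (L * \<bar>t\<bar> * 0))) {0..1}"
    by (intro fundamental_theorem_of_calculus) auto
  have "norm (prim f t) \<le> B / L * exp (L * \<bar>t\<bar> * 1) - B / L * exp (L * \<bar>t\<bar> * 0)"
    unfolding prim_def
  proof (rule integral_norm_bound_integral[OF integrable_prim[OF f] _ _, THEN order_trans])
    show "(\<lambda>r. B / L * (exp (L * \<bar>t\<bar> * r) * (L * \<bar>t\<bar>))) integrable_on {0..1}"
      using I by blast
    fix r :: real assume r: "r \<in> {0..1}"
    have "norm (t *\<^sub>R f (t * r)) \<le> \<bar>t\<bar> * (B * exp (L * \<bar>t * r\<bar>))"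
      using B by (auto intro: mult_left_mono)
    also have "\<dots> = B / L * (exp (L * \<bar>t\<bar> * r) * (L * \<bar>t\<bar>))"
      using L r by (simp add: abs_mult)
    finally show "norm (t *\<^sub>R f (t * r)) \<le> B / L * (exp (L * \<bar>t\<bar> * r) * (L * \<bar>t\<bar>))" .
  qed (use I in \<open>simp add: integral_unique\<close>)
  also have "\<dots> \<le> B / L * exp (L * \<bar>t\<bar>)" using B0 L by simp
  finally show ?thesis .
qed

section \<open>Jointly continuous functions of two variables and Leibniz rules for
  primitives\<close>

abbreviation cont2 :: "(real \<Rightarrow> real \<Rightarrow> complex) \<Rightarrow> bool" where
  "cont2 f \<equiv> continuous_on UNIV (\<lambda>p. f (fst p) (snd p))"

lemma cont2_compose:
  assumes "cont2 f" "continuous_on S \<sigma>" "continuous_on S \<tau>"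
  shows "continuous_on S (\<lambda>p. f (\<sigma> p) (\<tau> p))"
  using continuous_on_compose2[OF assms(1) continuous_on_Pair[OF assms(2,3)]] by simp

lemma cont2_prim2:
  assumes "cont2 f" shows "cont2 (\<lambda>t. prim (f t))"
  by (rule continuous_on_prim[of "\<lambda>p. f (fst p)"])
    (auto simp: case_prod_unfold intro!: continuous_intros cont2_compose[OF assms])

lemma cont2_prim1:
  assumes "cont2 f" shows "cont2 (\<lambda>t y. prim (\<lambda>s. f s y) t)"
  by (rule continuous_on_prim[of "\<lambda>p s. f s (snd p)"])
    (auto simp: case_prod_unfold intro!: continuous_intros cont2_compose[OF assms])

lemma prim_param_has_vector_derivative:
  assumes d: "\<And>s y. (f s has_vector_derivative f' s y) (at y)"
    and f: "cont2 f" and f': "cont2 f'"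
  shows "((\<lambda>y. prim (\<lambda>s. f s y) t) has_vector_derivative prim (\<lambda>s. f' s y) t) (at y)"
proof -
  have "((\<lambda>y. integral (cbox 0 1) (\<lambda>r. t *\<^sub>R f (t * r) y)) has_vector_derivative
      integral (cbox 0 1) (\<lambda>r. t *\<^sub>R f' (t * r) y)) (at y within UNIV)"
  proof (rule leibniz_rule_vector_derivative)
    fix y r
    show "((\<lambda>y. t *\<^sub>R f (t * r) y) has_vector_derivative t *\<^sub>R f' (t * r) y) (at y within UNIV)"
      using bounded_linear.has_vector_derivative[OF bounded_linear_scaleR_right d] by simp
    show "(\<lambda>r. t *\<^sub>R f (t * r) y) integrable_on cbox 0 1"
      by (intro integrable_continuous continuous_intros cont2_compose[OF f])
    show "continuous_on (UNIV \<times> cbox 0 1) (\<lambda>(y, r). t *\<^sub>R f' (t * r) y)"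
      unfolding case_prod_unfold
      by (intro continuous_intros cont2_compose[OF f'])
  qed auto
  then show ?thesis by (simp add: prim_def)
qed

lemma has_derivative_partials2:
  fixes f :: "real \<Rightarrow> real \<Rightarrow> complex"
  assumes d1: "\<And>t y. ((\<lambda>t. f t y) has_vector_derivative f1 t y) (at t)"
    and d2: "\<And>t y. (f t has_vector_derivative f2 t y) (at y)"
    and c2: "cont2 f2"
  shows "((\<lambda>p. f (fst p) (snd p)) has_derivative
    (\<lambda>h. fst h *\<^sub>R f1 (fst p) (snd p) + snd h *\<^sub>R f2 (fst p) (snd p))) (at p)"
proof -
  obtain t y where p: "p = (t, y)" by force
  have "((\<lambda>(t, y). f t y) has_derivative
      (\<lambda>(tx, ty). tx *\<^sub>R f1 t y + blinfun_apply (blinfun_scaleR_left (f2 t y)) ty)) (at (t, y) within UNIV \<times> UNIV)"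
  proof (rule has_derivative_partialsI)
    show "((\<lambda>x. f x y) has_derivative (\<lambda>x. x *\<^sub>R f1 t y)) (at t within UNIV)"
      using d1 by (simp add: has_vector_derivative_def)
    show "(f x has_derivative blinfun_apply (blinfun_scaleR_left (f2 x y))) (at y within UNIV)" for x y
      using d2 by (simp add: has_vector_derivative_def)
    have "continuous_on UNIV (\<lambda>p. blinfun_scaleR_left (f2 (fst p) (snd p)))"
      by (intro bounded_linear.continuous_on[OF bounded_linear_blinfun_scaleR_left] c2)
    then show "continuous (at (t, y) within UNIV \<times> UNIV) (\<lambda>(x, y). blinfun_scaleR_left (f2 x y))"
      by (simp add: case_prod_unfold continuous_on_eq_continuous_within)
  qed auto
  then show ?thesis by (simp add: p case_prod_unfold)
qed

text \<open>Leibniz's rule with a moving endpoint: endpoint and parameter are first independent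
  variables, then the chain rule is applied along the diagonal.\<close>

lemma prim_diagonal_has_vector_derivative:
  assumes d: "\<And>s \<tau>. (F s has_vector_derivative F' s \<tau>) (at \<tau>)"
    and F: "cont2 F" and F': "cont2 F'"
  shows "((\<lambda>t. prim (\<lambda>s. F s t) t) has_vector_derivative F t t + prim (\<lambda>s. F' s t) t) (at t)"
proof -
  have D: "((\<lambda>p. prim (\<lambda>s. F s (snd p)) (fst p)) has_derivative
    (\<lambda>h. fst h *\<^sub>R F (fst p) (snd p) + snd h *\<^sub>R prim (\<lambda>s. F' s (snd p)) (fst p))) (at p)" for p
  proof (rule has_derivative_partials2[of "\<lambda>t \<tau>. prim (\<lambda>s. F s \<tau>) t" F "\<lambda>t \<tau>. prim (\<lambda>s. F' s \<tau>) t"])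
    fix t y
    show "((\<lambda>t. prim (\<lambda>s. F s y) t) has_vector_derivative F t y) (at t)"
      by (intro prim_has_vector_derivative cont2_compose[OF F] continuous_intros)
    show "((\<lambda>\<tau>. prim (\<lambda>s. F s \<tau>) t) has_vector_derivative prim (\<lambda>s. F' s y) t) (at y)"
      by (rule prim_param_has_vector_derivative[OF d F F'])
    show "cont2 (\<lambda>t \<tau>. prim (\<lambda>s. F' s \<tau>) t)" by (rule cont2_prim1[OF F'])
  qed
  have "((\<lambda>t. (t, t)) has_derivative (\<lambda>h. (h, h))) (at t)"
    by (intro has_derivative_Pair has_derivative_ident)
  from has_derivative_compose[OF this D] show ?thesis
    by (simp add: has_vector_derivative_def scaleR_add_right)
qed

section \<open>The initial value problem for a single Fourier mode\<close>

text \<open>Time derivative of d'Alembert's solution of \<open>\<omega>\<^sub>t\<^sub>t - \<omega>\<^sub>y\<^sub>y = g\<close> with data \<open>(0, \<rho>)\<close>.\<close>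
definition wave_step ::
  "(real \<Rightarrow> complex) \<Rightarrow> (real \<Rightarrow> real \<Rightarrow> complex) \<Rightarrow> real \<Rightarrow> real \<Rightarrow> complex" where
  "wave_step \<rho> g t y = (\<rho> (y + t) + \<rho> (y - t) + prim (\<lambda>s. g s (y + t - s) + g s (y - t + s)) t) / 2"

lemma cont2_wave_step:
  assumes "continuous_on UNIV \<rho>" "cont2 g"
  shows "cont2 (wave_step \<rho> g)"
  unfolding wave_step_def
  by (intro continuous_intros continuous_on_compose2[OF assms(1)]
      continuous_on_prim[of "\<lambda>p s. g s (snd p + fst p - s) + g s (snd p - fst p + s)"])
    (auto simp: case_prod_unfold intro!: continuous_intros cont2_compose[OF assms(2)])

text \<open>Picard iteration in the weighted norm sup e^(-L|t|) |\<pi>|. \<open>Gdiff\<close>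
  encodes linearity, and \<open>Gbound\<close> lets \<open>G\<close> be nonlocal in time and in y as
  long as it preserves the exponential weight. The weight yields existence for all times of both
  signs in one application of Banach's theorem.\<close>

lemma wave_fixed_point:
  fixes G :: "(real \<Rightarrow> real \<Rightarrow> complex) \<Rightarrow> (real \<Rightarrow> real \<Rightarrow> complex)"
  assumes Gcont: "\<And>\<pi>. cont2 \<pi> \<Longrightarrow> cont2 (G \<pi>)"
    and Gdiff: "\<And>\<pi> \<pi>' s y. cont2 \<pi> \<Longrightarrow> cont2 \<pi>' \<Longrightarrow> G \<pi> s y - G \<pi>' s y = G (\<lambda>s y. \<pi> s y - \<pi>' s y) s y"
    and Gbound: "\<And>\<pi> L B s y. cont2 \<pi> \<Longrightarrow> L \<ge> 1 \<Longrightarrow> (\<And>s y. norm (\<pi> s y) \<le> B * exp (L * \<bar>s\<bar>))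
      \<Longrightarrow> norm (G \<pi> s y) \<le> C * B * exp (L * \<bar>s\<bar>)"
    and C: "C \<ge> 0" and \<rho>: "continuous_on UNIV \<rho>" and \<rho>B: "\<And>y. norm (\<rho> y) \<le> B\<rho>"
  obtains \<pi> where "cont2 \<pi>" "\<And>t y. \<pi> t y = wave_step \<rho> (G \<pi>) t y"
proof -
  \<comment> \<open>The contraction factor below is C/L; this choice keeps it at most 1/2.\<close>
  define L where "L = 2 * C + 1"
  have L: "L \<ge> 1" "L > 0" using C by (auto simp: L_def)
  \<comment> \<open>\<open>P\<close> restores the weight, so that the unknown \<omega> ranges over
    the complete space of bounded continuous functions.\<close>
  define P :: "((real \<times> real) \<Rightarrow>\<^sub>C complex) \<Rightarrow> real \<Rightarrow> real \<Rightarrow> complex" where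
    "P \<omega> = (\<lambda>t y. exp (L * \<bar>t\<bar>) * apply_bcontfun \<omega> (t, y))" for \<omega>
  have Pcont: "cont2 (P \<omega>)" for \<omega>
    unfolding P_def by (intro continuous_intros) auto
  have step: "norm (prim (\<lambda>s. h s (y + t - s) + h s (y - t + s)) t) \<le> 2 * (C * B) / L * exp (L * \<bar>t\<bar>)"
    if h: "h = G \<pi>" "cont2 \<pi>" "\<And>s y. norm (\<pi> s y) \<le> B * exp (L * \<bar>s\<bar>)" for h \<pi> B t y
  proof (rule prim_exp_bound)
    show "continuous_on UNIV (\<lambda>s. h s (y + t - s) + h s (y - t + s))"
      unfolding h by (intro continuous_intros cont2_compose[OF Gcont[OF h(2)]])
    show "norm (h s (y + t - s) + h s (y - t + s)) \<le> 2 * (C * B) * exp (L * \<bar>s\<bar>)" for s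
      using norm_triangle_ineq[of "h s (y + t - s)" "h s (y - t + s)"]
        Gbound[OF h(2) L(1) h(3), of s "y + t - s"] Gbound[OF h(2) L(1) h(3), of s "y - t + s"]
      unfolding h(1) by linarith
  qed (use L in auto)
  define F where "F \<omega> = (\<lambda>p. exp (- (L * \<bar>fst p\<bar>)) * wave_step \<rho> (G (P \<omega>)) (fst p) (snd p))" for \<omega>
  have Pb: "norm (P \<omega> s y) \<le> norm \<omega> * exp (L * \<bar>s\<bar>)" for \<omega> s y
    using norm_bounded[of \<omega> "(s, y)"] by (simp add: P_def norm_mult mult.commute)
  have F: "F \<omega> \<in> bcontfun" for \<omega>
  proof (rule bcontfun_normI)
    show "continuous_on UNIV (F \<omega>)"
      unfolding F_def by (intro continuous_intros cont2_wave_step \<rho> Gcont Pcont)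
    fix p :: "real \<times> real"
    obtain t y where p: "p = (t, y)" by force
    let ?I = "prim (\<lambda>s. G (P \<omega>) s (y + t - s) + G (P \<omega>) s (y - t + s)) t"
    have "norm (wave_step \<rho> (G (P \<omega>)) t y) \<le> (2 * B\<rho> + norm ?I) / 2"
      using norm_triangle_ineq[of "\<rho> (y + t) + \<rho> (y - t)" ?I] norm_triangle_ineq[of "\<rho> (y + t)" "\<rho> (y - t)"]
        \<rho>B[of "y + t"] \<rho>B[of "y - t"]
      by (simp add: wave_step_def norm_divide)
    also have "\<dots> \<le> B\<rho> + C * norm \<omega> / L * exp (L * \<bar>t\<bar>)"
      using step[OF refl Pcont Pb, of \<omega> y t] by (simp add: mult_ac)
    finally have 1: "norm (wave_step \<rho> (G (P \<omega>)) t y) \<le> B\<rho> + C * norm \<omega> / L * exp (L * \<bar>t\<bar>)" .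
    have B0: "B\<rho> \<ge> 0" using \<rho>B[of 0] norm_ge_zero[of "\<rho> 0"] by linarith
    have "norm (F \<omega> p) = exp (- (L * \<bar>t\<bar>)) * norm (wave_step \<rho> (G (P \<omega>)) t y)"
      by (simp add: F_def p norm_mult)
    also have "\<dots> \<le> exp (- (L * \<bar>t\<bar>)) * (B\<rho> + C * norm \<omega> / L * exp (L * \<bar>t\<bar>))"
      using 1 by (intro mult_left_mono) auto
    also have "\<dots> = exp (- (L * \<bar>t\<bar>)) * B\<rho> + C * norm \<omega> / L"
      by (simp add: algebra_simps flip: exp_add)
    also have "\<dots> \<le> 1 * B\<rho> + C * norm \<omega> / L"
      using B0 L by (intro add_right_mono mult_right_mono) auto
    finally show "norm (F \<omega> p) \<le> 1 * B\<rho> + C * norm \<omega> / L" .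
  qed
  have app: "apply_bcontfun (Bcontfun (F \<omega>)) = F \<omega>" for \<omega>
    using F by (simp add: Bcontfun_inverse)
  have "dist (Bcontfun (F a)) (Bcontfun (F b)) \<le> (1/2) * dist a b" for a b
  proof (rule dist_bound)
    fix p :: "real \<times> real"
    obtain t y where p: "p = (t, y)" by force
    let ?\<pi> = "\<lambda>s y. P a s y - P b s y"
    have c: "cont2 ?\<pi>" by (intro continuous_intros Pcont)
    have bd: "norm (?\<pi> s y) \<le> dist a b * exp (L * \<bar>s\<bar>)" for s y
    proof -
      have "?\<pi> s y = exp (L * \<bar>s\<bar>) * (apply_bcontfun a (s, y) - apply_bcontfun b (s, y))"
        by (simp add: P_def right_diff_distrib)
      then have "norm (?\<pi> s y) = exp (L * \<bar>s\<bar>) * dist (apply_bcontfun a (s, y)) (apply_bcontfun b (s, y))"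
        by (simp add: norm_mult dist_norm)
      then show ?thesis
        using dist_bounded[of a "(s, y)" b] by (simp add: mult.commute)
    qed
    have "wave_step \<rho> (G (P a)) t y - wave_step \<rho> (G (P b)) t y
       = prim (\<lambda>s. (G (P a) s (y + t - s) + G (P a) s (y - t + s))
           - (G (P b) s (y + t - s) + G (P b) s (y - t + s))) t / 2"
      unfolding wave_step_def
      by (subst prim_diff)
        (auto intro!: continuous_intros cont2_compose[OF Gcont] Pcont simp: diff_divide_distrib add_divide_distrib)
    also have "(\<lambda>s. (G (P a) s (y + t - s) + G (P a) s (y - t + s))
           - (G (P b) s (y + t - s) + G (P b) s (y - t + s)))
         = (\<lambda>s. G ?\<pi> s (y + t - s) + G ?\<pi> s (y - t + s))"
      by (simp add: Gdiff[OF Pcont Pcont, symmetric] algebra_simps)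
    finally have eq: "wave_step \<rho> (G (P a)) t y - wave_step \<rho> (G (P b)) t y
       = prim (\<lambda>s. G ?\<pi> s (y + t - s) + G ?\<pi> s (y - t + s)) t / 2" .
    have 2: "norm (wave_step \<rho> (G (P a)) t y - wave_step \<rho> (G (P b)) t y)
        \<le> C * dist a b / L * exp (L * \<bar>t\<bar>)"
      unfolding eq norm_divide using step[OF refl c bd, of y t] by (simp add: mult_ac)
    have "dist (F a p) (F b p) = exp (- (L * \<bar>t\<bar>)) *
        norm (wave_step \<rho> (G (P a)) t y - wave_step \<rho> (G (P b)) t y)"
      by (simp add: F_def p dist_norm norm_mult flip: right_diff_distrib)
    also have "\<dots> \<le> exp (- (L * \<bar>t\<bar>)) * (C * dist a b / L * exp (L * \<bar>t\<bar>))"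
      using 2 by (intro mult_left_mono) auto
    also have "\<dots> = C / L * dist a b"
      by (simp flip: exp_add)
    also have "\<dots> \<le> 1 / 2 * dist a b"
      using C by (intro mult_right_mono) (auto simp: L_def field_simps)
    finally show "dist (apply_bcontfun (Bcontfun (F a)) p) (apply_bcontfun (Bcontfun (F b)) p) \<le> (1/2) * dist a b"
      by (simp add: app)
  qed
  then obtain \<omega> where \<omega>: "Bcontfun (F \<omega>) = \<omega>"
    using banach_fix_type[of "1/2" "\<lambda>\<omega>. Bcontfun (F \<omega>)"] by auto
  have "P \<omega> t y = wave_step \<rho> (G (P \<omega>)) t y" for t y
  proof -
    have "P \<omega> t y = exp (L * \<bar>t\<bar>) * F \<omega> (t, y)"
      using app[of \<omega>] by (simp add: P_def \<omega>)
    also have "\<dots> = of_real (exp (L * \<bar>t\<bar>) * exp (- (L * \<bar>t\<bar>))) * wave_step \<rho> (G (P \<omega>)) t y"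
      by (simp only: F_def of_real_mult mult.assoc fst_conv snd_conv)
    also have "exp (L * \<bar>t\<bar>) * exp (- (L * \<bar>t\<bar>)) = 1"
      by (simp flip: exp_add)
    finally show ?thesis by simp
  qed
  with Pcont that show ?thesis by blast
qed

text \<open>The solution \<open>e\<^sup>i\<^sup>k\<^sup>x u(t,y)\<close> with stream function \<open>\<phi> = prim (u t)\<close>, i.e. \<open>v = - i k e\<^sup>i\<^sup>k\<^sup>x \<phi>\<close>.
  Only the equation is restricted to \<open>y > 0\<close>; it may hold for negative times as well.\<close>
definition mode_sol :: "real \<Rightarrow> (real \<Rightarrow> real) \<Rightarrow> (real \<Rightarrow> real) \<Rightarrow> (real \<Rightarrow> real \<Rightarrow> complex)
    \<Rightarrow> (real \<Rightarrow> real \<Rightarrow> complex) \<Rightarrow> bool" where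
  "mode_sol k U U' u ut \<longleftrightarrow> (\<exists>uy utt uty uyy.
     (\<forall>t y. ((\<lambda>s. u s y) has_vector_derivative ut t y) (at t)) \<and>
     (\<forall>t y. (u t has_vector_derivative uy t y) (at y)) \<and>
     (\<forall>t y. ((\<lambda>s. ut s y) has_vector_derivative utt t y) (at t)) \<and>
     (\<forall>t y. (ut t has_vector_derivative uty t y) (at y)) \<and>
     (\<forall>t y. ((\<lambda>s. uy s y) has_vector_derivative uty t y) (at t)) \<and>
     (\<forall>t y. (uy t has_vector_derivative uyy t y) (at y)) \<and>
     cont2 u \<and> cont2 ut \<and> cont2 uy \<and> cont2 utt \<and> cont2 uty \<and> cont2 uyy \<and>
     (\<forall>t. u t 0 = 0) \<and>
     (\<forall>t y. y > 0 \<longrightarrow> utt t y + ut t y + \<i> * k * (U y * (ut t y + u t y)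
         - U' y * prim (\<lambda>z. ut t z + u t z) y) = uyy t y))"

lemma prim_even:
  assumes "\<And>s. f (- s) = f s"
  shows "prim f (- t) = - prim f t"
  by (simp add: prim_minus_arg assms)

text \<open>Each primitive from 0 raises the power of |t| by one; applied twice, this bounds a
  stream function by y^2.\<close>

lemma prim_norm_bound_abs:
  assumes "continuous_on UNIV f" "\<And>s. norm (f s) \<le> B * \<bar>s\<bar> ^ n" "B \<ge> 0"
  shows "norm (prim f t) \<le> B * \<bar>t\<bar> ^ Suc n"
proof -
  have "norm (f s) \<le> B * \<bar>t\<bar> ^ n" if "\<bar>s\<bar> \<le> \<bar>t\<bar>" for s
    using order_trans[OF assms(2)[of s] mult_left_mono[OF power_mono[OF that, of n] assms(3)]] by simp
  from prim_norm_bound[OF assms(1) this] show ?thesis by (simp add: mult_ac)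
qed

text \<open>For even data, both \<open>\<integral>\<pi> dy\<close> and \<open>\<integral>\<pi> dt\<close> gain the derivative that d'Alembert's formula for \<open>\<pi>\<close> itself
  does not provide; the common term \<open>Z\<close> cancels in \<open>u\<^sub>t\<^sub>t - u\<^sub>y\<^sub>y\<close>, which leaves \<open>\<integral>g dy\<close>.\<close>
lemma wave_step_integral_formulas:
  assumes g: "cont2 g" and \<rho>: "continuous_on UNIV \<rho>"
    and geven: "\<And>s y. g s (- y) = g s y" and \<rho>even: "\<And>y. \<rho> (- y) = \<rho> y"
    and \<pi>: "\<And>t y. \<pi> t y = wave_step \<rho> g t y"
  obtains Z where "cont2 Z"
    "\<And>t y. ((\<lambda>s. prim (\<pi> s) y) has_vector_derivative Z t y + prim (g t) y) (at t)"
    "\<And>t y. ((\<lambda>z. prim (\<lambda>s. \<pi> s z) t) has_vector_derivative Z t y) (at y)"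
proof -
  define R where "R = prim \<rho>"
  define \<Gamma> where "\<Gamma> = (\<lambda>s. prim (g s))"
  have \<Gamma>: "cont2 \<Gamma>" unfolding \<Gamma>_def by (rule cont2_prim2[OF g])
  have \<pi>c: "cont2 \<pi>" using cont2_wave_step[OF \<rho> g] by (simp add: \<pi>)
  have dR: "(R has_vector_derivative \<rho> y) (at y)" for y
    unfolding R_def by (rule prim_has_vector_derivative[OF \<rho>])
  have d\<Gamma>: "(\<Gamma> s has_vector_derivative g s y) (at y)" for s y
    unfolding \<Gamma>_def by (intro prim_has_vector_derivative cont2_compose[OF g] continuous_intros)
  have Rodd: "R (- y) = - R y" for y unfolding R_def by (rule prim_even) (rule \<rho>even)
  have \<Gamma>odd: "\<Gamma> s (- y) = - \<Gamma> s y" for s y unfolding \<Gamma>_def by (rule prim_even) (rule geven)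
  have sh: "((\<lambda>y. f (a + c * y)) has_vector_derivative c *\<^sub>R f' (a + c * y)) (at y)"
    if "\<And>y. (f has_vector_derivative f' y) (at y)" for f f' :: "real \<Rightarrow> complex" and a c y
  proof -
    have "((\<lambda>y. a + c * y) has_vector_derivative c) (at y)"
      by (auto intro!: derivative_eq_intros simp: has_vector_derivative_def)
    from vector_diff_chain_at[OF this that] show ?thesis by (simp add: o_def)
  qed
  note sh1 = sh[where c = 1, simplified] and sh2 = sh[where c = "-1", simplified]
  \<comment> \<open>In \<open>mode_ivp\<close> this becomes the second y-derivative of u.\<close>
  define Z where "Z = (\<lambda>t y. (\<rho> (y + t) - \<rho> (y - t) + prim (\<lambda>s. g s (y + t - s) - g s (y - t + s)) t) / 2)"
  have Zc: "cont2 Z"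
    unfolding Z_def
    by (intro continuous_intros continuous_on_compose2[OF \<rho>]
        continuous_on_prim[of "\<lambda>p s. g s (snd p + fst p - s) - g s (snd p - fst p + s)"])
      (auto simp: case_prod_unfold intro!: continuous_intros cont2_compose[OF g])
  \<comment> \<open>\<open>H1\<close> and \<open>H2\<close> are d'Alembert's expressions with \<rho>
    and g replaced by their y-primitives; they turn out to be the y-primitive and the t-primitive of
    \<pi>.\<close>
  define H1 where "H1 = (\<lambda>t y. (R (y + t) + R (y - t) + prim (\<lambda>s. \<Gamma> s (y + t - s) + \<Gamma> s (y - t + s)) t) / 2)"
  define H2 where "H2 = (\<lambda>t y. (R (y + t) - R (y - t) + prim (\<lambda>s. \<Gamma> s (y + t - s) - \<Gamma> s (y - t + s)) t) / 2)"
  have half: "((\<lambda>x. f x / 2) has_vector_derivative f' / 2) F"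
    if "(f has_vector_derivative f') F" for f :: "real \<Rightarrow> complex" and f' F
    using bounded_linear.has_vector_derivative[OF bounded_linear_mult_left that, of "1/2"] by simp
  have H1y: "(H1 t has_vector_derivative \<pi> t y) (at y)" for t y
  proof -
    have "((\<lambda>y. prim (\<lambda>s. \<Gamma> s (y + t - s) + \<Gamma> s (y - t + s)) t) has_vector_derivative
        prim (\<lambda>s. g s (y + t - s) + g s (y - t + s)) t) (at y)"
    proof (rule prim_param_has_vector_derivative)
      fix s y
      show "((\<lambda>y. \<Gamma> s (y + t - s) + \<Gamma> s (y - t + s)) has_vector_derivative
          g s (y + t - s) + g s (y - t + s)) (at y)"
        using has_vector_derivative_add[OF sh1[where f="\<Gamma> s" and f'="g s" and a="t - s" and y=y, OF d\<Gamma>] sh1[where f="\<Gamma> s" and f'="g s" and a="s - t" and y=y, OF d\<Gamma>]]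
        by (simp add: algebra_simps)
    qed (intro continuous_intros cont2_compose[OF \<Gamma>] cont2_compose[OF g])+
    from has_vector_derivative_add[OF has_vector_derivative_add[OF sh1[where f=R and f'=\<rho> and a="t" and y=y, OF dR] sh1[where f=R and f'=\<rho> and a="- t" and y=y, OF dR]] this]
    show ?thesis unfolding H1_def \<pi> wave_step_def
      by (intro half) (simp add: algebra_simps)
  qed
  have 1: "prim (\<pi> t) y = H1 t y" for t y
  proof -
    \<comment> \<open>Oddness of \<open>R\<close> and \<open>\<Gamma> s\<close> makes the terms
      cancel in pairs at y = 0, so that \<open>H1 t\<close> is the primitive starting from
      0.\<close>
    have "H1 t 0 = 0"
      using \<Gamma>odd[of _ "t - _"] Rodd[of t] by (simp add: H1_def prim_def)
    with prim_unique[OF H1y, of t y] show ?thesis by simp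
  qed
  have dt: "((\<lambda>t. R (y + t)) has_vector_derivative \<rho> (y + t)) (at t)"
    "((\<lambda>t. R (y - t)) has_vector_derivative - \<rho> (y - t)) (at t)" for t y
    using sh1[where f=R and f'=\<rho> and a="y" and y=t, OF dR] sh2[where f=R and f'=\<rho> and a="y" and y=t, OF dR] by simp_all
  have d\<Gamma>t: "((\<lambda>t. \<Gamma> s (y + t - s)) has_vector_derivative g s (y + t - s)) (at t)"
    "((\<lambda>t. \<Gamma> s (y - t + s)) has_vector_derivative - g s (y - t + s)) (at t)" for s t y
    using sh1[where f="\<Gamma> s" and f'="g s" and a="y - s" and y=t, OF d\<Gamma>] sh2[where f="\<Gamma> s" and f'="g s" and a="y + s" and y=t, OF d\<Gamma>] by (simp_all add: algebra_simps)
  have H1t: "((\<lambda>s. H1 s y) has_vector_derivative Z t y + \<Gamma> t y) (at t)" for t y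
  proof -
    \<comment> \<open>Both diagonal terms equal \<open>\<Gamma> t y\<close>; after halving they give
      the extra \<open>prim (g t) y\<close>. In \<open>H2t\<close> they enter with opposite signs
      and cancel.\<close>
    have "((\<lambda>t. prim (\<lambda>s. \<Gamma> s (y + t - s) + \<Gamma> s (y - t + s)) t) has_vector_derivative
        (\<Gamma> t (y + t - t) + \<Gamma> t (y - t + t)) + prim (\<lambda>s. g s (y + t - s) + - g s (y - t + s)) t) (at t)"
      by (intro prim_diagonal_has_vector_derivative[where F = "\<lambda>s t. \<Gamma> s (y + t - s) + \<Gamma> s (y - t + s)"]
          has_vector_derivative_add d\<Gamma>t continuous_intros cont2_compose[OF \<Gamma>] cont2_compose[OF g])
    from half[OF has_vector_derivative_add[OF has_vector_derivative_add[OF dt[of y t]] this]]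
    show ?thesis unfolding H1_def by (rule has_vector_derivative_eq_rhs) (simp add: Z_def field_simps)
  qed
  have H2t: "((\<lambda>s. H2 s y) has_vector_derivative \<pi> t y) (at t)" for t y
  proof -
    have "((\<lambda>t. prim (\<lambda>s. \<Gamma> s (y + t - s) - \<Gamma> s (y - t + s)) t) has_vector_derivative
        (\<Gamma> t (y + t - t) - \<Gamma> t (y - t + t)) + prim (\<lambda>s. g s (y + t - s) - - g s (y - t + s)) t) (at t)"
      by (intro prim_diagonal_has_vector_derivative[where F = "\<lambda>s t. \<Gamma> s (y + t - s) - \<Gamma> s (y - t + s)"]
          has_vector_derivative_diff d\<Gamma>t continuous_intros cont2_compose[OF \<Gamma>] cont2_compose[OF g])
    from half[OF has_vector_derivative_add[OF has_vector_derivative_diff[OF dt[of y t]] this]]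
    show ?thesis unfolding H2_def by (rule has_vector_derivative_eq_rhs) (simp add: \<pi> wave_step_def field_simps)
  qed
  have H2y: "(H2 t has_vector_derivative Z t y) (at y)" for t y
  proof -
    have "((\<lambda>y. prim (\<lambda>s. \<Gamma> s (y + t - s) - \<Gamma> s (y - t + s)) t) has_vector_derivative
        prim (\<lambda>s. g s (y + t - s) - g s (y - t + s)) t) (at y)"
    proof (rule prim_param_has_vector_derivative)
      fix s y
      show "((\<lambda>y. \<Gamma> s (y + t - s) - \<Gamma> s (y - t + s)) has_vector_derivative
          g s (y + t - s) - g s (y - t + s)) (at y)"
        using has_vector_derivative_diff[OF sh1[where f="\<Gamma> s" and f'="g s" and a="t - s" and y=y, OF d\<Gamma>] sh1[where f="\<Gamma> s" and f'="g s" and a="s - t" and y=y, OF d\<Gamma>]]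
        by (simp add: algebra_simps)
    qed (intro continuous_intros cont2_compose[OF \<Gamma>] cont2_compose[OF g])+
    from has_vector_derivative_add[OF has_vector_derivative_diff[OF sh1[where f=R and f'=\<rho> and a="t" and y=y, OF dR] sh1[where f=R and f'=\<rho> and a="- t" and y=y, OF dR]] this]
    show ?thesis unfolding H2_def Z_def
      by (intro half) (simp add: algebra_simps)
  qed
  have 2: "prim (\<lambda>s. \<pi> s y) t = H2 t y" for t y
    using prim_unique[OF H2t, of y t] by (simp add: H2_def)
  show ?thesis
  proof (rule that[OF Zc])
    show "((\<lambda>s. prim (\<pi> s) y) has_vector_derivative Z t y + prim (g t) y) (at t)" for t y
      using H1t[of y t] by (simp add: 1 \<Gamma>_def)
    show "((\<lambda>z. prim (\<lambda>s. \<pi> s z) t) has_vector_derivative Z t y) (at y)" for t y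
      using H2y[of t y] by (simp add: 2)
  qed
qed

text \<open>The unknown of the fixed point is \<open>\<pi> = u\<^sub>t\<^sub>y\<close>, extended evenly in \<open>y\<close>: this turns the boundary condition
  into oddness of \<open>u\<close>, and the differentiated equation contains \<open>U\<close> and \<open>U''\<close> but not \<open>U'\<close>, whose odd
  extension would jump at \<open>0\<close>.\<close>
lemma mode_ivp:
  fixes U U1 U2 :: "real \<Rightarrow> real" and R \<rho> :: "real \<Rightarrow> complex" and k :: real
  assumes dU: "\<And>y. y \<ge> 0 \<Longrightarrow> (U has_real_derivative U1 y) (at y within {0..})"
    and dU1: "\<And>y. y \<ge> 0 \<Longrightarrow> (U1 has_real_derivative U2 y) (at y within {0..})"
    and U2c: "continuous_on {0..} U2"
    and UM: "\<And>y. y \<ge> 0 \<Longrightarrow> \<bar>U y\<bar> \<le> M" and U2M: "\<And>y. y \<ge> 0 \<Longrightarrow> \<bar>U2 y\<bar> * y\<^sup>2 \<le> M"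
    and dR: "\<And>y. (R has_vector_derivative \<rho> y) (at y)"
    and \<rho>c: "continuous_on UNIV \<rho>" and \<rho>B: "\<And>y. norm (\<rho> y) \<le> B"
    and R0: "R 0 = 0"
  obtains u ut where "mode_sol k U U1 u ut" "\<And>y. u 0 y = 0" "\<And>y. y \<ge> 0 \<Longrightarrow> ut 0 y = R y"
proof -
  have Uc: "continuous_on {0..} U"
    by (rule DERIV_continuous_on) (use dU in auto)
  define A where "A y = complex_of_real (U \<bar>y\<bar>)" for y
  define A2 where "A2 y = complex_of_real (U2 \<bar>y\<bar>)" for y
  have Ac: "continuous_on UNIV A" "continuous_on UNIV A2"
    unfolding A_def A2_def
    by (intro continuous_intros continuous_on_compose2[OF Uc] continuous_on_compose2[OF U2c]; auto)+
  define \<rho>e where "\<rho>e y = \<rho> \<bar>y\<bar>" for y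
  have \<rho>e: "continuous_on UNIV \<rho>e"
    unfolding \<rho>e_def by (intro continuous_on_compose2[OF \<rho>c] continuous_intros) auto
  have M0: "M \<ge> 0" using UM[of 0] by simp
  \<comment> \<open>With \<pi> = u_ty and u = 0 at time 0, \<open>Q\<close> is the y-derivative of
    u_t + u, \<open>q\<close> is u_t + u, and \<open>\<Psi>\<close> is its stream function.
    \<open>G\<close> is the source of the wave equation for u_y, obtained by differentiating the
    mode equation in y; the two terms U' (u_t + u) cancel in it.\<close>
  define Q where "Q \<pi> = (\<lambda>s y. \<pi> s y + prim (\<lambda>r. \<pi> r y) s)" for \<pi> :: "real \<Rightarrow> real \<Rightarrow> complex"
  define q where "q \<pi> = (\<lambda>s. prim (Q \<pi> s))" for \<pi>
  define \<Psi> where "\<Psi> \<pi> = (\<lambda>s. prim (q \<pi> s))" for \<pi>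
  define G where "G \<pi> = (\<lambda>s y. - (\<pi> s \<bar>y\<bar> + \<i> * k * (A y * Q \<pi> s \<bar>y\<bar> - A2 y * \<Psi> \<pi> s \<bar>y\<bar>)))" for \<pi>
  have Qc: "cont2 (Q \<pi>)" if "cont2 \<pi>" for \<pi>
    unfolding Q_def by (intro continuous_intros that cont2_prim1)
  have qc: "cont2 (q \<pi>)" if "cont2 \<pi>" for \<pi>
    unfolding q_def by (intro cont2_prim2 Qc that)
  have \<Psi>c: "cont2 (\<Psi> \<pi>)" if "cont2 \<pi>" for \<pi>
    unfolding \<Psi>_def by (intro cont2_prim2 qc that)
  have Gc: "cont2 (G \<pi>)" if "cont2 \<pi>" for \<pi>
    unfolding G_def
    by (intro continuous_intros cont2_compose[OF that] cont2_compose[OF Qc[OF that]]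
        cont2_compose[OF \<Psi>c[OF that]] continuous_on_compose2[OF Ac(1)] continuous_on_compose2[OF Ac(2)]) auto
  have slice: "continuous_on UNIV (f s)" "continuous_on UNIV (\<lambda>s. f s y)" if "cont2 f" for f :: "real \<Rightarrow> real \<Rightarrow> complex" and s y
    by (intro cont2_compose[OF that] continuous_intros)+
  have lin: "Q (\<lambda>s y. \<pi> s y - \<pi>' s y) s y = Q \<pi> s y - Q \<pi>' s y" if "cont2 \<pi>" "cont2 \<pi>'" for \<pi> \<pi>' s y
    using prim_diff[OF slice(2)[OF that(1)] slice(2)[OF that(2)]] by (simp add: Q_def)
  have qlin: "q (\<lambda>s y. \<pi> s y - \<pi>' s y) s y = q \<pi> s y - q \<pi>' s y" if "cont2 \<pi>" "cont2 \<pi>'" for \<pi> \<pi>' s y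
    using prim_diff[OF slice(1)[OF Qc[OF that(1)]] slice(1)[OF Qc[OF that(2)]]]
    by (simp add: q_def lin[OF that, abs_def])
  have \<Psi>lin: "\<Psi> (\<lambda>s y. \<pi> s y - \<pi>' s y) s y = \<Psi> \<pi> s y - \<Psi> \<pi>' s y" if "cont2 \<pi>" "cont2 \<pi>'" for \<pi> \<pi>' s y
    using prim_diff[OF slice(1)[OF qc[OF that(1)]] slice(1)[OF qc[OF that(2)]]]
    by (simp add: \<Psi>_def qlin[OF that, abs_def])
  \<comment> \<open>The 1 stands for \<pi> itself. Each 2 M bounds one transport term: the 2 comes
    from \<open>Q\<close> being \<pi> plus its time integral, and the decay of \<open>U2\<close>
    compensates the growth y^2 of \<open>\<Psi>\<close>.\<close>
  define C where "C = 1 + \<bar>k\<bar> * (2 * M + 2 * M)"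
  have Gb: "norm (G \<pi> s y) \<le> C * B * exp (L * \<bar>s\<bar>)"
    if \<pi>: "cont2 \<pi>" and L: "L \<ge> 1" and b: "\<And>s y. norm (\<pi> s y) \<le> B * exp (L * \<bar>s\<bar>)" for \<pi> L B s y
  proof -
    have B0: "B \<ge> 0" using order_trans[OF norm_ge_zero b[of 0 0]] by simp
    define e where "e = B * exp (L * \<bar>s\<bar>)"
    have e0: "e \<ge> 0" using B0 by (simp add: e_def)
    have Qb: "norm (Q \<pi> s z) \<le> 2 * e" for z
    proof -
      have "norm (prim (\<lambda>r. \<pi> r z) s) \<le> B / L * exp (L * \<bar>s\<bar>)"
        using prim_exp_bound[OF slice(2)[OF \<pi>] _ b] L by simp
      also have "\<dots> \<le> e"
        unfolding e_def using L B0 mult_left_mono[of 1 L B]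
        by (intro mult_right_mono) (auto simp: pos_divide_le_eq)
      finally show ?thesis
        using b[of s z] norm_triangle_ineq[of "\<pi> s z" "prim (\<lambda>r. \<pi> r z) s"]
        unfolding Q_def e_def by linarith
    qed
    have "norm (q \<pi> s z) \<le> 2 * e * \<bar>z\<bar> ^ Suc 0" for z
      unfolding q_def by (rule prim_norm_bound_abs[OF slice(1)[OF Qc[OF \<pi>]]]) (use Qb e0 in auto)
    then have \<Psi>b: "norm (\<Psi> \<pi> s z) \<le> 2 * e * \<bar>z\<bar> ^ Suc (Suc 0)" for z
      unfolding \<Psi>_def by (rule prim_norm_bound_abs[OF slice(1)[OF qc[OF \<pi>]]]) (use e0 in auto)
    have 1: "norm (A y * Q \<pi> s \<bar>y\<bar>) \<le> M * (2 * e)"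
      unfolding norm_mult by (intro mult_mono Qb) (use UM[of "\<bar>y\<bar>"] M0 in \<open>auto simp: A_def\<close>)
    have "norm (A2 y * \<Psi> \<pi> s \<bar>y\<bar>) \<le> \<bar>U2 \<bar>y\<bar>\<bar> * (2 * e * \<bar>\<bar>y\<bar>\<bar> ^ Suc (Suc 0))"
      unfolding norm_mult by (intro mult_mono \<Psi>b) (auto simp: A2_def)
    also have "\<dots> = \<bar>U2 \<bar>y\<bar>\<bar> * \<bar>y\<bar>\<^sup>2 * (2 * e)" by (simp add: power2_eq_square)
    also have "\<dots> \<le> M * (2 * e)" using U2M[of "\<bar>y\<bar>"] e0 by (intro mult_right_mono) auto
    finally have 2: "norm (A2 y * \<Psi> \<pi> s \<bar>y\<bar>) \<le> M * (2 * e)" .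
    have "norm (\<i> * k * (A y * Q \<pi> s \<bar>y\<bar> - A2 y * \<Psi> \<pi> s \<bar>y\<bar>)) \<le> \<bar>k\<bar> * (M * (2 * e) + M * (2 * e))"
      using norm_triangle_ineq4[of "A y * Q \<pi> s \<bar>y\<bar>" "A2 y * \<Psi> \<pi> s \<bar>y\<bar>"] 1 2
      by (auto simp: norm_mult intro!: mult_left_mono)
    then have "norm (G \<pi> s y) \<le> e + \<bar>k\<bar> * (M * (2 * e) + M * (2 * e))"
      using b[of s "\<bar>y\<bar>"] norm_triangle_ineq[of "\<pi> s \<bar>y\<bar>" "\<i> * k * (A y * Q \<pi> s \<bar>y\<bar> - A2 y * \<Psi> \<pi> s \<bar>y\<bar>)"]
      unfolding G_def norm_minus_cancel e_def by linarith
    then show ?thesis by (simp add: C_def e_def algebra_simps)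
  qed
  obtain \<pi> where \<pi>: "cont2 \<pi>" and fp: "\<And>t y. \<pi> t y = wave_step \<rho>e (G \<pi>) t y"
  proof (rule wave_fixed_point[of G C \<rho>e B])
    show "cont2 (G \<pi>)" if "cont2 \<pi>" for \<pi> by (rule Gc[OF that])
    show "G \<pi> s y - G \<pi>' s y = G (\<lambda>s y. \<pi> s y - \<pi>' s y) s y" if "cont2 \<pi>" "cont2 \<pi>'" for \<pi> \<pi>' s y
      by (simp add: G_def lin[OF that] \<Psi>lin[OF that] algebra_simps)
    show "C \<ge> 0" using M0 by (simp add: C_def)
    show "norm (\<rho>e y) \<le> B" for y using \<rho>B by (simp add: \<rho>e_def)
  qed (use Gb \<rho>e in blast)+
  define g where "g = G \<pi>"
  have g: "cont2 g" unfolding g_def by (rule Gc[OF \<pi>])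
  obtain Z where Z: "cont2 Z"
    "\<And>t y. ((\<lambda>s. prim (\<pi> s) y) has_vector_derivative Z t y + prim (g t) y) (at t)"
    "\<And>t y. ((\<lambda>z. prim (\<lambda>s. \<pi> s z) t) has_vector_derivative Z t y) (at y)"
  proof (rule wave_step_integral_formulas[OF g \<rho>e])
    show "g s (- y) = g s y" for s y by (simp add: g_def G_def A_def A2_def)
    show "\<rho>e (- y) = \<rho>e y" for y by (simp add: \<rho>e_def)
    show "\<pi> t y = wave_step \<rho>e g t y" for t y using fp by (simp add: g_def)
  qed blast
  define ut where "ut = (\<lambda>t. prim (\<pi> t))"
  define uy where "uy = (\<lambda>t y. prim (\<lambda>s. \<pi> s y) t)"
  define u where "u = (\<lambda>t y. prim (\<lambda>s. ut s y) t)"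
  have utc: "cont2 ut" unfolding ut_def by (rule cont2_prim2[OF \<pi>])
  have uyc: "cont2 uy" unfolding uy_def by (rule cont2_prim1[OF \<pi>])
  have uc: "cont2 u" unfolding u_def by (rule cont2_prim1[OF utc])
  have d_ut_y: "(ut t has_vector_derivative \<pi> t y) (at y)" for t y
    unfolding ut_def by (rule prim_has_vector_derivative[OF slice(1)[OF \<pi>]])
  have d_u_t: "((\<lambda>s. u s y) has_vector_derivative ut t y) (at t)" for t y
    unfolding u_def by (rule prim_has_vector_derivative[OF slice(2)[OF utc]])
  have d_u_y: "(u t has_vector_derivative uy t y) (at y)" for t y
    unfolding u_def uy_def by (rule prim_param_has_vector_derivative[OF d_ut_y utc \<pi>])
  have d_uy_t: "((\<lambda>s. uy s y) has_vector_derivative \<pi> t y) (at t)" for t y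
    unfolding uy_def by (rule prim_has_vector_derivative[OF slice(2)[OF \<pi>]])
  have u0: "u t 0 = 0" for t by (simp add: u_def ut_def prim_def)
  have qeq: "q \<pi> t y = ut t y + u t y" for t y
  proof -
    have "(\<lambda>s. prim (Q \<pi> t) s) y = (ut t y + u t y) - (ut t 0 + u t 0)"
      by (rule prim_unique) (auto simp: Q_def uy_def[symmetric] intro!: has_vector_derivative_add d_ut_y d_u_y
          simp flip: uy_def[THEN fun_cong, THEN fun_cong])
    then show ?thesis by (simp add: q_def u0 ut_def)
  qed
  have eq: "prim (g t) y = - (ut t y + \<i> * k * (U y * (ut t y + u t y)
         - U1 y * prim (\<lambda>z. ut t z + u t z) y))" if y: "y > 0" for t y
  proof -
    \<comment> \<open>\<open>?F\<close> is the lower-order part of the mode equation; its derivative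
      is g because the two products of \<open>U1\<close> and \<open>q\<close> cancel. Derivatives
      are taken within [0,y], as those of U and U' at 0 are one-sided.\<close>
    let ?F = "\<lambda>y. - (ut t y + \<i> * k * (U y * q \<pi> t y - U1 y * \<Psi> \<pi> t y))"
    have "(?F has_vector_derivative g t z) (at z within {0..y})" if z: "z \<in> {0..y}" for z
    proof -
      have dq: "(q \<pi> t has_vector_derivative Q \<pi> t z) (at z within {0..y})"
        unfolding q_def by (rule has_vector_derivative_at_within[OF
            prim_has_vector_derivative[OF slice(1)[OF Qc[OF \<pi>]]]])
      have d\<Psi>: "(\<Psi> \<pi> t has_vector_derivative q \<pi> t z) (at z within {0..y})"
        unfolding \<Psi>_def by (rule has_vector_derivative_at_within[OF
            prim_has_vector_derivative[OF slice(1)[OF qc[OF \<pi>]]]])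
      have dU': "((\<lambda>y. complex_of_real (U y)) has_vector_derivative U1 z) (at z within {0..y})"
        "((\<lambda>y. complex_of_real (U1 y)) has_vector_derivative U2 z) (at z within {0..y})"
        using DERIV_subset[OF dU, of z "{0..y}"] DERIV_subset[OF dU1, of z "{0..y}"] z
        by (auto intro!: has_vector_derivative_of_real)
      have "(?F has_vector_derivative - (\<pi> t z + \<i> * k * ((U z * Q \<pi> t z + U1 z * q \<pi> t z)
          - (U1 z * q \<pi> t z + U2 z * \<Psi> \<pi> t z)))) (at z within {0..y})"
        by (intro has_vector_derivative_minus has_vector_derivative_add has_vector_derivative_diff
            has_vector_derivative_mult dq d\<Psi> dU' has_vector_derivative_at_within[OF d_ut_y]
            has_vector_derivative_mult_right)
      then show ?thesis
        using z by (simp add: g_def G_def A_def A2_def)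
    qed
    then have "(g t has_integral (?F y - ?F 0)) {0..y}"
      using y by (intro fundamental_theorem_of_calculus) auto
    then have "prim (g t) y = ?F y - ?F 0"
      using prim_eq_integral[OF slice(1)[OF g]] y by (simp add: integral_unique)
    moreover have "?F 0 = 0" by (simp add: q_def \<Psi>_def ut_def)
    moreover have "\<Psi> \<pi> t y = prim (\<lambda>z. ut t z + u t z) y" by (simp add: \<Psi>_def qeq[abs_def])
    ultimately show ?thesis by (simp add: qeq)
  qed
  have "mode_sol k U U1 u ut"
    unfolding mode_sol_def
  proof (rule exI[of _ uy], rule exI[of _ "\<lambda>t y. Z t y + prim (g t) y"], rule exI[of _ \<pi>],
      rule exI[of _ Z], intro conjI allI impI)
    fix t y :: real assume "y > 0"
    then show "(Z t y + prim (g t) y) + ut t y + \<i> * k * (U y * (ut t y + u t y)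
         - U1 y * prim (\<lambda>z. ut t z + u t z) y) = Z t y" by (simp add: eq)
  next
    show "cont2 (\<lambda>t y. Z t y + prim (g t) y)"
      by (intro continuous_intros Z(1) cont2_prim2[OF g])
    show "((\<lambda>s. ut s y) has_vector_derivative Z t y + prim (g t) y) (at t)" for t y
      unfolding ut_def by (rule Z(2))
    show "(uy t has_vector_derivative Z t y) (at y)" for t y
      unfolding uy_def by (rule Z(3))
  qed (fact d_ut_y d_u_t d_u_y d_uy_t utc uyc uc \<pi> Z(1) u0)+
  moreover have "ut 0 y = R y" if "y \<ge> 0" for y
  proof -
    have "\<pi> 0 z = \<rho> z" if "z \<in> closed_segment 0 y" for z
      using that \<open>y \<ge> 0\<close> by (simp add: fp wave_step_def \<rho>e_def closed_segment_eq_real_ivl)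
    then have "ut 0 y = prim \<rho> y" unfolding ut_def by (rule prim_cong)
    then show ?thesis using prim_unique[OF dR, of y] R0 by simp
  qed
  moreover have "u 0 y = 0" for y by (simp add: u_def)
  ultimately show ?thesis using that by blast
qed

section \<open>From Fourier modes to solutions of the system\<close>

definition wave_x :: "int \<Rightarrow> real \<Rightarrow> complex" where
  "wave_x k x = exp (\<i> * of_int k * of_real x)"

lemma wave_x_has_vector_derivative:
  "(wave_x k has_vector_derivative \<i> * of_int k * wave_x k x) (at x within X)"
proof -
  have "((\<lambda>z. exp (\<i> * of_int k * z)) has_field_derivative exp (\<i> * of_int k * of_real x) * (\<i> * of_int k))
      (at (of_real x))"
    by (auto intro!: derivative_eq_intros)
  then have "((\<lambda>x. exp (\<i> * of_int k * of_real x)) has_vector_derivative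
      exp (\<i> * of_int k * of_real x) * (\<i> * of_int k)) (at x within X)"
    by (rule has_vector_derivative_real_field[where f="\<lambda>z. exp (\<i> * of_int k * z)"])
  then show ?thesis by (simp add: wave_x_def[abs_def] mult_ac)
qed

lemma continuous_on_wave_x [continuous_intros]:
  "continuous_on A f \<Longrightarrow> continuous_on A (\<lambda>p. wave_x k (f p))"
  unfolding wave_x_def by (intro continuous_intros)

lemma wave_x_periodic: "wave_x k (x + 2 * pi) = wave_x k x"
proof -
  have "wave_x k (x + 2 * pi) = wave_x k x * exp (of_int k * (2 * of_real pi * \<i>))"
    by (simp add: wave_x_def algebra_simps flip: exp_add)
  also have "exp (of_int k * (2 * of_real pi * \<i>)) = 1"
    using exp_integer_2pi[of "of_int k"] by (simp add: mult_ac)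
  finally show ?thesis by simp
qed

definition mode3 :: "int \<Rightarrow> (real \<Rightarrow> real \<Rightarrow> complex) \<Rightarrow> real \<times> real \<times> real \<Rightarrow> complex" where
  "mode3 k g p = wave_x k (fst (snd p)) * g (fst p) (snd (snd p))"

lemma continuous_on_mode3:
  assumes "cont2 g" shows "continuous_on A (mode3 k g)"
  unfolding mode3_def by (intro continuous_intros cont2_compose[OF assms])

lemma mode3_has_derivative:
  assumes d1: "\<And>t y. ((\<lambda>s. g s y) has_vector_derivative g1 t y) (at t)"
    and d2: "\<And>t y. (g t has_vector_derivative g2 t y) (at y)"
    and c2: "cont2 g2"
  shows "(mode3 k g has_derivative (\<lambda>h. fst h *\<^sub>R mode3 k g1 p
    + fst (snd h) *\<^sub>R (\<i> * of_int k * mode3 k g p) + snd (snd h) *\<^sub>R mode3 k g2 p)) (at p)"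
proof -
  have "((\<lambda>p. (fst p, snd (snd p))) has_derivative (\<lambda>h. (fst h, snd (snd h)))) (at p)"
    for p :: "real \<times> real \<times> real"
    by (intro derivative_intros)
  from has_derivative_compose[OF this has_derivative_partials2[OF d1 d2 c2]]
  have A: "((\<lambda>p. g (fst p) (snd (snd p))) has_derivative
      (\<lambda>h. fst h *\<^sub>R g1 (fst p) (snd (snd p)) + snd (snd h) *\<^sub>R g2 (fst p) (snd (snd p)))) (at p)"
    by simp
  have "((\<lambda>p. fst (snd p)) has_derivative (\<lambda>h. fst (snd h))) (at p)"
    for p :: "real \<times> real \<times> real"
    by (intro derivative_intros)
  from has_derivative_compose[OF this wave_x_has_vector_derivative[unfolded has_vector_derivative_def]]
  have B: "((\<lambda>p. wave_x k (fst (snd p))) has_derivative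
      (\<lambda>h. fst (snd h) *\<^sub>R (\<i> * of_int k * wave_x k (fst (snd p))))) (at p)" .
  from has_derivative_mult[OF B A] show ?thesis
    unfolding mode3_def
    by (rule has_derivative_eq_rhs) (auto simp: fun_eq_iff algebra_simps)
qed

lemma C2_on_mode3:
  assumes u_t: "\<And>t y. ((\<lambda>s. u s y) has_vector_derivative ut t y) (at t)"
    and u_y: "\<And>t y. (u t has_vector_derivative uy t y) (at y)"
    and ut_t: "\<And>t y. ((\<lambda>s. ut s y) has_vector_derivative utt t y) (at t)"
    and ut_y: "\<And>t y. (ut t has_vector_derivative uty t y) (at y)"
    and uy_t: "\<And>t y. ((\<lambda>s. uy s y) has_vector_derivative uty t y) (at t)"
    and uy_y: "\<And>t y. (uy t has_vector_derivative uyy t y) (at y)"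
    and c: "cont2 u" "cont2 ut" "cont2 uy" "cont2 utt" "cont2 uty" "cont2 uyy"
  shows "C2_on UNIV (mode3 k u)"
proof -
  note d0 = mode3_has_derivative[OF u_t u_y c(3), of k]
  note dt = mode3_has_derivative[OF ut_t ut_y c(5), of k]
  note dy = mode3_has_derivative[OF uy_t uy_y c(6), of k]
  have f0: "frechet_derivative (mode3 k u) (at p) = (\<lambda>h. fst h *\<^sub>R mode3 k ut p
    + fst (snd h) *\<^sub>R (\<i> * of_int k * mode3 k u p) + snd (snd h) *\<^sub>R mode3 k uy p)" for p
    using frechet_derivative_at[OF d0] by simp
  define D where "D v h p = fst v *\<^sub>R (fst h *\<^sub>R mode3 k utt p
    + fst (snd h) *\<^sub>R (\<i> * of_int k * mode3 k ut p) + snd (snd h) *\<^sub>R mode3 k uty p)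
    + fst (snd v) *\<^sub>R (\<i> * of_int k * (fst h *\<^sub>R mode3 k ut p
    + fst (snd h) *\<^sub>R (\<i> * of_int k * mode3 k u p) + snd (snd h) *\<^sub>R mode3 k uy p))
    + snd (snd v) *\<^sub>R (fst h *\<^sub>R mode3 k uty p
    + fst (snd h) *\<^sub>R (\<i> * of_int k * mode3 k uy p) + snd (snd h) *\<^sub>R mode3 k uyy p)"
    for v h p :: "real \<times> real \<times> real"
  have d2: "((\<lambda>p. frechet_derivative (mode3 k u) (at p) v) has_derivative (\<lambda>h. D v h p)) (at p)" for v p
    unfolding f0 D_def
    by (intro has_derivative_add has_derivative_scaleR_right has_derivative_mult_right dt dy d0)
  have f2: "frechet_derivative (\<lambda>p. frechet_derivative (mode3 k u) (at p) v) (at p) = (\<lambda>h. D v h p)" for v p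
    using frechet_derivative_at[OF d2] by simp
  show ?thesis
    unfolding C2_on_def
  proof (intro conjI allI)
    show "mode3 k u differentiable_on UNIV"
      unfolding differentiable_on_def differentiable_def using d0 by blast
    show "(\<lambda>p. frechet_derivative (mode3 k u) (at p) v) differentiable_on UNIV" for v
      unfolding differentiable_on_def differentiable_def using d2 by blast
    show "continuous_on UNIV (\<lambda>p. frechet_derivative (\<lambda>q. frechet_derivative (mode3 k u) (at q) v) (at p) w)" for v w
      unfolding f2 D_def by (intro continuous_intros continuous_on_mode3 c)
  qed simp
qed

section \<open>Fourier coefficients and norms of a single mode\<close>

lemma fcoef_mode:
  "fcoef (\<lambda>x y. wave_x k x * g y) j = (\<lambda>y. if j = k then g y else 0)"
proof
  fix y
  have "wave_x k x * exp (- \<i> * of_int j * of_real x) = wave_x (k - j) x" for x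
    unfolding wave_x_def exp_add[symmetric] by (simp add: algebra_simps)
  then have e: "fcoef (\<lambda>x y. wave_x k x * g y) j y = 1 / (2 * pi) * integral {0..2*pi} (\<lambda>x. wave_x (k - j) x * g y)"
    unfolding fcoef_def by (simp only: mult.assoc mult.left_commute[of _ "g y"] mult.commute[of _ "g y"])
  show "fcoef (\<lambda>x y. wave_x k x * g y) j y = (if j = k then g y else 0)"
  proof (cases "j = k")
    case True
    then show ?thesis unfolding e by (simp add: wave_x_def scaleR_conv_of_real)
  next
    case False
    define n where "n = k - j"
    have n: "n \<noteq> 0" using False by (simp add: n_def)
    have "((\<lambda>x. wave_x n x * g y) has_integral
       (wave_x n (2*pi) * g y / (\<i> * of_int n) - wave_x n 0 * g y / (\<i> * of_int n))) {0..2*pi}"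
    proof (rule fundamental_theorem_of_calculus)
      fix x
      have "((\<lambda>x. wave_x n x * (g y / (\<i> * of_int n))) has_vector_derivative
          (\<i> * of_int n * wave_x n x) * (g y / (\<i> * of_int n))) (at x within {0..2*pi})"
        by (intro has_vector_derivative_mult_left wave_x_has_vector_derivative)
      then show "((\<lambda>x. wave_x n x * g y / (\<i> * of_int n)) has_vector_derivative wave_x n x * g y)
          (at x within {0..2*pi})"
        using n by simp
    qed simp
    moreover have "wave_x n (2 * pi) = wave_x n 0"
      using wave_x_periodic[of n 0] by simp
    ultimately have "((\<lambda>x. wave_x n x * g y) has_integral 0) {0..2*pi}"
      by simp
    from integral_unique[OF this] have "integral {0..2*pi} (\<lambda>x. wave_x n x * g y) = 0" .
    then show ?thesis using False unfolding e n_def[symmetric] by simp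
  qed
qed

lemma Hm_norm_mode:
  assumes N0: "N (\<lambda>_. 0) = 0"
  shows "Hm_norm m N (\<lambda>x y. wave_x k x * g y) =
    (let S = ennreal ((1 + (real_of_int k)\<^sup>2) powr m) * (N g)\<^sup>2
     in if S = \<infinity> then \<infinity> else ennreal (sqrt (enn2real S)))"
proof -
  let ?T = "\<lambda>j::int. ennreal ((1 + (real_of_int j)\<^sup>2) powr m) *
      (N (fcoef (\<lambda>x y. wave_x k x * g y) j))\<^sup>2"
  have "?T j = 0" if "j \<noteq> k" for j
    using that N0 by (simp add: fcoef_mode)
  then have "infsum ?T UNIV = infsum ?T {k}"
    by (intro infsum_cong_neutral) auto
  also have "\<dots> = ?T k" by simp
  also have "\<dots> = ennreal ((1 + (real_of_int k)\<^sup>2) powr m) * (N g)\<^sup>2"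
    by (simp add: fcoef_mode)
  finally show ?thesis unfolding Hm_norm_def by (simp only:)
qed

lemma sqrt_weight: "sqrt ((1 + (k::real)\<^sup>2) powr m * c\<^sup>2) = (1 + k\<^sup>2) powr (m / 2) * \<bar>c\<bar>"
proof -
  have "(1 + k\<^sup>2) powr m = ((1 + k\<^sup>2) powr (m / 2))\<^sup>2"
    by (simp add: power2_eq_square flip: powr_add)
  then show ?thesis by (simp add: real_sqrt_mult)
qed

lemma Hm_norm_mode_le:
  assumes N0: "N (\<lambda>_. 0) = 0" and "N g \<le> ennreal c" "c \<ge> 0"
  shows "Hm_norm m N (\<lambda>x y. wave_x k x * g y) \<le> ennreal ((1 + (real_of_int k)\<^sup>2) powr (m / 2) * c)"
proof -
  define S where "S = ennreal ((1 + (real_of_int k)\<^sup>2) powr m) * (N g)\<^sup>2"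
  have "S \<le> ennreal ((1 + (real_of_int k)\<^sup>2) powr m) * (ennreal c)\<^sup>2"
    unfolding S_def by (intro mult_left_mono power_mono assms) auto
  also have "\<dots> = ennreal ((1 + (real_of_int k)\<^sup>2) powr m * c\<^sup>2)"
    using assms by (simp add: ennreal_power ennreal_mult'')
  finally have S: "S \<le> ennreal ((1 + (real_of_int k)\<^sup>2) powr m * c\<^sup>2)" .
  then have "S \<noteq> \<infinity>" using top.extremum_uniqueI[of S] by (auto simp: top_unique)
  moreover have "enn2real S \<le> (1 + (real_of_int k)\<^sup>2) powr m * c\<^sup>2"
    using S by (intro enn2real_leI) auto
  then have "sqrt (enn2real S) \<le> (1 + (real_of_int k)\<^sup>2) powr (m / 2) * c"
    using real_sqrt_le_mono[of "enn2real S"] assms by (fastforce simp: sqrt_weight)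
  ultimately show ?thesis
    unfolding Hm_norm_mode[of N, OF N0] S_def[symmetric] Let_def by (auto intro: ennreal_leI)
qed

lemma Hm_norm_mode_ge:
  assumes N0: "N (\<lambda>_. 0) = 0" and "ennreal c \<le> N g" "c \<ge> 0"
  shows "ennreal ((1 + (real_of_int k)\<^sup>2) powr (m / 2) * c) \<le> Hm_norm m N (\<lambda>x y. wave_x k x * g y)"
proof -
  define S where "S = ennreal ((1 + (real_of_int k)\<^sup>2) powr m) * (N g)\<^sup>2"
  have "ennreal ((1 + (real_of_int k)\<^sup>2) powr m * c\<^sup>2) = ennreal ((1 + (real_of_int k)\<^sup>2) powr m) * (ennreal c)\<^sup>2"
    using assms by (simp add: ennreal_power ennreal_mult'')
  also have "\<dots> \<le> S"
    unfolding S_def by (intro mult_left_mono power_mono assms) auto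
  finally have S: "ennreal ((1 + (real_of_int k)\<^sup>2) powr m * c\<^sup>2) \<le> S" .
  have "(1 + (real_of_int k)\<^sup>2) powr (m / 2) * c \<le> sqrt (enn2real S)" if "S \<noteq> \<infinity>"
  proof -
    have "(1 + (real_of_int k)\<^sup>2) powr m * c\<^sup>2 \<le> enn2real S"
      using enn2real_mono[OF S] that by (simp add: top.not_eq_extremum)
    from real_sqrt_le_mono[OF this] show ?thesis using assms by (simp add: sqrt_weight)
  qed
  then show ?thesis
    unfolding Hm_norm_mode[of N, OF N0] S_def[symmetric] Let_def by (auto intro: ennreal_leI)
qed

lemma W0a_norm_le: "(\<And>y. y \<ge> 0 \<Longrightarrow> exp (\<alpha> * y) * norm (g y) \<le> c) \<Longrightarrow> W0a_norm \<alpha> g \<le> ennreal c"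
  unfolding W0a_norm_def sup_norm_def by (intro SUP_least ennreal_leI) (auto simp: norm_mult)

lemma W0a_norm_ge: "y \<ge> 0 \<Longrightarrow> ennreal (exp (\<alpha> * y) * norm (g y)) \<le> W0a_norm \<alpha> g"
  unfolding W0a_norm_def sup_norm_def by (rule SUP_upper2[of y]) (auto simp: norm_mult)

lemma W1a_norm_le:
  fixes g :: "real \<Rightarrow> complex"
  assumes "\<And>y. y \<ge> 0 \<Longrightarrow> exp (\<alpha> * y) * norm (g y) \<le> c"
    and "\<And>y z. y \<ge> 0 \<Longrightarrow> z \<ge> 0 \<Longrightarrow> norm (of_real (exp (\<alpha> * y)) * g y - of_real (exp (\<alpha> * z)) * g z) \<le> d * \<bar>y - z\<bar>"
    and "c \<ge> 0" "d \<ge> 0"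
  shows "W1a_norm \<alpha> g \<le> ennreal (c + d)"
proof -
  have "sup_norm (\<lambda>y. of_real (exp (\<alpha> * y)) * g y) \<le> ennreal c"
    using W0a_norm_le[OF assms(1)] by (simp add: W0a_norm_def)
  moreover have "lip_const (\<lambda>y. of_real (exp (\<alpha> * y)) * g y) \<le> ennreal d"
    unfolding lip_const_def
    by (intro SUP_least ennreal_leI) (use assms(2) in \<open>auto simp: pos_divide_le_eq\<close>)
  ultimately show ?thesis
    unfolding W1a_norm_def using assms by (simp add: add_mono)
qed

lemma W0a_norm_zero: "W0a_norm \<alpha> (\<lambda>_. 0) = 0"
  using W0a_norm_le[of \<alpha> "\<lambda>_. 0" 0] by simp

lemma W1a_norm_zero: "W1a_norm \<alpha> (\<lambda>_. 0) = 0"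
  using W1a_norm_le[of \<alpha> "\<lambda>_. 0" 0 0] by simp

lemma analytic_x_mode:
  assumes "N (\<lambda>_. 0) = 0" "N g \<le> ennreal c"
  shows "analytic_x N (\<lambda>x y. wave_x k x * g y)"
  unfolding analytic_x_def
proof (rule exI[of _ "1::real"], rule conjI, simp, rule exI[of _ "exp \<bar>real_of_int k\<bar> * c"], rule allI)
  fix j :: int
  have "ennreal (exp \<bar>real_of_int k\<bar>) * N g \<le> ennreal (exp \<bar>real_of_int k\<bar>) * ennreal c"
    by (intro mult_left_mono assms) auto
  then show "ennreal (exp (1 * \<bar>real_of_int j\<bar>)) * N (fcoef (\<lambda>x y. wave_x k x * g y) j)
      \<le> ennreal (exp \<bar>real_of_int k\<bar> * c)"
    using assms(1) by (cases "j = k") (simp_all add: fcoef_mode ennreal_mult')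
qed

text \<open>\<open>deriv U\<close> is a two-sided derivative, known for y > 0, which is where the
  equations are required. There v is \<open>prim (u t)\<close> up to a factor, so the derivatives in
  t and y follow from the rules for \<open>prim\<close>.\<close>

lemma mode_sol_system:
  fixes k :: int
  assumes sol: "mode_sol (of_int k) U U1 u ut" and dU: "\<And>y. y > 0 \<Longrightarrow> deriv U y = U1 y"
  defines "W \<equiv> \<lambda>t x y. wave_x k x * u t y"
  shows "C2_on UNIV (\<lambda>(t, x, y). W t x y)"
    and "pd_t W t x y = wave_x k x * ut t y"
    and "let v = (\<lambda>t x y. - integral {0..y} (\<lambda>z. pd_x W t x z));
          w = (\<lambda>t x y. pd_t W t x y + of_real (U y) * pd_x W t x y + v t x y * of_real (deriv U y))
      in (\<forall>t>0. \<forall>x. \<forall>y>0.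
            pd_t w t x y + w t x y - pd_y (pd_y W) t x y = 0 \<and>
            pd_x W t x y + pd_y v t x y = 0) \<and>
         (\<forall>x. \<forall>y\<ge>0. W 0 x y = wave_x k x * u 0 y \<and> pd_t W 0 x y = wave_x k x * ut 0 y) \<and>
         (\<forall>t\<ge>0. \<forall>x. W t x 0 = 0 \<and> v t x 0 = 0)"
proof -
  obtain uy utt uty uyy where
    u_t: "\<And>t y. ((\<lambda>s. u s y) has_vector_derivative ut t y) (at t)"
    and u_y: "\<And>t y. (u t has_vector_derivative uy t y) (at y)"
    and ut_t: "\<And>t y. ((\<lambda>s. ut s y) has_vector_derivative utt t y) (at t)"
    and ut_y: "\<And>t y. (ut t has_vector_derivative uty t y) (at y)"
    and uy_t: "\<And>t y. ((\<lambda>s. uy s y) has_vector_derivative uty t y) (at t)"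
    and uy_y: "\<And>t y. (uy t has_vector_derivative uyy t y) (at y)"
    and c: "cont2 u" "cont2 ut" "cont2 uy" "cont2 utt" "cont2 uty" "cont2 uyy"
    and u0: "\<And>t. u t 0 = 0"
    and eq: "\<And>t y. y > 0 \<Longrightarrow> utt t y + ut t y + \<i> * complex_of_real (of_int k) * (U y * (ut t y + u t y)
         - U1 y * prim (\<lambda>z. ut t z + u t z) y) = uyy t y"
    using sol unfolding mode_sol_def by blast
  have slice: "continuous_on UNIV (f s)" if "cont2 f" for f :: "real \<Rightarrow> real \<Rightarrow> complex" and s
    by (intro cont2_compose[OF that] continuous_intros)
  have "(\<lambda>(t, x, y). W t x y) = mode3 k u"
    by (auto simp: W_def mode3_def fun_eq_iff)
  then show "C2_on UNIV (\<lambda>(t, x, y). W t x y)"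
    using C2_on_mode3[OF u_t u_y ut_t ut_y uy_t uy_y c] by simp
  have pt: "pd_t W t x y = wave_x k x * ut t y" for t x y
    unfolding pd_t_def W_def
    by (intro vector_derivative_at has_vector_derivative_mult_right u_t)
  then show "pd_t W t x y = wave_x k x * ut t y" .
  have px: "pd_x W t x y = \<i> * of_int k * wave_x k x * u t y" for t x y
    unfolding pd_x_def W_def
    by (intro vector_derivative_at has_vector_derivative_mult_left wave_x_has_vector_derivative)
  have py: "pd_y W = (\<lambda>t x y. wave_x k x * uy t y)"
    unfolding pd_y_def W_def fun_eq_iff
    by (intro allI vector_derivative_at has_vector_derivative_mult_right u_y)
  have pyy: "pd_y (pd_y W) t x y = wave_x k x * uyy t y" for t x y
    unfolding py unfolding pd_y_def
    by (intro vector_derivative_at has_vector_derivative_mult_right uy_y)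
  define v where "v = (\<lambda>t x y. - integral {0..y} (\<lambda>z. pd_x W t x z))"
  define w where "w = (\<lambda>t x y. pd_t W t x y + of_real (U y) * pd_x W t x y + v t x y * of_real (deriv U y))"
  have v: "v t x y = - (\<i> * of_int k * wave_x k x * prim (u t) y)" if "y \<ge> 0" for t x y
    unfolding v_def px using that by (simp add: prim_eq_integral[OF slice[OF c(1)]])
  have w: "w t x y = wave_x k x * (ut t y + \<i> * of_int k * (U y * u t y - U1 y * prim (u t) y))"
    if "y > 0" for t x y
    unfolding w_def pt px using that by (simp add: v dU algebra_simps)
  have pw: "pd_t w t x y = wave_x k x * (utt t y + \<i> * of_int k * (U y * ut t y - U1 y * prim (ut t) y))"
    if "y > 0" for t x y
  proof -
    have "((\<lambda>s. prim (u s) y) has_vector_derivative prim (ut t) y) (at t)"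
    proof (rule prim_param_has_vector_derivative[of "\<lambda>z s. u s z" "\<lambda>z s. ut s z"])
      show "((\<lambda>s. u s z) has_vector_derivative ut s z) (at s)" for z s by (rule u_t)
    qed (intro cont2_compose[OF c(1)] cont2_compose[OF c(2)] continuous_intros)+
    then show ?thesis
      unfolding pd_t_def w[OF that]
      by (intro vector_derivative_at has_vector_derivative_mult_right has_vector_derivative_add
          has_vector_derivative_diff u_t ut_t)
  qed
  have pv: "pd_y v t x y = - (\<i> * of_int k * wave_x k x * u t y)" if "y > 0" for t x y
    unfolding pd_y_def
  proof (rule vector_derivative_at)
    have "((\<lambda>y. - (\<i> * of_int k * wave_x k x * prim (u t) y)) has_vector_derivative
        - (\<i> * of_int k * wave_x k x * u t y)) (at y)"
      by (intro has_vector_derivative_minus has_vector_derivative_mult_right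
          prim_has_vector_derivative slice[OF c(1)])
    then show "(v t x has_vector_derivative - (\<i> * of_int k * wave_x k x * u t y)) (at y)"
      by (rule has_vector_derivative_transform_within_open[of _ _ _ "{0<..}"]) (use that v in auto)
  qed
  have "pd_t w t x y + w t x y - pd_y (pd_y W) t x y = 0 \<and> pd_x W t x y + pd_y v t x y = 0"
    if "y > 0" for t x y
  proof
    have "pd_t w t x y + w t x y - pd_y (pd_y W) t x y
      = wave_x k x * (utt t y + ut t y + \<i> * complex_of_real (of_int k) * (U y * (ut t y + u t y)
         - U1 y * prim (\<lambda>z. ut t z + u t z) y) - uyy t y)"
      unfolding w[OF that] pw[OF that] pyy prim_add[OF slice[OF c(2)] slice[OF c(1)]]
      by (simp add: algebra_simps)
    also have "\<dots> = 0" using eq[OF that, of t] by simp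
    finally show "pd_t w t x y + w t x y - pd_y (pd_y W) t x y = 0" .
    show "pd_x W t x y + pd_y v t x y = 0" by (simp add: px pv that)
  qed
  then have "(\<forall>t>0. \<forall>x. \<forall>y>0.
            pd_t w t x y + w t x y - pd_y (pd_y W) t x y = 0 \<and>
            pd_x W t x y + pd_y v t x y = 0) \<and>
         (\<forall>x. \<forall>y\<ge>0. W 0 x y = wave_x k x * u 0 y \<and> pd_t W 0 x y = wave_x k x * ut 0 y) \<and>
         (\<forall>t\<ge>0. \<forall>x. W t x 0 = 0 \<and> v t x 0 = 0)"
    by (simp add: pt v) (simp add: W_def u0)
  then show "let v = (\<lambda>t x y. - integral {0..y} (\<lambda>z. pd_x W t x z));
          w = (\<lambda>t x y. pd_t W t x y + of_real (U y) * pd_x W t x y + v t x y * of_real (deriv U y))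
      in (\<forall>t>0. \<forall>x. \<forall>y>0.
            pd_t w t x y + w t x y - pd_y (pd_y W) t x y = 0 \<and>
            pd_x W t x y + pd_y v t x y = 0) \<and>
         (\<forall>x. \<forall>y\<ge>0. W 0 x y = wave_x k x * u 0 y \<and> pd_t W 0 x y = wave_x k x * ut 0 y) \<and>
         (\<forall>t\<ge>0. \<forall>x. W t x 0 = 0 \<and> v t x 0 = 0)"
    unfolding Let_def w_def v_def .
qed

text \<open>For one mode each Sobolev norm is the weight (1 + k^2)^(m/2) times the norm of the
  profile, and the supremum is bounded below by the value at \<open>t0\<close>, \<open>y0\<close>.
  The theorem thus becomes a set of scalar inequalities for one profile.\<close>

lemma inflation_from_mode_sol:
  fixes \<alpha> :: real and Us :: "real \<Rightarrow> real" and m \<mu> \<delta> :: real and k :: int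
  assumes sol: "mode_sol (of_int k) Us U1 u ut" and dU: "\<And>y. y > 0 \<Longrightarrow> deriv Us y = U1 y"
    and c1: "\<And>y. y \<ge> 0 \<Longrightarrow> exp (\<alpha> * y) * norm (u 0 y) \<le> c1"
    and c2: "\<And>y z. y \<ge> 0 \<Longrightarrow> z \<ge> 0 \<Longrightarrow>
      norm (of_real (exp (\<alpha> * y)) * u 0 y - of_real (exp (\<alpha> * z)) * u 0 z) \<le> c2 * \<bar>y - z\<bar>"
    and c3: "\<And>y. y \<ge> 0 \<Longrightarrow> exp (\<alpha> * y) * norm (ut 0 y) \<le> c3"
    and c0: "c1 \<ge> 0" "c2 \<ge> 0" "c3 \<ge> 0"
    and small: "(1 + (real_of_int k)\<^sup>2) powr (m / 2) * (c1 + c2 + c3) \<le> 1"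
    and large: "0 \<le> t0" "t0 \<le> \<delta>" "0 \<le> y0"
      "1 / \<delta> \<le> (1 + (real_of_int k)\<^sup>2) powr ((m - \<mu>) / 2) * (exp (\<alpha> * y0) * norm (u t0 y0))"
  shows "\<exists>(uin :: real \<Rightarrow> real \<Rightarrow> complex) (utin :: real \<Rightarrow> real \<Rightarrow> complex)
            (u :: real \<Rightarrow> real \<Rightarrow> real \<Rightarrow> complex) (S :: (real \<times> real \<times> real) set).
     (\<forall>x y. uin (x + 2*pi) y = uin x y \<and> utin (x + 2*pi) y = utin x y) \<and>
     analytic_x (W1a_norm \<alpha>) uin \<and> analytic_x (W0a_norm \<alpha>) utin \<and>
     Hm_norm m (W1a_norm \<alpha>) uin + Hm_norm m (W0a_norm \<alpha>) utin \<le> 1 \<and>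
     C2_on S (\<lambda>(t, x, y). u t x y) \<and> {0..} \<times> UNIV \<times> {0..} \<subseteq> S \<and>
     (\<forall>t x y. u t (x + 2*pi) y = u t x y) \<and>
     (let v = (\<lambda>t x y. - integral {0..y} (\<lambda>z. pd_x u t x z));
          w = (\<lambda>t x y. pd_t u t x y + of_real (Us y) * pd_x u t x y + v t x y * of_real (deriv Us y))
      in (\<forall>t>0. \<forall>x. \<forall>y>0.
            pd_t w t x y + w t x y - pd_y (pd_y u) t x y = 0 \<and>
            pd_x u t x y + pd_y v t x y = 0) \<and>
         (\<forall>x. \<forall>y\<ge>0. u 0 x y = uin x y \<and> pd_t u 0 x y = utin x y) \<and>
         (\<forall>t\<ge>0. \<forall>x. u t x 0 = 0 \<and> v t x 0 = 0)) \<and>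
     (SUP t\<in>{0..\<delta>}. Hm_norm (m - \<mu>) (W0a_norm \<alpha>) (u t)) \<ge> ennreal (1 / \<delta>)"
proof -
  define W where "W = (\<lambda>t x y. wave_x k x * u t y)"
  define Wt where "Wt = (\<lambda>x y. wave_x k x * ut 0 y)"
  have n1: "W1a_norm \<alpha> (u 0) \<le> ennreal (c1 + c2)"
    by (rule W1a_norm_le) (use c1 c2 c0 in auto)
  have n0: "W0a_norm \<alpha> (ut 0) \<le> ennreal c3"
    by (rule W0a_norm_le) (use c3 in auto)
  let ?K = "(1 + (real_of_int k)\<^sup>2) powr (m / 2)"
  show ?thesis
  proof (rule exI[of _ "W 0"], rule exI[of _ Wt], rule exI[of _ W], rule exI[of _ UNIV], intro conjI)
    show "\<forall>x y. W 0 (x + 2*pi) y = W 0 x y \<and> Wt (x + 2*pi) y = Wt x y"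
      by (simp add: W_def Wt_def wave_x_periodic)
    show "analytic_x (W1a_norm \<alpha>) (W 0)"
      unfolding W_def by (rule analytic_x_mode[of "W1a_norm \<alpha>", OF W1a_norm_zero n1])
    show "analytic_x (W0a_norm \<alpha>) Wt"
      unfolding Wt_def by (rule analytic_x_mode[of "W0a_norm \<alpha>", OF W0a_norm_zero n0])
    have "Hm_norm m (W1a_norm \<alpha>) (W 0) \<le> ennreal (?K * (c1 + c2))"
      unfolding W_def using c0 by (intro Hm_norm_mode_le[of "W1a_norm \<alpha>", OF W1a_norm_zero n1]) auto
    moreover have "Hm_norm m (W0a_norm \<alpha>) Wt \<le> ennreal (?K * c3)"
      unfolding Wt_def using c0 by (intro Hm_norm_mode_le[of "W0a_norm \<alpha>", OF W0a_norm_zero n0]) auto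
    ultimately have "Hm_norm m (W1a_norm \<alpha>) (W 0) + Hm_norm m (W0a_norm \<alpha>) Wt
        \<le> ennreal (?K * (c1 + c2)) + ennreal (?K * c3)"
      by (rule add_mono)
    also have "\<dots> = ennreal (?K * (c1 + c2 + c3))"
      using c0 by (simp add: ennreal_plus[symmetric] algebra_simps del: ennreal_plus)
    also have "\<dots> \<le> ennreal 1" using small by (rule ennreal_leI)
    finally show "Hm_norm m (W1a_norm \<alpha>) (W 0) + Hm_norm m (W0a_norm \<alpha>) Wt \<le> 1" by simp
    show "C2_on UNIV (\<lambda>(t, x, y). W t x y)" using mode_sol_system(1)[OF sol dU] by (simp add: W_def)
    show "\<forall>t x y. W t (x + 2*pi) y = W t x y"
      by (simp add: W_def wave_x_periodic)
    show "let v = (\<lambda>t x y. - integral {0..y} (\<lambda>z. pd_x W t x z));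
          w = (\<lambda>t x y. pd_t W t x y + of_real (Us y) * pd_x W t x y + v t x y * of_real (deriv Us y))
      in (\<forall>t>0. \<forall>x. \<forall>y>0.
            pd_t w t x y + w t x y - pd_y (pd_y W) t x y = 0 \<and>
            pd_x W t x y + pd_y v t x y = 0) \<and>
         (\<forall>x. \<forall>y\<ge>0. W 0 x y = W 0 x y \<and> pd_t W 0 x y = Wt x y) \<and>
         (\<forall>t\<ge>0. \<forall>x. W t x 0 = 0 \<and> v t x 0 = 0)"
      using mode_sol_system(3)[OF sol dU] unfolding Let_def Wt_def W_def by simp
    have "ennreal (1 / \<delta>) \<le> ennreal ((1 + (real_of_int k)\<^sup>2) powr ((m - \<mu>) / 2) * (exp (\<alpha> * y0) * norm (u t0 y0)))"
      using large(4) by (rule ennreal_leI)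
    also have "\<dots> \<le> Hm_norm (m - \<mu>) (W0a_norm \<alpha>) (W t0)"
      unfolding W_def by (intro Hm_norm_mode_ge[of "W0a_norm \<alpha>", OF W0a_norm_zero W0a_norm_ge] large) auto
    also have "\<dots> \<le> (SUP t\<in>{0..\<delta>}. Hm_norm (m - \<mu>) (W0a_norm \<alpha>) (W t))"
      using large by (intro SUP_upper) auto
    finally show "(SUP t\<in>{0..\<delta>}. Hm_norm (m - \<mu>) (W0a_norm \<alpha>) (W t)) \<ge> ennreal (1 / \<delta>)" .
  qed simp
qed

section \<open>Scaling and Duhamel's formula for mode solutions\<close>

lemma mode_sol_scale:
  assumes "mode_sol k U U1 u ut"
  shows "mode_sol k U U1 (\<lambda>t y. c * u t y) (\<lambda>t y. c * ut t y)"
proof -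
  obtain uy utt uty uyy where d:
    "\<And>t y. ((\<lambda>s. u s y) has_vector_derivative ut t y) (at t)"
    "\<And>t y. (u t has_vector_derivative uy t y) (at y)"
    "\<And>t y. ((\<lambda>s. ut s y) has_vector_derivative utt t y) (at t)"
    "\<And>t y. (ut t has_vector_derivative uty t y) (at y)"
    "\<And>t y. ((\<lambda>s. uy s y) has_vector_derivative uty t y) (at t)"
    "\<And>t y. (uy t has_vector_derivative uyy t y) (at y)"
    and c: "cont2 u" "cont2 ut" "cont2 uy" "cont2 utt" "cont2 uty" "cont2 uyy"
    and u0: "\<And>t. u t 0 = 0"
    and eq: "\<And>t y. y > 0 \<Longrightarrow> utt t y + ut t y + \<i> * k * (U y * (ut t y + u t y)
         - U1 y * prim (\<lambda>z. ut t z + u t z) y) = uyy t y"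
    using assms unfolding mode_sol_def by blast
  have "c * utt t y + c * ut t y + \<i> * k * (U y * (c * ut t y + c * u t y)
         - U1 y * prim (\<lambda>z. c * ut t z + c * u t z) y) = c * uyy t y" if "y > 0" for t y
    unfolding eq[OF that, symmetric] distrib_left[symmetric] prim_mult_left
    by (simp add: algebra_simps)
  then show ?thesis
    unfolding mode_sol_def
    by (intro exI[of _ "\<lambda>t y. c * uy t y"] exI[of _ "\<lambda>t y. c * utt t y"]
        exI[of _ "\<lambda>t y. c * uty t y"] exI[of _ "\<lambda>t y. c * uyy t y"])
      (auto intro!: has_vector_derivative_mult_right d continuous_intros c simp: u0)
qed

lemma cexp_has_vector_derivative:
  fixes l :: complex shows
  "((\<lambda>t. exp (l * of_real t)) has_vector_derivative l * exp (l * of_real t)) (at t)"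
proof -
  have "((\<lambda>z. exp (l * z)) has_field_derivative exp (l * of_real t) * l) (at (of_real t))"
    by (auto intro!: derivative_eq_intros)
  then have "((\<lambda>t. exp (l * of_real t)) has_vector_derivative exp (l * of_real t) * l) (at t within UNIV)"
    by (rule has_vector_derivative_real_field[where f="\<lambda>z. exp (l * z)"])
  then show ?thesis by (simp add: mult_ac)
qed

text \<open>Duhamel's formula for a quasi-mode \<open>e\<^sup>l\<^sup>t g(y)\<close> with residual \<open>e\<^sup>l\<^sup>t R(y)\<close>: the error is driven by the
  single solution \<open>w\<close> with data \<open>(0, R)\<close>.\<close>
lemma mode_sol_duhamel:
  fixes l :: complex and g g1 g2 R :: "real \<Rightarrow> complex"
  assumes sol: "mode_sol k U U1 w wt" and w0: "\<And>y. w 0 y = 0" and wt0: "\<And>y. y > 0 \<Longrightarrow> wt 0 y = R y"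
    and g: "\<And>y. (g has_vector_derivative g1 y) (at y)" "\<And>y. (g1 has_vector_derivative g2 y) (at y)"
    and g2c: "continuous_on UNIV g2" and g0: "g 0 = 0"
    and res: "\<And>y. y > 0 \<Longrightarrow> R y = (l + 1) * (l * g y + \<i> * k * (U y * g y - U1 y * prim g y)) - g2 y"
  defines "u \<equiv> \<lambda>t y. exp (l * of_real t) * (g y - prim (\<lambda>s. exp (- l * of_real s) * w s y) t)"
  shows "mode_sol k U U1 u (\<lambda>t y. l * u t y - w t y)"
proof -
  obtain wy wtt wty wyy where
    d: "\<And>t y. ((\<lambda>s. w s y) has_vector_derivative wt t y) (at t)"
    "\<And>t y. (w t has_vector_derivative wy t y) (at y)"
    "\<And>t y. ((\<lambda>s. wt s y) has_vector_derivative wtt t y) (at t)"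
    "\<And>t y. (wt t has_vector_derivative wty t y) (at y)"
    "\<And>t y. ((\<lambda>s. wy s y) has_vector_derivative wty t y) (at t)"
    "\<And>t y. (wy t has_vector_derivative wyy t y) (at y)"
    and c: "cont2 w" "cont2 wt" "cont2 wy" "cont2 wtt" "cont2 wty" "cont2 wyy"
    and w00: "\<And>t. w t 0 = 0"
    and eq: "\<And>t y. y > 0 \<Longrightarrow> wtt t y + wt t y + \<i> * k * (U y * (wt t y + w t y)
         - U1 y * prim (\<lambda>z. wt t z + w t z) y) = wyy t y"
    using sol unfolding mode_sol_def by blast
  have slice: "continuous_on UNIV (f s)" "continuous_on UNIV (\<lambda>s. f s y)" if "cont2 f" for f :: "real \<Rightarrow> real \<Rightarrow> complex" and s y
    by (intro cont2_compose[OF that] continuous_intros)+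
  have gc: "continuous_on UNIV g" "continuous_on UNIV g1"
    using g by (auto intro!: has_vector_derivative_continuous continuous_at_imp_continuous_on)
  define e where "e t = exp (l * of_real t)" for t :: real
  define e' where "e' t = exp (- l * of_real t)" for t :: real
  have ee': "e t * e' t = 1" for t by (simp add: e_def e'_def flip: exp_add)
  have ee2: "e' t * (e t * x) = x" "e t * (e' t * x) = x" for t x
    by (simp_all add: e_def e'_def flip: exp_add mult.assoc)
  have ec: "continuous_on A (\<lambda>p. e (f p))" "continuous_on A (\<lambda>p. e' (f p))" if "continuous_on A f"
    for A and f :: "'b::topological_space \<Rightarrow> real"
    unfolding e_def e'_def by (intro continuous_intros that)+
  have de: "(e has_vector_derivative l * e t) (at t)" "(e' has_vector_derivative - l * e' t) (at t)" for t
    unfolding e_def[abs_def] e'_def[abs_def] by (rule cexp_has_vector_derivative)+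
  have ew: "cont2 (\<lambda>s y. e' s * f s y)" if "cont2 f" for f
    by (intro continuous_intros ec that)
  define J where "J f = (\<lambda>t y. prim (\<lambda>s. e' s * f s y) t)" for f :: "real \<Rightarrow> real \<Rightarrow> complex"
  have Jc: "cont2 (J f)" if "cont2 f" for f
    unfolding J_def by (rule cont2_prim1[OF ew[OF that]])
  have Jt: "((\<lambda>t. J f t y) has_vector_derivative e' t * f t y) (at t)" if "cont2 f" for f t y
    unfolding J_def by (rule prim_has_vector_derivative[OF slice(2)[OF ew[OF that]]])
  have Jy: "(J f t has_vector_derivative J f' t y) (at y)"
    if "\<And>t y. (f t has_vector_derivative f' t y) (at y)" "cont2 f" "cont2 f'" for f f' t y
    unfolding J_def
    by (intro prim_param_has_vector_derivative has_vector_derivative_mult_right that ew)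
  have u: "u = (\<lambda>t y. e t * (g y - J w t y))" by (simp add: u_def e_def J_def e'_def)
  define uy where "uy = (\<lambda>t y. e t * (g1 y - J wy t y))"
  define uyy where "uyy = (\<lambda>t y. e t * (g2 y - J wyy t y))"
  have uc: "cont2 u" "cont2 uy" "cont2 uyy"
    unfolding u uy_def uyy_def
    by (intro continuous_intros ec Jc c continuous_on_compose2[OF gc(1)] continuous_on_compose2[OF gc(2)]
        continuous_on_compose2[OF g2c]; simp)+
  have d_u_t: "((\<lambda>s. u s y) has_vector_derivative l * u t y - w t y) (at t)" for t y
  proof -
    have "((\<lambda>s. u s y) has_vector_derivative e t * (0 - e' t * w t y) + (l * e t) * (g y - J w t y)) (at t)"
      unfolding u
      by (intro has_vector_derivative_mult has_vector_derivative_diff has_vector_derivative_const Jt c de)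
    also have "e t * (0 - e' t * w t y) = - (e t * e' t) * w t y" by simp
    finally show ?thesis by (simp add: u ee2 algebra_simps)
  qed
  have d_uy_t: "((\<lambda>s. uy s y) has_vector_derivative l * uy t y - wy t y) (at t)" for t y
  proof -
    have "((\<lambda>s. uy s y) has_vector_derivative e t * (0 - e' t * wy t y) + (l * e t) * (g1 y - J wy t y)) (at t)"
      unfolding uy_def
      by (intro has_vector_derivative_mult has_vector_derivative_diff has_vector_derivative_const Jt c de)
    also have "e t * (0 - e' t * wy t y) = - (e t * e' t) * wy t y" by simp
    finally show ?thesis by (simp add: uy_def ee2 algebra_simps)
  qed
  have d_u_y: "(u t has_vector_derivative uy t y) (at y)" for t y
    unfolding u uy_def
    by (intro has_vector_derivative_mult_right has_vector_derivative_diff g Jy d c)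
  have d_uy_y: "(uy t has_vector_derivative uyy t y) (at y)" for t y
    unfolding uy_def uyy_def
    by (intro has_vector_derivative_mult_right has_vector_derivative_diff g Jy d c)
  define P where "P = (\<lambda>t. prim (w t))"
  define Pt where "Pt = (\<lambda>t. prim (wt t))"
  have Pc: "cont2 P" unfolding P_def by (rule cont2_prim2[OF c(1)])
  have dP: "((\<lambda>s. P s y) has_vector_derivative Pt t y) (at t)" for t y
    unfolding P_def Pt_def
    by (rule prim_param_has_vector_derivative[of "\<lambda>z s. w s z" "\<lambda>z s. wt s z"])
      (auto intro!: d cont2_compose[OF c(1)] cont2_compose[OF c(2)] continuous_intros)
  have dPy: "(P t has_vector_derivative w t y) (at y)" for t y
    unfolding P_def by (rule prim_has_vector_derivative[OF slice(1)[OF c(1)]])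
  have primJ: "prim (J w t) y = J P t y" for t y
    using prim_unique[OF Jy[OF dPy Pc c(1)], of t y] by (simp add: J_def P_def prim_def)
  \<comment> \<open>This is the equation for w multiplied by e^(-l s) and integrated in time, with
    time derivatives moved onto the exponential by parts. It is checked by differentiating
    \<open>?X\<close>; the boundary term at time 0 is the initial velocity \<open>R\<close>.\<close>
  have key: "J wyy t y = (l + 1) * (l * J w t y + \<i> * k * (U y * J w t y - U1 y * J P t y))
      + e' t * ((l + 1) * w t y + wt t y + \<i> * k * (U y * w t y - U1 y * P t y)) - R y"
    (is "_ = ?X t - R y") if y: "y > 0" for t y
  proof -
    have "(?X has_vector_derivative e' t * wyy t y) (at t)" for t
    proof -
      have "(?X has_vector_derivative
          (l + 1) * (l * (e' t * w t y) + \<i> * k * (U y * (e' t * w t y) - U1 y * (e' t * P t y)))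
          + (e' t * ((l + 1) * wt t y + wtt t y + \<i> * k * (U y * wt t y - U1 y * Pt t y))
            + (- l * e' t) * ((l + 1) * w t y + wt t y + \<i> * k * (U y * w t y - U1 y * P t y)))) (at t)"
        by (intro has_vector_derivative_add has_vector_derivative_diff has_vector_derivative_mult_right
            has_vector_derivative_mult Jt c Pc d dP de)
      also have "(l + 1) * (l * (e' t * w t y) + \<i> * k * (U y * (e' t * w t y) - U1 y * (e' t * P t y)))
          + (e' t * ((l + 1) * wt t y + wtt t y + \<i> * k * (U y * wt t y - U1 y * Pt t y))
            + (- l * e' t) * ((l + 1) * w t y + wt t y + \<i> * k * (U y * w t y - U1 y * P t y)))
          = e' t * (wtt t y + wt t y + \<i> * k * (U y * (wt t y + w t y) - U1 y * (Pt t y + P t y)))"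
        by (simp add: algebra_simps)
      also have "Pt t y + P t y = prim (\<lambda>z. wt t z + w t z) y"
        by (simp add: P_def Pt_def prim_add[OF slice(1)[OF c(2)] slice(1)[OF c(1)]])
      also note eq[OF y]
      finally show ?thesis .
    qed
    then have "J wyy t y = ?X t - ?X 0" unfolding J_def by (rule prim_unique)
    also have "?X 0 = R y" by (simp add: J_def P_def w0 wt0[OF y] e'_def prim_def)
    finally show ?thesis .
  qed
  \<comment> \<open>The \<open>- R y\<close> in \<open>key\<close> cancels the residual of g, and
    the terms with the factor \<open>e t * e' t\<close> = 1 cancel those that come from u_t = l u -
    w.\<close>
  have "(l * (l * u t y - w t y) - wt t y) + (l * u t y - w t y) + \<i> * k * (U y * ((l * u t y - w t y) + u t y)
         - U1 y * prim (\<lambda>z. (l * u t z - w t z) + u t z) y) = uyy t y" if y: "y > 0" for t y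
  proof -
    have cc: "continuous_on UNIV (\<lambda>z. ((l + 1) * e t) * (g z - J w t z))" for t
      by (intro continuous_intros gc slice(1)[OF Jc[OF c(1)]])
    have "prim (\<lambda>z. (l * u t z - w t z) + u t z) y
      = prim (\<lambda>z. ((l + 1) * e t) * (g z - J w t z) - w t z) y"
      by (intro arg_cong[where f="\<lambda>f. prim f y"]) (simp add: fun_eq_iff u algebra_simps)
    also have "\<dots> = (l + 1) * e t * (prim g y - J P t y) - P t y"
      using prim_diff[OF cc slice(1)[OF c(1)], of t t y]
      by (simp add: prim_mult_left P_def prim_diff[OF gc(1) slice(1)[OF Jc[OF c(1)]]] primJ[unfolded P_def])
    finally have p: "prim (\<lambda>z. (l * u t z - w t z) + u t z) y = (l + 1) * e t * (prim g y - J P t y) - P t y" .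
    have "uyy t y = e t * g2 y - e t * J wyy t y" by (simp add: uyy_def algebra_simps)
    also have "e t * J wyy t y = e t * ((l + 1) * (l * J w t y + \<i> * k * (U y * J w t y - U1 y * J P t y)) - R y)
      + (e t * e' t) * ((l + 1) * w t y + wt t y + \<i> * k * (U y * w t y - U1 y * P t y))"
      by (simp add: key[OF y] algebra_simps)
    finally show ?thesis
      unfolding p ee' res[OF y] by (simp add: u algebra_simps)
  qed
  moreover have "u t 0 = 0" for t by (simp add: u g0 J_def w00 prim_def)
  ultimately show ?thesis
    unfolding mode_sol_def
    by (intro exI[of _ uy] exI[of _ "\<lambda>t y. l * (l * u t y - w t y) - wt t y"]
        exI[of _ "\<lambda>t y. l * uy t y - wy t y"] exI[of _ uyy])
      (auto intro!: d_u_t d_u_y d_uy_t d_uy_y has_vector_derivative_diff has_vector_derivative_mult_right d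
        continuous_intros uc c)
qed

section \<open>Mollified shear profile\<close>

lemma at_Ici: "y > 0 \<Longrightarrow> at y within {0..} = at (y::real)"
  by (rule at_within_interior) (simp add: interior_Ici[of _ "-1"])

text \<open>\<open>b\<close> is half of U''(a), so that U is b (y - a)^2 to leading order; its sign
  decides the sign of the wave number.\<close>

locale shear_profile =
  fixes U U1 U2 U3 :: "real \<Rightarrow> real" and \<alpha> a b M :: real
  assumes \<alpha>: "\<alpha> > 0" and a: "a > 0" and b: "b \<noteq> 0"
    and dU: "\<And>y. y \<ge> 0 \<Longrightarrow> (U has_real_derivative U1 y) (at y within {0..})"
    and dU1: "\<And>y. y \<ge> 0 \<Longrightarrow> (U1 has_real_derivative U2 y) (at y within {0..})"
    and dU2: "\<And>y. y \<ge> 0 \<Longrightarrow> (U2 has_real_derivative U3 y) (at y within {0..})"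
    and U3c: "continuous_on {0..} U3"
    and UM: "\<And>y. y \<ge> 0 \<Longrightarrow> \<bar>U y\<bar> \<le> M * exp (- \<alpha> * y)"
    and U1M: "\<And>y. y \<ge> 0 \<Longrightarrow> \<bar>U1 y\<bar> \<le> M * exp (- \<alpha> * y)"
    and U2M: "\<And>y. y \<ge> 0 \<Longrightarrow> \<bar>U2 y\<bar> \<le> M * exp (- \<alpha> * y)"
    and U3M: "\<And>y. y \<ge> 0 \<Longrightarrow> \<bar>U3 y\<bar> \<le> M * exp (- \<alpha> * y)"
    and crit: "U a = 0" "U1 a = 0" "U2 a = 2 * b"
begin

lemma M_nonneg: "M \<ge> 0"
  using UM[of 0] by simp

lemma U_deriv: "y > 0 \<Longrightarrow> (U has_real_derivative U1 y) (at y)"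
  and U1_deriv: "y > 0 \<Longrightarrow> (U1 has_real_derivative U2 y) (at y)"
  and U2_deriv: "y > 0 \<Longrightarrow> (U2 has_real_derivative U3 y) (at y)"
  using dU[of y] dU1[of y] dU2[of y] by (simp_all add: at_Ici)

lemma U_continuous: "continuous_on {0..} U" "continuous_on {0..} U1" "continuous_on {0..} U2"
  by (rule DERIV_continuous_on, use dU dU1 dU2 in auto)+

definition W :: "real \<Rightarrow> real" where "W y = integral {0..y} U"

lemma W_deriv:
  assumes "y > 0" shows "(W has_real_derivative U y) (at y)"
proof -
  have "continuous_on {0..y + 1} U" using U_continuous(1) continuous_on_subset by fastforce
  from integral_has_real_derivative[OF this, of y] assms
  have "((\<lambda>y. integral {0..y} U) has_real_derivative U y) (at y within {0..y + 1})" by simp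
  then show ?thesis using assms by (simp add: W_def[abs_def] at_within_Icc_at)
qed

text \<open>\<open>V0\<close> averages \<open>U\<close> over a step \<open>1/N\<^sup>4\<close>. One more derivative than \<open>U\<close> possesses is needed for the residual
  to be \<open>C\<^sup>1\<close>, and the error \<open>1/N\<^sup>4\<close> compensates the factor \<open>(\<lambda> + 1) k\<close> of the transport terms, which has size \<open>N\<^sup>4\<close>.\<close>
definition mollify :: "(real \<Rightarrow> real) \<Rightarrow> real \<Rightarrow> real \<Rightarrow> real" where
  "mollify f N y = N ^ 4 * (f (y + 1 / N ^ 4) - f y)"

abbreviation "V0 \<equiv> mollify W"
abbreviation "V1 \<equiv> mollify U"
abbreviation "V2 \<equiv> mollify U1"
abbreviation "V3 \<equiv> mollify U2"
abbreviation "V4 \<equiv> mollify U3"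

lemma mollify_deriv:
  assumes "\<And>y. y > 0 \<Longrightarrow> (f has_real_derivative f' y) (at y)" "N > 0" "y > 0"
  shows "(mollify f N has_real_derivative mollify f' N y) (at y)"
proof -
  have "((\<lambda>y. f (y + 1 / N ^ 4)) has_real_derivative f' (y + 1 / N ^ 4)) (at y)"
    using assms by (intro DERIV_shift[THEN iffD1] assms) (auto intro: add_pos_pos)
  then show ?thesis
    unfolding mollify_def[abs_def] using assms
    by (auto intro!: derivative_eq_intros)
qed

lemma V_deriv:
  assumes "N > 0" "y > 0"
  shows "(V0 N has_real_derivative V1 N y) (at y)" "(V1 N has_real_derivative V2 N y) (at y)"
    "(V2 N has_real_derivative V3 N y) (at y)" "(V3 N has_real_derivative V4 N y) (at y)"
  using assms by (auto intro!: mollify_deriv W_deriv U_deriv U1_deriv U2_deriv)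

lemma mollify_mvt:
  assumes "\<And>y. y > 0 \<Longrightarrow> (f has_real_derivative f' y) (at y)" "N > 0" "y > 0"
  obtains z where "y < z" "z < y + 1 / N ^ 4" "mollify f N y = f' z"
proof -
  have "\<exists>z>y. z < y + 1 / N ^ 4 \<and> f (y + 1 / N ^ 4) - f y = (y + 1 / N ^ 4 - y) * f' z"
    by (rule MVT2) (use assms in auto)
  then show ?thesis using that assms by (auto simp: mollify_def)
qed

text \<open>The average is taken over points to the right of \<open>y\<close>: there the exponential
  bound is even smaller, and the argument never leaves the half-line.\<close>

lemma mollify_bound:
  assumes d: "\<And>y. y > 0 \<Longrightarrow> (f has_real_derivative f' y) (at y)"
    and B: "\<And>y. y \<ge> 0 \<Longrightarrow> \<bar>f' y\<bar> \<le> M * exp (- \<alpha> * y)" and N: "N > 0" and y: "y > 0"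
  shows "\<bar>mollify f N y\<bar> \<le> M * exp (- \<alpha> * y)"
proof -
  obtain z where z: "y < z" "mollify f N y = f' z" using mollify_mvt[OF d N y] by blast
  have "\<bar>f' z\<bar> \<le> M * exp (- \<alpha> * z)" using B z y by auto
  also have "\<dots> \<le> M * exp (- \<alpha> * y)" using z \<alpha> M_nonneg by (intro mult_left_mono) auto
  finally show ?thesis using z by simp
qed

lemma mollify_close:
  assumes d: "\<And>y. y > 0 \<Longrightarrow> (f has_real_derivative f' y) (at y)"
    and d': "\<And>y. y > 0 \<Longrightarrow> (f' has_real_derivative f'' y) (at y)"
    and B: "\<And>y. y \<ge> 0 \<Longrightarrow> \<bar>f'' y\<bar> \<le> M * exp (- \<alpha> * y)" and N: "N > 0" and y: "y > 0"
  shows "\<bar>mollify f N y - f' y\<bar> \<le> M * exp (- \<alpha> * y) / N ^ 4"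
proof -
  obtain z where z: "y < z" "z < y + 1 / N ^ 4" "mollify f N y = f' z" using mollify_mvt[OF d N y] by blast
  obtain x where x: "y < x" "x < z" "f' z - f' y = (z - y) * f'' x"
    using MVT2[of y z f' f''] z d' y by auto
  have "\<bar>f'' x\<bar> \<le> M * exp (- \<alpha> * x)" using B x y by auto
  also have "\<dots> \<le> M * exp (- \<alpha> * y)" using x \<alpha> M_nonneg by (intro mult_left_mono) auto
  finally have "\<bar>(z - y) * f'' x\<bar> \<le> (1 / N ^ 4) * (M * exp (- \<alpha> * y))"
    unfolding abs_mult using z by (intro mult_mono) auto
  then show ?thesis using z x by simp
qed

lemma V_bound:
  assumes "N > 0" "y > 0"
  shows "\<bar>V0 N y\<bar> \<le> M * exp (- \<alpha> * y)" "\<bar>V1 N y\<bar> \<le> M * exp (- \<alpha> * y)"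
    "\<bar>V2 N y\<bar> \<le> M * exp (- \<alpha> * y)" "\<bar>V3 N y\<bar> \<le> M * exp (- \<alpha> * y)"
  using mollify_bound[of W U, OF W_deriv UM assms] mollify_bound[of U U1, OF U_deriv U1M assms]
    mollify_bound[of U1 U2, OF U1_deriv U2M assms] mollify_bound[of U2 U3, OF U2_deriv U3M assms] by simp_all

lemma V_close:
  assumes "N > 0" "y > 0"
  shows "\<bar>V0 N y - U y\<bar> \<le> M * exp (- \<alpha> * y) / N ^ 4" "\<bar>V1 N y - U1 y\<bar> \<le> M * exp (- \<alpha> * y) / N ^ 4"
    "\<bar>V2 N y - U2 y\<bar> \<le> M * exp (- \<alpha> * y) / N ^ 4"
  using mollify_close[of W U U1, OF W_deriv U_deriv U1M assms] mollify_close[of U U1 U2, OF U_deriv U1_deriv U2M assms]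
    mollify_close[of U1 U2 U3, OF U1_deriv U2_deriv U3M assms] by simp_all

text \<open>The mean value theorem on either side of \<open>a\<close>, in place of integration,
  passes the constant K on unchanged. Three applications, starting from the bound on
  \<open>U3\<close>, give \<open>U_taylor\<close>.\<close>

lemma vanishing_bound:
  fixes f f' :: "real \<Rightarrow> real"
  assumes d: "\<And>y. y > 0 \<Longrightarrow> (f has_real_derivative f' y) (at y)" and f: "f a = 0"
    and B: "\<And>y. y > 0 \<Longrightarrow> \<bar>f' y\<bar> \<le> K * \<bar>y - a\<bar> ^ n" and y: "y > 0" and K: "K \<ge> 0"
  shows "\<bar>f y\<bar> \<le> K * \<bar>y - a\<bar> ^ Suc n"
proof -
  have "\<exists>z. z > 0 \<and> \<bar>z - a\<bar> \<le> \<bar>y - a\<bar> \<and> f y = (y - a) * f' z"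
  proof (cases y a rule: linorder_cases)
    case less
    then obtain z where "y < z" "z < a" "f a - f y = (a - y) * f' z"
      using MVT2[of y a f f'] d y by auto
    then show ?thesis using y f by (intro exI[of _ z]) (auto simp: algebra_simps)
  next
    case equal
    then show ?thesis using a f by (intro exI[of _ a]) auto
  next
    case greater
    then obtain z where "a < z" "z < y" "f y - f a = (y - a) * f' z"
      using MVT2[of a y f f'] d a by auto
    then show ?thesis using a f by (intro exI[of _ z]) auto
  qed
  then obtain z where z: "z > 0" "\<bar>z - a\<bar> \<le> \<bar>y - a\<bar>" "f y = (y - a) * f' z" by blast
  have "\<bar>f' z\<bar> \<le> K * \<bar>y - a\<bar> ^ n"
    using B[OF z(1)] mult_left_mono[OF power_mono[OF z(2), of n] K] by simp
  then have "\<bar>y - a\<bar> * \<bar>f' z\<bar> \<le> \<bar>y - a\<bar> * (K * \<bar>y - a\<bar> ^ n)" by (intro mult_left_mono) auto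
  then show ?thesis using z by (simp add: abs_mult mult_ac)
qed

lemma M_exp_le: "y > 0 \<Longrightarrow> M * exp (- \<alpha> * y) \<le> M"
  using M_nonneg \<alpha> by (simp add: mult_left_le)

lemma U_taylor:
  assumes "y > 0"
  shows "\<bar>U y - b * (y - a)\<^sup>2\<bar> \<le> M * \<bar>y - a\<bar> ^ 3" "\<bar>U1 y - 2 * b * (y - a)\<bar> \<le> M * \<bar>y - a\<bar> ^ 2"
    "\<bar>U2 y - 2 * b\<bar> \<le> M * \<bar>y - a\<bar>"
proof -
  have 2: "\<bar>U2 y - 2 * b\<bar> \<le> M * \<bar>y - a\<bar> ^ Suc 0" if "y > 0" for y
  proof (rule vanishing_bound[where f' = U3])
    show "\<bar>U3 y\<bar> \<le> M * \<bar>y - a\<bar> ^ 0" if "y > 0" for y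
      using order_trans[OF U3M M_exp_le, of y] that by simp
  qed (use that crit M_nonneg in \<open>auto intro!: derivative_eq_intros U2_deriv\<close>)
  have 1: "\<bar>U1 y - 2 * b * (y - a)\<bar> \<le> M * \<bar>y - a\<bar> ^ Suc (Suc 0)" if "y > 0" for y
    by (rule vanishing_bound[where f' = "\<lambda>y. U2 y - 2 * b"])
      (use that crit M_nonneg 2 in \<open>auto intro!: derivative_eq_intros U1_deriv\<close>)
  have 0: "\<bar>U y - b * (y - a)\<^sup>2\<bar> \<le> M * \<bar>y - a\<bar> ^ Suc (Suc (Suc 0))"
    by (rule vanishing_bound[where f' = "\<lambda>y. U1 y - 2 * b * (y - a)"])
      (use assms crit M_nonneg 1 in \<open>auto intro!: derivative_eq_intros U_deriv\<close>)
  show "\<bar>U y - b * (y - a)\<^sup>2\<bar> \<le> M * \<bar>y - a\<bar> ^ 3" "\<bar>U1 y - 2 * b * (y - a)\<bar> \<le> M * \<bar>y - a\<bar> ^ 2"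
    "\<bar>U2 y - 2 * b\<bar> \<le> M * \<bar>y - a\<bar>"
    using 0 1[OF assms] 2[OF assms] by (simp_all add: eval_nat_numeral)
qed

end

section \<open>The inner profile\<close>

text \<open>\<open>\<theta>0 = e\<^sup>i\<^sup>\<pi>\<^sup>/\<^sup>3\<close> and \<open>\<zeta>0 = e\<^sup>i\<^sup>\<pi>\<^sup>/\<^sup>6\<close>. With \<open>k b = N\<^sup>3\<close> the unstable root of \<open>\<lambda>\<^sup>3 = i k b\<close> is \<open>\<lambda> = \<zeta>0 N\<close>, and then
  \<open>U - c \<approx> b q\<close> near the critical point, where \<open>c = i \<lambda> / k\<close> and \<open>q = \<xi>\<^sup>2 + cnj \<theta>0 / N\<^sup>2\<close>.
  The rescaled problem \<open>\<phi>''' = const (q \<phi>' - q' \<phi>)\<close> is of second order after a Fourier transform and has a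
  solution whose third derivative is the Gaussian \<open>Egauss\<close>; hence \<open>(\<phi> / q)'\<close> is a multiple of \<open>Egauss / q\<^sup>2\<close>.
  Below \<open>pker = 1 / q\<close>, and \<open>Egauss * r\<^sub>j\<close> is the \<open>j\<close>-th derivative of \<open>Egauss * r0\<close>.\<close>
definition \<theta>0 :: complex where "\<theta>0 = Complex (1/2) (sqrt 3 / 2)"
definition \<zeta>0 :: complex where "\<zeta>0 = Complex (sqrt 3 / 2) (1/2)"

lemma \<theta>0_props: "\<theta>0 * cnj \<theta>0 = 1" "\<theta>0 \<noteq> 0" "Re \<theta>0 = 1/2" "\<i> * \<zeta>0 = \<theta>0\<^sup>2" "norm \<theta>0 = 1" "norm \<zeta>0 = 1"
  "\<theta>0\<^sup>2 * \<theta>0 = -1"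
  by (auto simp: \<theta>0_def \<zeta>0_def complex_eq_iff power2_eq_square cmod_def power_divide)

definition pker :: "real \<Rightarrow> complex \<Rightarrow> complex" where
  "pker N \<xi> = 1 / (\<xi>\<^sup>2 + cnj \<theta>0 / of_real (N\<^sup>2))"

definition Egauss :: "real \<Rightarrow> complex \<Rightarrow> complex" where
  "Egauss N \<xi> = exp (- (\<theta>0 * of_real (N\<^sup>2) * \<xi>\<^sup>2) / 2)"

definition r0 :: "real \<Rightarrow> complex \<Rightarrow> complex" where
  "r0 N \<xi> = (pker N \<xi>)\<^sup>2 / of_real (N ^ 3)"
definition r1 :: "real \<Rightarrow> complex \<Rightarrow> complex" where
  "r1 N \<xi> = (let p = pker N \<xi>; T = \<theta>0 * of_real (N\<^sup>2) in (- 4 * \<xi> * p ^ 3 - T * \<xi> * p\<^sup>2) / of_real (N ^ 3))"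
definition r2 :: "real \<Rightarrow> complex \<Rightarrow> complex" where
  "r2 N \<xi> = (let p = pker N \<xi>; T = \<theta>0 * of_real (N\<^sup>2) in
     (- 4 * p ^ 3 + 24 * \<xi>\<^sup>2 * p ^ 4 - T * p\<^sup>2 + 8 * T * \<xi>\<^sup>2 * p ^ 3 + T\<^sup>2 * \<xi>\<^sup>2 * p\<^sup>2) / of_real (N ^ 3))"
definition r3 :: "real \<Rightarrow> complex \<Rightarrow> complex" where
  "r3 N \<xi> = (let p = pker N \<xi>; T = \<theta>0 * of_real (N\<^sup>2) in
     (72 * \<xi> * p ^ 4 - 192 * \<xi> ^ 3 * p ^ 5 + 20 * T * \<xi> * p ^ 3 - 48 * T * \<xi> ^ 3 * p ^ 4
       + 2 * T\<^sup>2 * \<xi> * p\<^sup>2 - 4 * T\<^sup>2 * \<xi> ^ 3 * p ^ 3) / of_real (N ^ 3) - T * \<xi> * r2 N \<xi>)"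

lemma qker_Re:
  assumes "N > 0"
  shows "Re ((of_real x)\<^sup>2 + cnj \<theta>0 / of_real (N\<^sup>2)) = x\<^sup>2 + 1 / (2 * N\<^sup>2)"
  by (simp add: \<theta>0_def power2_eq_square flip: of_real_mult)

text \<open>The real part of cnj \<open>\<theta>0\<close> is positive, so q has no zero on the real
  line: for the unstable root the critical layer is not singular.\<close>

lemma qker_nz:
  assumes "N > 0"
  shows "(of_real x)\<^sup>2 + cnj \<theta>0 / of_real (N\<^sup>2) \<noteq> 0"
proof -
  have "x\<^sup>2 + 1 / (2 * N\<^sup>2) > 0" using assms by (intro add_nonneg_pos) auto
  then show ?thesis by (metis qker_Re[OF assms, of x] less_irrefl zero_complex.sel(1))
qed

lemma norm_pker_le:
  assumes "N > 0"
  shows "norm (pker N (of_real x)) \<le> 2 * N\<^sup>2"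
proof -
  have "1 / (2 * N\<^sup>2) \<le> x\<^sup>2 + 1 / (2 * N\<^sup>2)" by simp
  also have "\<dots> \<le> norm ((of_real x)\<^sup>2 + cnj \<theta>0 / of_real (N\<^sup>2))"
    using complex_Re_le_cmod[of "(of_real x)\<^sup>2 + cnj \<theta>0 / of_real (N\<^sup>2)"] by (simp only: qker_Re[OF assms])
  finally have "1 / (2 * N\<^sup>2) \<le> norm ((of_real x)\<^sup>2 + cnj \<theta>0 / of_real (N\<^sup>2))" .
  then have "1 / norm ((of_real x)\<^sup>2 + cnj \<theta>0 / of_real (N\<^sup>2)) \<le> 1 / (1 / (2 * N\<^sup>2))"
    using assms by (intro divide_left_mono mult_pos_pos) (auto intro: less_le_trans)
  then show ?thesis by (simp add: pker_def norm_divide)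
qed

lemma norm_Egauss: "norm (Egauss N (of_real x)) = exp (- ((N * x)\<^sup>2 / 4))"
  by (simp add: Egauss_def \<theta>0_def power2_eq_square power_mult_distrib)

lemma pker_deriv:
  assumes "N > 0"
  shows "(pker N has_field_derivative - 2 * of_real x * (pker N (of_real x))\<^sup>2) (at (of_real x))"
  unfolding pker_def[abs_def] using qker_nz[OF assms, of x]
  by (auto intro!: derivative_eq_intros simp: power2_eq_square)

lemma Egauss_deriv:
  "(Egauss N has_field_derivative - (\<theta>0 * of_real (N\<^sup>2)) * \<xi> * Egauss N \<xi>) (at \<xi>)"
  unfolding Egauss_def[abs_def]
  by (auto intro!: derivative_eq_intros)

text \<open>Complex differentiation is possible at real points because the poles of
  \<open>pker\<close> lie off the real line; the restriction to real arguments comes later.\<close>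

lemma Er_deriv:
  assumes N: "N > 0"
  shows "((\<lambda>\<xi>. Egauss N \<xi> * r0 N \<xi>) has_field_derivative Egauss N (of_real x) * r1 N (of_real x)) (at (of_real x))"
    and "((\<lambda>\<xi>. Egauss N \<xi> * r1 N \<xi>) has_field_derivative Egauss N (of_real x) * r2 N (of_real x)) (at (of_real x))"
    and "((\<lambda>\<xi>. Egauss N \<xi> * r2 N \<xi>) has_field_derivative Egauss N (of_real x) * r3 N (of_real x)) (at (of_real x))"
proof -
  note d = Egauss_deriv pker_deriv[OF N, of x]
  show "((\<lambda>\<xi>. Egauss N \<xi> * r0 N \<xi>) has_field_derivative Egauss N (of_real x) * r1 N (of_real x)) (at (of_real x))"
    unfolding r0_def r1_def Let_def
    by (rule DERIV_cong, (rule DERIV_cdivide derivative_intros d)+)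
      (simp add: algebra_simps eval_nat_numeral add_divide_distrib diff_divide_distrib)
  show "((\<lambda>\<xi>. Egauss N \<xi> * r1 N \<xi>) has_field_derivative Egauss N (of_real x) * r2 N (of_real x)) (at (of_real x))"
    unfolding r1_def r2_def Let_def
    by (rule DERIV_cong, (rule DERIV_cdivide derivative_intros d)+)
      (simp add: algebra_simps eval_nat_numeral add_divide_distrib diff_divide_distrib)
  show "((\<lambda>\<xi>. Egauss N \<xi> * r2 N \<xi>) has_field_derivative Egauss N (of_real x) * r3 N (of_real x)) (at (of_real x))"
    unfolding r2_def r3_def Let_def
    by (rule DERIV_cong, (rule DERIV_cdivide derivative_intros d)+)
      (simp add: algebra_simps eval_nat_numeral add_divide_distrib diff_divide_distrib)
qed

text \<open>This is \<open>(q \<psi>)''' = \<theta>0\<^sup>2 N\<^sup>4 q\<^sup>2 \<psi>'\<close> for \<open>\<psi>' = Egauss * r0\<close>.\<close>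
lemma inner_ode:
  fixes x :: real
  assumes N: "N > 0"
  defines "q \<equiv> (complex_of_real x)\<^sup>2 + cnj \<theta>0 / of_real (N\<^sup>2)"
  shows "\<theta>0\<^sup>2 * of_real (N ^ 4) * q\<^sup>2 * r0 N (of_real x)
    = q * r2 N (of_real x) + 6 * of_real x * r1 N (of_real x) + 6 * r0 N (of_real x)"
proof -
  define p where "p = pker N (of_real x)"
  define T where "T = \<theta>0 * of_real (N\<^sup>2)"
  define X where "X = (complex_of_real x)\<^sup>2"
  have qp: "q * p = 1" using qker_nz[OF N, of x] by (simp add: p_def pker_def q_def)
  have TX: "T * X = T * q - 1"
    using \<theta>0_props(1) N by (simp add: X_def T_def q_def algebra_simps)
  have T0: "T \<noteq> 0" using N \<theta>0_props(2) by (simp add: T_def)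
  \<comment> \<open>\<open>TX\<close> determines X only through the product T X, so both sides are
    multiplied by T before X is eliminated.\<close>
  have "T * (T\<^sup>2 * q\<^sup>2 * p\<^sup>2) = T * (q * (- 4 * p ^ 3 + 24 * X * p ^ 4 - T * p\<^sup>2 + 8 * T * X * p ^ 3 + T\<^sup>2 * X * p\<^sup>2)
      + 6 * (- 4 * X * p ^ 3 - T * X * p\<^sup>2) + 6 * p\<^sup>2)"
    using qp TX by algebra
  then have e: "T\<^sup>2 * q\<^sup>2 * p\<^sup>2 = q * (- 4 * p ^ 3 + 24 * X * p ^ 4 - T * p\<^sup>2 + 8 * T * X * p ^ 3 + T\<^sup>2 * X * p\<^sup>2)
      + 6 * (- 4 * X * p ^ 3 - T * X * p\<^sup>2) + 6 * p\<^sup>2"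
    using T0 by (metis mult_left_cancel)
  have "\<theta>0\<^sup>2 * of_real (N ^ 4) = T\<^sup>2" by (simp add: T_def power_mult_distrib flip: power_mult)
  then have "\<theta>0\<^sup>2 * of_real (N ^ 4) * q\<^sup>2 * r0 N (of_real x) = (T\<^sup>2 * q\<^sup>2 * p\<^sup>2) / of_real (N ^ 3)"
    by (simp add: r0_def p_def)
  also have "\<dots> = q * r2 N (of_real x) + 6 * of_real x * r1 N (of_real x) + 6 * r0 N (of_real x)"
    unfolding e r0_def r1_def r2_def Let_def p_def[symmetric] T_def[symmetric] X_def
    by (simp add: add_divide_distrib diff_divide_distrib algebra_simps power2_eq_square)
  finally show ?thesis .
qed

lemma power_times_gauss_bounded:
  obtains C :: real where "C > 0" "\<And>z. z \<ge> 0 \<Longrightarrow> (1 + z) ^ n * exp (- (z\<^sup>2 / 4)) \<le> C"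
proof -
  have "(1 + z) ^ n * exp (- (z\<^sup>2 / 4)) \<le> real (Suc n) ^ n * exp 2" if z: "z \<ge> 0" for z :: real
  proof -
    \<comment> \<open>This is x <= e^x for x = (1 + z) / (n + 1), raised to the n-th power;
      completing the square then gives 1 + z - z^2/4 <= 2.\<close>
    have "((1 + z) / real (Suc n)) ^ n \<le> (exp ((1 + z) / real (Suc n))) ^ n"
    proof (rule power_mono)
      show "(1 + z) / real (Suc n) \<le> exp ((1 + z) / real (Suc n))"
        using exp_ge_add_one_self[of "(1 + z) / real (Suc n)"] by linarith
    qed (use z in auto)
    also have "\<dots> = exp (real n * ((1 + z) / real (Suc n)))"
      by (simp only: exp_of_nat_mult)
    also have "\<dots> \<le> exp (1 + z)"
    proof -
      have "real n * (1 + z) \<le> (1 + z) * real (Suc n)" using z by (simp add: algebra_simps)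
      then show ?thesis by (simp add: pos_divide_le_eq)
    qed
    finally have "(1 + z) ^ n \<le> exp (1 + z) * real (Suc n) ^ n"
      by (simp add: power_divide pos_divide_le_eq)
    then have "(1 + z) ^ n * exp (- (z\<^sup>2 / 4)) \<le> (exp (1 + z) * real (Suc n) ^ n) * exp (- (z\<^sup>2 / 4))"
      by (intro mult_right_mono) auto
    also have "\<dots> = real (Suc n) ^ n * exp (1 + z - z\<^sup>2 / 4)"
      using exp_add[of "1 + z" "- (z\<^sup>2 / 4)"] by (simp add: mult_ac)
    also have "1 + z - z\<^sup>2 / 4 \<le> 2"
      using zero_le_power2[of "z / 2 - 1"] by (simp add: power2_eq_square field_simps)
    then have "real (Suc n) ^ n * exp (1 + z - z\<^sup>2 / 4) \<le> real (Suc n) ^ n * exp 2"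
      by (intro mult_left_mono) auto
    finally show ?thesis .
  qed
  moreover have "real (Suc n) ^ n * exp 2 > 0" by simp
  ultimately show ?thesis using that by blast
qed

lemma max_power_deriv:
  "((\<lambda>x::real. max 0 x ^ Suc (Suc n)) has_real_derivative real (Suc (Suc n)) * max 0 x ^ Suc n) (at x)"
proof (cases x "0::real" rule: linorder_cases)
  case less
  have "((\<lambda>x. 0) has_real_derivative 0) (at x)" by simp
  then have "((\<lambda>x::real. max 0 x ^ Suc (Suc n)) has_real_derivative 0) (at x)"
    by (rule has_field_derivative_transform_within_open[of _ _ _ "{..<0}"]) (use less in auto)
  then show ?thesis using less by simp
next
  case greater
  have "((\<lambda>x. x ^ Suc (Suc n)) has_real_derivative real (Suc (Suc n)) * x ^ Suc n) (at x)"
    using DERIV_pow[of "Suc (Suc n)" x] by simp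
  then have "((\<lambda>x::real. max 0 x ^ Suc (Suc n)) has_real_derivative real (Suc (Suc n)) * x ^ Suc n) (at x)"
    by (rule has_field_derivative_transform_within_open[of _ _ _ "{0<..}"]) (use greater in auto)
  then show ?thesis using greater by simp
next
  case equal
  \<comment> \<open>At 0 the difference quotient is \<open>max 0 h ^ Suc n\<close> itself.\<close>
  have "((\<lambda>h::real. max 0 h ^ Suc n) \<longlongrightarrow> max 0 0 ^ Suc n) (at 0)"
    by (intro tendsto_intros)
  then have "((\<lambda>h::real. max 0 h ^ Suc n) \<longlongrightarrow> 0) (at 0)" by simp
  then have "((\<lambda>h::real. (max 0 (0 + h) ^ Suc (Suc n) - max 0 0 ^ Suc (Suc n)) / h) \<longlongrightarrow> 0) (at 0)"
    by (rule Lim_transform_eventually) (auto simp: eventually_at_filter max_def)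
  then show ?thesis using equal by (simp add: DERIV_def)
qed

section \<open>A calculus of orders in N\<close>

context shear_profile
begin

text \<open>Size \<open>N\<^sup>l\<close> near the critical point up to powers of the inner variable \<open>N (y - a)\<close>, which the Gaussian absorbs.\<close>
definition grow :: "real \<Rightarrow> (real \<Rightarrow> real \<Rightarrow> complex) \<Rightarrow> bool" where
  "grow l f \<longleftrightarrow> (\<exists>C m. C \<ge> 0 \<and> (\<forall>N\<ge>1. \<forall>y. \<bar>y - a\<bar> \<le> a / 2 \<longrightarrow>
     norm (f N y) \<le> C * N powr l * (1 + N * \<bar>y - a\<bar>) ^ m))"

lemma growI:
  assumes "\<And>N y. N \<ge> 1 \<Longrightarrow> \<bar>y - a\<bar> \<le> a / 2 \<Longrightarrow> norm (f N y) \<le> C * N powr l * (1 + N * \<bar>y - a\<bar>) ^ m"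
  shows "grow l f"
proof -
  have "norm (f N y) \<le> \<bar>C\<bar> * N powr l * (1 + N * \<bar>y - a\<bar>) ^ m" if "N \<ge> 1" "\<bar>y - a\<bar> \<le> a / 2" for N y
  proof -
    have "C * N powr l * (1 + N * \<bar>y - a\<bar>) ^ m \<le> \<bar>C\<bar> * N powr l * (1 + N * \<bar>y - a\<bar>) ^ m"
      using that by (intro mult_right_mono zero_le_power) auto
    then show ?thesis using assms[OF that] by linarith
  qed
  then show ?thesis unfolding grow_def by (intro exI[of _ "\<bar>C\<bar>"] exI[of _ m]) auto
qed

lemma grow_mono:
  assumes "grow i f" "i \<le> l" shows "grow l f"
proof -
  obtain C m where C: "C \<ge> 0" "\<And>N y. N \<ge> 1 \<Longrightarrow> \<bar>y - a\<bar> \<le> a / 2 \<Longrightarrow>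
      norm (f N y) \<le> C * N powr i * (1 + N * \<bar>y - a\<bar>) ^ m"
    using assms(1) unfolding grow_def by blast
  show ?thesis
  proof (rule growI)
    fix N y :: real assume *: "N \<ge> 1" "\<bar>y - a\<bar> \<le> a / 2"
    have "C * N powr i * (1 + N * \<bar>y - a\<bar>) ^ m \<le> C * N powr l * (1 + N * \<bar>y - a\<bar>) ^ m"
      using * C(1) assms(2) by (intro mult_right_mono mult_left_mono powr_mono zero_le_power) auto
    then show "norm (f N y) \<le> C * N powr l * (1 + N * \<bar>y - a\<bar>) ^ m" using C(2)[OF *] by linarith
  qed
qed

lemma grow_mult:
  assumes "grow i f" "grow j g" "i + j \<le> l" shows "grow l (\<lambda>N y. f N y * g N y)"
proof -
  obtain C m where C: "C \<ge> 0" "\<And>N y. N \<ge> 1 \<Longrightarrow> \<bar>y - a\<bar> \<le> a / 2 \<Longrightarrow>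
      norm (f N y) \<le> C * N powr i * (1 + N * \<bar>y - a\<bar>) ^ m"
    using assms(1) unfolding grow_def by blast
  obtain D n where D: "D \<ge> 0" "\<And>N y. N \<ge> 1 \<Longrightarrow> \<bar>y - a\<bar> \<le> a / 2 \<Longrightarrow>
      norm (g N y) \<le> D * N powr j * (1 + N * \<bar>y - a\<bar>) ^ n"
    using assms(2) unfolding grow_def by blast
  have "grow (i + j) (\<lambda>N y. f N y * g N y)"
  proof (rule growI)
    fix N y :: real assume *: "N \<ge> 1" "\<bar>y - a\<bar> \<le> a / 2"
    have "norm (f N y * g N y) \<le> (C * N powr i * (1 + N * \<bar>y - a\<bar>) ^ m) * (D * N powr j * (1 + N * \<bar>y - a\<bar>) ^ n)"
      unfolding norm_mult using * C D by (intro mult_mono C(2) D(2)) auto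
    also have "\<dots> = (C * D) * N powr (i + j) * (1 + N * \<bar>y - a\<bar>) ^ (m + n)"
      by (simp add: powr_add power_add mult_ac)
    finally show "norm (f N y * g N y) \<le> (C * D) * N powr (i + j) * (1 + N * \<bar>y - a\<bar>) ^ (m + n)" .
  qed
  then show ?thesis using assms(3) grow_mono by blast
qed

lemma grow_add:
  assumes "grow l f" "grow l g" shows "grow l (\<lambda>N y. f N y + g N y)"
proof -
  obtain C m where C: "C \<ge> 0" "\<And>N y. N \<ge> 1 \<Longrightarrow> \<bar>y - a\<bar> \<le> a / 2 \<Longrightarrow>
      norm (f N y) \<le> C * N powr l * (1 + N * \<bar>y - a\<bar>) ^ m"
    using assms(1) unfolding grow_def by blast
  obtain D n where D: "D \<ge> 0" "\<And>N y. N \<ge> 1 \<Longrightarrow> \<bar>y - a\<bar> \<le> a / 2 \<Longrightarrow>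
      norm (g N y) \<le> D * N powr l * (1 + N * \<bar>y - a\<bar>) ^ n"
    using assms(2) unfolding grow_def by blast
  show ?thesis
  proof (rule growI)
    fix N y :: real assume *: "N \<ge> 1" "\<bar>y - a\<bar> \<le> a / 2"
    let ?z = "1 + N * \<bar>y - a\<bar>"
    have z: "?z \<ge> 1" using * by simp
    have "C * N powr l * ?z ^ m \<le> C * N powr l * ?z ^ (m + n)" "D * N powr l * ?z ^ n \<le> D * N powr l * ?z ^ (m + n)"
      using C D z by (intro mult_left_mono power_increasing; simp)+
    then have "norm (f N y + g N y) \<le> C * N powr l * ?z ^ (m + n) + D * N powr l * ?z ^ (m + n)"
      using C(2)[OF *] D(2)[OF *] norm_triangle_ineq[of "f N y" "g N y"] by linarith
    then show "norm (f N y + g N y) \<le> (C + D) * N powr l * ?z ^ (m + n)" by (simp add: algebra_simps)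
  qed
qed

lemma grow_minus: "grow l f \<Longrightarrow> grow l (\<lambda>N y. - f N y)"
  unfolding grow_def by simp

lemma grow_diff: "grow l f \<Longrightarrow> grow l g \<Longrightarrow> grow l (\<lambda>N y. f N y - g N y)"
  using grow_add[OF _ grow_minus, of l f g] by simp

lemma grow_bounded:
  assumes "\<And>y. \<bar>y - a\<bar> \<le> a / 2 \<Longrightarrow> norm (f y) \<le> K" "0 \<le> l"
  shows "grow l (\<lambda>N y. f y)"
proof -
  have "grow 0 (\<lambda>N y. f y)" by (rule growI[where C = K and m = 0]) (use assms(1) in auto)
  then show ?thesis using assms(2) grow_mono by blast
qed

lemma grow_const: "0 \<le> l \<Longrightarrow> grow l (\<lambda>N y. c)"
  by (rule grow_bounded) auto

lemma grow_power_N: "real n \<le> l \<Longrightarrow> grow l (\<lambda>N y. of_real (N ^ n))"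
  by (rule grow_mono[of "real n"], rule growI[where C = 1 and m = 0]) (auto simp: powr_realpow norm_power)

lemma grow_power: "grow i f \<Longrightarrow> real n * i \<le> l \<Longrightarrow> grow l (\<lambda>N y. f N y ^ n)"
proof (induction n arbitrary: l)
  case 0
  then show ?case by (simp add: grow_const)
next
  case (Suc n)
  have "grow (real n * i) (\<lambda>N y. f N y ^ n)" by (rule Suc.IH[OF Suc.prems(1)]) simp
  then show ?case
    using Suc.prems grow_mult[OF Suc.prems(1), of "real n * i" "\<lambda>N y. f N y ^ n" l]
    by (simp add: algebra_simps)
qed

lemma grow_div_N: 
  assumes "grow i f" "i - real n \<le> l" shows "grow l (\<lambda>N y. f N y / of_real (N ^ n))"
proof -
  have "grow (- real n) (\<lambda>N y. 1 / of_real (N ^ n))"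
    by (rule growI[where C = 1 and m = 0])
      (simp_all add: norm_divide norm_power powr_minus_divide powr_realpow)
  from grow_mult[OF assms(1) this, of l] assms(2) show ?thesis by simp
qed

text \<open>|y - a|^n is N^(-n) times a power of the inner variable, and the averaging error 1/N^4
  is no larger than N^(-n) because n <= 4.\<close>

lemma grow_vanishing:
  assumes "\<And>N y. N \<ge> 1 \<Longrightarrow> \<bar>y - a\<bar> \<le> a / 2 \<Longrightarrow> norm (f N y) \<le> K * (\<bar>y - a\<bar> ^ n + 1 / N ^ 4)"
    and "n \<le> 4" "- real n \<le> l" "K \<ge> 0"
  shows "grow l f"
proof -
  have "grow (- real n) f"
  proof (rule growI)
    fix N y :: real assume *: "N \<ge> 1" "\<bar>y - a\<bar> \<le> a / 2"
    let ?x = "N * \<bar>y - a\<bar>"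
    have "\<bar>y - a\<bar> ^ n = N powr (- real n) * ?x ^ n"
      using * by (simp add: powr_minus_divide powr_realpow power_mult_distrib)
    moreover have "1 / N ^ 4 \<le> N powr (- real n) * 1"
    proof -
      have "N ^ n \<le> N ^ 4" using * assms(2) by (intro power_increasing) auto
      then have "1 / N ^ 4 \<le> 1 / N ^ n" using * by (intro divide_left_mono) auto
      then show ?thesis using * by (simp add: powr_minus_divide powr_realpow)
    qed
    moreover have "N powr (- real n) * ?x ^ n \<le> N powr (- real n) * (1 + ?x) ^ n"
      "N powr (- real n) * 1 \<le> N powr (- real n) * (1 + ?x) ^ n"
      using * by (auto intro!: mult_left_mono power_mono one_le_power simp del: mult_1_right)
    ultimately have "\<bar>y - a\<bar> ^ n + 1 / N ^ 4 \<le> N powr (- real n) * (1 + ?x) ^ n + N powr (- real n) * (1 + ?x) ^ n"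
      by linarith
    then have "K * (\<bar>y - a\<bar> ^ n + 1 / N ^ 4) \<le> K * (N powr (- real n) * (1 + ?x) ^ n + N powr (- real n) * (1 + ?x) ^ n)"
      using assms(4) by (intro mult_left_mono) auto
    then show "norm (f N y) \<le> (2 * K) * N powr (- real n) * (1 + ?x) ^ n"
      using assms(1)[OF *] by (simp add: algebra_simps)
  qed
  then show ?thesis using assms(3) grow_mono by blast
qed

end

lemma has_vector_derivative_imp_continuous_on:
  fixes f :: "real \<Rightarrow> complex"
  shows "(\<And>y. (f has_vector_derivative f' y) (at y)) \<Longrightarrow> continuous_on A f"
  by (meson continuous_at_imp_continuous_on has_vector_derivative_continuous)

lemma complex_of_real_has_vector_derivative: "(f has_real_derivative f') (at y) \<Longrightarrow> ((\<lambda>y. complex_of_real (f y)) has_vector_derivative of_real f') (at y)"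
  by (rule has_vector_derivative_of_real)

context shear_profile
begin

section \<open>The quasi-mode\<close>

text \<open>The cutoff need not be constant near \<open>a\<close>: each derivative that falls on it instead of on the inner profile
  gains a factor \<open>1/N\<close>, and this is all the residual estimate requires.\<close>
definition bump :: "real \<Rightarrow> real" where "bump y = max 0 (a\<^sup>2 / 4 - (y - a)\<^sup>2)"
text \<open>The fourth power is the smallest one of class C^3, as \<open>\<chi>3\<close>
  requires.\<close>

definition cut0 :: "real \<Rightarrow> complex" where "cut0 y = of_real (bump y ^ 4)"
definition cut1 :: "real \<Rightarrow> complex" where "cut1 y = of_real (- 8 * (y - a) * bump y ^ 3)"
definition cut2 :: "real \<Rightarrow> complex" where "cut2 y = of_real (- 8 * bump y ^ 3 + 48 * (y - a)\<^sup>2 * bump y ^ 2)"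
definition cut3 :: "real \<Rightarrow> complex" where "cut3 y = of_real (144 * (y - a) * bump y ^ 2 - 192 * (y - a) ^ 3 * bump y)"

definition X0 :: "real \<Rightarrow> real \<Rightarrow> complex" where "X0 N y = Egauss N (of_real (y - a)) * r0 N (of_real (y - a))"
definition X1 :: "real \<Rightarrow> real \<Rightarrow> complex" where "X1 N y = Egauss N (of_real (y - a)) * r1 N (of_real (y - a))"
definition X2 :: "real \<Rightarrow> real \<Rightarrow> complex" where "X2 N y = Egauss N (of_real (y - a)) * r2 N (of_real (y - a))"
definition X3 :: "real \<Rightarrow> real \<Rightarrow> complex" where "X3 N y = Egauss N (of_real (y - a)) * r3 N (of_real (y - a))"

definition \<chi>0 :: "real \<Rightarrow> real \<Rightarrow> complex" where "\<chi>0 N y = cut0 y * X0 N y"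
definition \<chi>1 :: "real \<Rightarrow> real \<Rightarrow> complex" where "\<chi>1 N y = cut1 y * X0 N y + cut0 y * X1 N y"
definition \<chi>2 :: "real \<Rightarrow> real \<Rightarrow> complex" where "\<chi>2 N y = cut2 y * X0 N y + 2 * (cut1 y * X1 N y) + cut0 y * X2 N y"
definition \<chi>3 :: "real \<Rightarrow> real \<Rightarrow> complex" where
  "\<chi>3 N y = cut3 y * X0 N y + 3 * (cut2 y * X1 N y) + 3 * (cut1 y * X2 N y) + cut0 y * X3 N y"

text \<open>This is i \<lambda> / k for \<lambda> = \<open>growth N\<close> and k = N^3 / b, because
  i \<open>\<zeta>0\<close> = \<open>\<theta>0\<close>^2 = - cnj \<open>\<theta>0\<close>.\<close>

definition phase_speed :: "real \<Rightarrow> complex" where "phase_speed N = - (of_real b * cnj \<theta>0 / of_real (N\<^sup>2))"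
definition \<psi> :: "real \<Rightarrow> real \<Rightarrow> complex" where "\<psi> N = prim (\<chi>0 N)"

text \<open>Far above the critical layer \<open>\<phi>\<close> is a multiple of \<open>V0 - c\<close>, an inviscid stationary solution in the moving frame.\<close>
definition \<phi> :: "real \<Rightarrow> real \<Rightarrow> complex" where "\<phi> N y = (of_real (V0 N y) - phase_speed N) * \<psi> N y"
definition g0 :: "real \<Rightarrow> real \<Rightarrow> complex" where "g0 N y = of_real (V1 N y) * \<psi> N y + (of_real (V0 N y) - phase_speed N) * \<chi>0 N y"
definition g1 :: "real \<Rightarrow> real \<Rightarrow> complex" where
  "g1 N y = of_real (V2 N y) * \<psi> N y + 2 * (of_real (V1 N y) * \<chi>0 N y) + (of_real (V0 N y) - phase_speed N) * \<chi>1 N y"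
definition g2 :: "real \<Rightarrow> real \<Rightarrow> complex" where
  "g2 N y = of_real (V3 N y) * \<psi> N y + 3 * (of_real (V2 N y) * \<chi>0 N y) + 3 * (of_real (V1 N y) * \<chi>1 N y) + (of_real (V0 N y) - phase_speed N) * \<chi>2 N y"
definition g3 :: "real \<Rightarrow> real \<Rightarrow> complex" where
  "g3 N y = of_real (V4 N y) * \<psi> N y + 4 * (of_real (V3 N y) * \<chi>0 N y) + 6 * (of_real (V2 N y) * \<chi>1 N y) + 4 * (of_real (V1 N y) * \<chi>2 N y)
    + (of_real (V0 N y) - phase_speed N) * \<chi>3 N y"

definition growth :: "real \<Rightarrow> complex" where "growth N = \<zeta>0 * of_real N"

text \<open>The function \<open>R\<close> of \<open>mode_sol_duhamel\<close> for the profile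
  \<open>g0\<close>, with stream function \<open>\<phi>\<close>, at wave number N^3 / b.\<close>

definition residual :: "real \<Rightarrow> real \<Rightarrow> complex" where
  "residual N y = (growth N + 1) * (growth N * g0 N y + \<i> * of_real (N ^ 3 / b) * (U y * g0 N y - U1 y * \<phi> N y)) - g2 N y"
text \<open>In the y-derivative the two products of U' and \<open>g0\<close> cancel, so
  \<open>U2\<close> occurs but \<open>U1\<close> does not.\<close>

definition residual' :: "real \<Rightarrow> real \<Rightarrow> complex" where
  "residual' N y = (growth N + 1) * (growth N * g1 N y + \<i> * of_real (N ^ 3 / b) * (U y * g1 N y - U2 y * \<phi> N y)) - g3 N y"

lemma bump_zero: "\<bar>y - a\<bar> \<ge> a / 2 \<Longrightarrow> bump y = 0"
proof -
  assume "\<bar>y - a\<bar> \<ge> a / 2"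
  then have "(a / 2)\<^sup>2 \<le> \<bar>y - a\<bar>\<^sup>2" using a by (intro power_mono) auto
  then show ?thesis by (simp add: bump_def power_divide)
qed

lemma \<chi>_zero:
  assumes "\<bar>y - a\<bar> \<ge> a / 2"
  shows "\<chi>0 N y = 0" "\<chi>1 N y = 0" "\<chi>2 N y = 0" "\<chi>3 N y = 0"
  using bump_zero[OF assms] by (simp_all add: \<chi>0_def \<chi>1_def \<chi>2_def \<chi>3_def cut0_def cut1_def cut2_def cut3_def)

lemma bump_power_deriv:
  "((\<lambda>y. bump y ^ Suc (Suc n)) has_real_derivative real (Suc (Suc n)) * bump y ^ Suc n * (- 2 * (y - a))) (at y)"
proof -
  have "((\<lambda>y. a\<^sup>2 / 4 - (y - a)\<^sup>2) has_real_derivative - 2 * (y - a)) (at y)"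
    by (auto intro!: derivative_eq_intros)
  from DERIV_chain2[OF max_power_deriv[of n] this] show ?thesis by (simp only: bump_def[abs_def])
qed

lemma cutoff_deriv:
  "(cut0 has_vector_derivative cut1 y) (at y)" "(cut1 has_vector_derivative cut2 y) (at y)"
  "(cut2 has_vector_derivative cut3 y) (at y)"
proof -
  have c2: "((\<lambda>y. bump y ^ 2) has_real_derivative 2 * bump y * (- 2 * (y - a))) (at y)" for y
    using bump_power_deriv[of 0 y] by (simp add: numeral_2_eq_2)
  have c3: "((\<lambda>y. bump y ^ 3) has_real_derivative 3 * bump y ^ 2 * (- 2 * (y - a))) (at y)" for y
    using bump_power_deriv[of 1 y] by (simp add: numeral_2_eq_2 numeral_3_eq_3)
  have c4: "((\<lambda>y. bump y ^ 4) has_real_derivative 4 * bump y ^ 3 * (- 2 * (y - a))) (at y)" for y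
    using bump_power_deriv[of 2 y] by (simp add: eval_nat_numeral)
  show "(cut0 has_vector_derivative cut1 y) (at y)"
    unfolding cut0_def[abs_def] cut1_def
    by (intro has_vector_derivative_of_real DERIV_cong[OF c4]) simp
  show "(cut1 has_vector_derivative cut2 y) (at y)"
    unfolding cut1_def[abs_def] cut2_def
    by (intro has_vector_derivative_of_real)
      (rule DERIV_cong, (rule c3 derivative_intros)+, simp add: algebra_simps power2_eq_square)
  show "(cut2 has_vector_derivative cut3 y) (at y)"
    unfolding cut2_def[abs_def] cut3_def
    by (intro has_vector_derivative_of_real)
      (rule DERIV_cong, (rule c3 c2 derivative_intros)+, simp add: algebra_simps eval_nat_numeral)
qed

lemma X_deriv:
  assumes N: "N > 0"
  shows "(X0 N has_vector_derivative X1 N y) (at y)" "(X1 N has_vector_derivative X2 N y) (at y)"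
    "(X2 N has_vector_derivative X3 N y) (at y)"
proof -
  have sh: "((\<lambda>y. F (of_real (y - a))) has_vector_derivative F') (at y)"
    if "(F has_field_derivative F') (at (of_real (y - a)))" for F F'
  proof -
    have "((\<lambda>y. y - a) has_vector_derivative 1) (at y)"
      by (auto intro!: derivative_eq_intros simp: has_vector_derivative_def)
    moreover have "((\<lambda>x. F (of_real x)) has_vector_derivative F') (at (y - a))"
      using has_vector_derivative_real_field[OF that] .
    ultimately show ?thesis using vector_diff_chain_at[of "\<lambda>y. y - a" 1 y "\<lambda>x. F (of_real x)" F'] by (simp add: o_def)
  qed
  show "(X0 N has_vector_derivative X1 N y) (at y)" "(X1 N has_vector_derivative X2 N y) (at y)"
    "(X2 N has_vector_derivative X3 N y) (at y)"
    unfolding X0_def[abs_def] X1_def[abs_def] X2_def[abs_def] X3_def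
    using sh[OF Er_deriv(1)[OF N]] sh[OF Er_deriv(2)[OF N]] sh[OF Er_deriv(3)[OF N]] by simp_all
qed

lemma X3_continuous:
  assumes "N > 0" shows "continuous_on UNIV (X3 N)"
proof -
  have nz: "(complex_of_real (y - a))\<^sup>2 + cnj \<theta>0 / of_real (N\<^sup>2) \<noteq> 0" for y
    using qker_nz[OF assms] .
  have "continuous_on UNIV (\<lambda>y. pker N (of_real (y - a)))"
    unfolding pker_def using nz by (intro continuous_intros) auto
  then show ?thesis
    unfolding X3_def[abs_def] r3_def r2_def Let_def Egauss_def
    by (intro continuous_intros) (use assms in auto)
qed

lemma \<chi>_deriv:
  assumes "N > 0"
  shows "(\<chi>0 N has_vector_derivative \<chi>1 N y) (at y)" "(\<chi>1 N has_vector_derivative \<chi>2 N y) (at y)"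
    "(\<chi>2 N has_vector_derivative \<chi>3 N y) (at y)"
proof -
  note d = cutoff_deriv X_deriv[OF assms]
  show "(\<chi>0 N has_vector_derivative \<chi>1 N y) (at y)"
    unfolding \<chi>0_def[abs_def] \<chi>1_def
    by (rule has_vector_derivative_eq_rhs, (rule d has_vector_derivative_mult)+)
      (simp add: algebra_simps)
  show "(\<chi>1 N has_vector_derivative \<chi>2 N y) (at y)"
    unfolding \<chi>1_def[abs_def] \<chi>2_def
    by (rule has_vector_derivative_eq_rhs, (rule d has_vector_derivative_add has_vector_derivative_mult_right has_vector_derivative_mult)+)
      (simp add: algebra_simps)
  show "(\<chi>2 N has_vector_derivative \<chi>3 N y) (at y)"
    unfolding \<chi>2_def[abs_def] \<chi>3_def
    by (rule has_vector_derivative_eq_rhs, (rule d has_vector_derivative_add has_vector_derivative_mult_right has_vector_derivative_mult)+)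
      (simp add: algebra_simps)
qed

lemma \<chi>_continuous:
  assumes "N > 0"
  shows "continuous_on A (\<chi>0 N)" "continuous_on A (\<chi>1 N)" "continuous_on A (\<chi>2 N)" "continuous_on A (\<chi>3 N)"
proof -
  show "continuous_on A (\<chi>0 N)" "continuous_on A (\<chi>1 N)" "continuous_on A (\<chi>2 N)"
    by (rule has_vector_derivative_imp_continuous_on, rule \<chi>_deriv[OF assms])+
  note cw = cutoff_deriv[THEN has_vector_derivative_imp_continuous_on]
  note cX = X_deriv[OF assms, THEN has_vector_derivative_imp_continuous_on]
  have "continuous_on A cut3" unfolding cut3_def bump_def by (intro continuous_intros)
  moreover have "continuous_on A (X3 N)" using X3_continuous[OF assms] continuous_on_subset by blast
  ultimately show "continuous_on A (\<chi>3 N)"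
    unfolding \<chi>3_def[abs_def] by (intro continuous_intros cw cX)
qed

lemma \<psi>_deriv: "N > 0 \<Longrightarrow> (\<psi> N has_vector_derivative \<chi>0 N y) (at y)"
  unfolding \<psi>_def by (rule prim_has_vector_derivative[OF \<chi>_continuous(1)])

lemma \<psi>_zero:
  assumes "y \<le> a / 2" shows "\<psi> N y = 0"
proof -
  have "\<psi> N y = prim (\<lambda>_. 0) y"
    unfolding \<psi>_def
  proof (rule prim_cong)
    fix s assume "s \<in> closed_segment 0 y"
    then have "s \<le> a / 2" using assms a by (auto simp: closed_segment_eq_real_ivl split: if_splits)
    then have "\<bar>s - a\<bar> \<ge> a / 2" by linarith
    then show "\<chi>0 N s = 0" by (rule \<chi>_zero)
  qed
  then show ?thesis by (simp add: prim_def)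
qed

lemma low_zero:
  assumes "y \<le> a / 2"
  shows "\<phi> N y = 0" "g0 N y = 0" "g1 N y = 0" "g2 N y = 0" "g3 N y = 0" "residual N y = 0" "residual' N y = 0"
proof -
  have "\<bar>y - a\<bar> \<ge> a / 2" using assms by linarith
  then show "\<phi> N y = 0" "g0 N y = 0" "g1 N y = 0" "g2 N y = 0" "g3 N y = 0" "residual N y = 0" "residual' N y = 0"
    by (simp_all add: \<phi>_def g0_def g1_def g2_def g3_def residual_def residual'_def \<psi>_zero[OF assms] \<chi>_zero)
qed

text \<open>The quasi-mode vanishes below a/2, so identities proved for y > 0, where U and its
  averages are differentiable, extend to the whole line.\<close>

lemma glue_deriv:
  fixes f f' :: "real \<Rightarrow> complex"
  assumes "\<And>y. y > 0 \<Longrightarrow> (f has_vector_derivative f' y) (at y)"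
    and "\<And>y. y \<le> a / 2 \<Longrightarrow> f y = 0" "\<And>y. y \<le> a / 2 \<Longrightarrow> f' y = 0"
  shows "(f has_vector_derivative f' y) (at y)"
proof (cases "y > 0")
  case False
  have "((\<lambda>_. 0) has_vector_derivative 0) (at y)" by (rule has_vector_derivative_const)
  then have "(f has_vector_derivative 0) (at y)"
    by (rule has_vector_derivative_transform_within_open[of _ _ _ "{..<a/2}"]) (use False a assms(2) in auto)
  then show ?thesis using assms(3)[of y] False a by simp
qed (use assms in blast)

lemma glue_continuous:
  fixes f :: "real \<Rightarrow> complex"
  assumes "continuous_on {0<..} f" and "\<And>y. y \<le> a / 2 \<Longrightarrow> f y = 0"
  shows "continuous_on UNIV f"
proof -
  have "continuous_on {..<a/2} (\<lambda>_. 0 :: complex)" by simp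
  then have "continuous_on {..<a/2} f"
    by (rule continuous_on_eq) (use assms(2) in auto)
  then have "continuous_on ({0<..} \<union> {..<a/2}) f"
    by (intro continuous_on_open_Un assms) auto
  moreover have "{0<..} \<union> {..<a/2} = UNIV" using a by auto
  ultimately show ?thesis by simp
qed

lemma g_deriv_pos:
  assumes "N > 0" "y > 0"
  shows "(\<phi> N has_vector_derivative g0 N y) (at y)" "(g0 N has_vector_derivative g1 N y) (at y)"
    "(g1 N has_vector_derivative g2 N y) (at y)" "(g2 N has_vector_derivative g3 N y) (at y)"
proof -
  note dV' = V_deriv[OF assms, THEN complex_of_real_has_vector_derivative]
  note d = dV' \<psi>_deriv[OF assms(1)] \<chi>_deriv[OF assms(1)]
  have dc: "((\<lambda>y. complex_of_real (V0 N y) - phase_speed N) has_vector_derivative V1 N y) (at y)"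
    using has_vector_derivative_diff[OF dV'(1) has_vector_derivative_const[of "phase_speed N"]] by simp
  show "(\<phi> N has_vector_derivative g0 N y) (at y)"
    unfolding \<phi>_def[abs_def] g0_def
    by (rule has_vector_derivative_eq_rhs, (rule dc d has_vector_derivative_mult)+)
      (simp add: algebra_simps)
  show "(g0 N has_vector_derivative g1 N y) (at y)"
    unfolding g0_def[abs_def] g1_def
    by (rule has_vector_derivative_eq_rhs, (rule dc d has_vector_derivative_add has_vector_derivative_mult_right has_vector_derivative_mult)+)
      (simp add: algebra_simps)
  show "(g1 N has_vector_derivative g2 N y) (at y)"
    unfolding g1_def[abs_def] g2_def
    by (rule has_vector_derivative_eq_rhs, (rule dc d has_vector_derivative_add has_vector_derivative_mult_right has_vector_derivative_mult)+)
      (simp add: algebra_simps)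
  show "(g2 N has_vector_derivative g3 N y) (at y)"
    unfolding g2_def[abs_def] g3_def
    by (rule has_vector_derivative_eq_rhs, (rule dc d has_vector_derivative_add has_vector_derivative_mult_right has_vector_derivative_mult)+)
      (simp add: algebra_simps)
qed

lemma g_deriv:
  assumes "N > 0"
  shows "(\<phi> N has_vector_derivative g0 N y) (at y)" "(g0 N has_vector_derivative g1 N y) (at y)"
    "(g1 N has_vector_derivative g2 N y) (at y)" "(g2 N has_vector_derivative g3 N y) (at y)"
  by (rule glue_deriv; simp add: g_deriv_pos[OF assms] low_zero)+

lemma V4_continuous: "N > 0 \<Longrightarrow> continuous_on {0<..} (V4 N)"
  unfolding mollify_def[abs_def]
  by (intro continuous_intros continuous_on_compose2[OF U3c]) (auto intro: add_nonneg_nonneg)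

lemma g_continuous:
  assumes "N > 0" shows "continuous_on UNIV (g2 N)" "continuous_on UNIV (g3 N)"
proof -
  show "continuous_on UNIV (g2 N)"
    using has_vector_derivative_imp_continuous_on[OF g_deriv(4)[OF assms]] .
  have cV: "continuous_on {0<..} (\<lambda>y. complex_of_real (V0 N y))" "continuous_on {0<..} (\<lambda>y. complex_of_real (V1 N y))"
    "continuous_on {0<..} (\<lambda>y. complex_of_real (V2 N y))" "continuous_on {0<..} (\<lambda>y. complex_of_real (V3 N y))"
    by (intro continuous_on_of_real, rule DERIV_continuous_on, rule has_field_derivative_at_within,
        rule V_deriv[OF assms], simp)+
  have "continuous_on {0<..} (g3 N)"
    unfolding g3_def[abs_def]
    by (intro continuous_intros cV V4_continuous \<chi>_continuous assms
        has_vector_derivative_imp_continuous_on[OF \<psi>_deriv])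
  then show "continuous_on UNIV (g3 N)" by (rule glue_continuous) (rule low_zero(5))
qed

lemma residual_deriv:
  assumes "N > 0" shows "(residual N has_vector_derivative residual' N y) (at y)"
proof (rule glue_deriv)
  fix y :: real assume y: "y > 0"
  note d = complex_of_real_has_vector_derivative[OF U_deriv[OF y]] complex_of_real_has_vector_derivative[OF U1_deriv[OF y]] g_deriv[OF assms, of y]
  show "(residual N has_vector_derivative residual' N y) (at y)"
    unfolding residual_def[abs_def] residual'_def
    by (rule has_vector_derivative_eq_rhs, (rule d has_vector_derivative_add has_vector_derivative_diff has_vector_derivative_mult_right has_vector_derivative_mult)+)
      (simp add: algebra_simps)
qed (simp_all add: low_zero)

lemma residual'_continuous:
  assumes "N > 0" shows "continuous_on UNIV (residual' N)"
proof (rule glue_continuous)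
  have cg: "continuous_on A (\<phi> N)" "continuous_on A (g1 N)" "continuous_on A (g3 N)" for A
    by (rule has_vector_derivative_imp_continuous_on[OF g_deriv(1)[OF assms]]
      has_vector_derivative_imp_continuous_on[OF g_deriv(3)[OF assms]]
      continuous_on_subset[OF g_continuous(2)[OF assms]] subset_UNIV)+
  have cU: "continuous_on {0<..} (\<lambda>y. complex_of_real (U y))" "continuous_on {0<..} (\<lambda>y. complex_of_real (U2 y))"
    using U_continuous by (intro continuous_on_of_real; force elim: continuous_on_subset)+
  show "continuous_on {0<..} (residual' N)"
    unfolding residual'_def[abs_def] by (intro continuous_intros cg cU)
qed (rule low_zero(7))

end

section \<open>Orders of the building blocks of the quasi-mode\<close>

context shear_profile
begin

lemma grow_\<xi>: "- 1 \<le> l \<Longrightarrow> grow l (\<lambda>N y. of_real (y - a))"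
  by (rule grow_mono[of "- 1"], rule growI[where C = 1 and m = 1])
    (simp_all add: norm_of_real powr_minus_divide field_simps del: of_real_diff)

lemma grow_pker: "2 \<le> l \<Longrightarrow> grow l (\<lambda>N y. pker N (of_real (y - a)))"
proof (rule grow_mono[of 2], rule growI[where C = 2 and m = 0])
  fix N y :: real assume "N \<ge> 1"
  then show "norm (pker N (of_real (y - a))) \<le> 2 * N powr 2 * (1 + N * \<bar>y - a\<bar>) ^ 0"
    using norm_pker_le[of N "y - a"] by simp
qed

lemmas grow_times = grow_mult[OF _ _ order_refl]

lemma grow_T: "grow 2 (\<lambda>N y. \<theta>0 * of_real (N\<^sup>2))"
  using grow_times[OF grow_const[OF order_refl, of \<theta>0] grow_power_N[of 2 2]] by simp

text \<open>Weights: -1 for \<xi>, 2 for \<open>pker\<close>, 2 for T, -3 for the normalisation. So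
  \<open>r0\<close> has order 4 - 3 = 1, and each derivative costs one factor N.\<close>

lemma grow_r:
  "grow 1 (\<lambda>N y. r0 N (of_real (y - a)))" "grow 2 (\<lambda>N y. r1 N (of_real (y - a)))"
  "grow 3 (\<lambda>N y. r2 N (of_real (y - a)))"
proof -
  note x1 = grow_\<xi>[OF order_refl] and p1 = grow_pker[OF order_refl] and c = grow_const[OF order_refl]
  note p2 = grow_power[OF p1, OF order_refl, of 2] and p3 = grow_power[OF p1, OF order_refl, of 3]
    and p4 = grow_power[OF p1, OF order_refl, of 4] and x2 = grow_power[OF x1, OF order_refl, of 2]
    and T2 = grow_power[OF grow_T, OF order_refl, of 2]
  show "grow 1 (\<lambda>N y. r0 N (of_real (y - a)))"
    unfolding r0_def by (rule grow_div_N[OF p2]) simp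
  have A: "grow 5 (\<lambda>N y. - 4 * of_real (y - a) * pker N (of_real (y - a)) ^ 3)"
    by (rule grow_mono[OF grow_times[OF grow_times[OF c x1] p3]]) simp
  have B: "grow 5 (\<lambda>N y. \<theta>0 * of_real (N\<^sup>2) * of_real (y - a) * (pker N (of_real (y - a)))\<^sup>2)"
    by (rule grow_mono[OF grow_times[OF grow_times[OF grow_T x1] p2]]) simp
  show "grow 2 (\<lambda>N y. r1 N (of_real (y - a)))"
    unfolding r1_def Let_def by (rule grow_div_N[of 5], rule grow_diff[OF A B]) simp
  have C: "grow 6 (\<lambda>N y. - 4 * pker N (of_real (y - a)) ^ 3)"
    by (rule grow_mono[OF grow_times[OF c p3]]) simp
  have D: "grow 6 (\<lambda>N y. 24 * (of_real (y - a))\<^sup>2 * pker N (of_real (y - a)) ^ 4)"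
    by (rule grow_mono[OF grow_times[OF grow_times[OF c x2] p4]]) simp
  have E: "grow 6 (\<lambda>N y. \<theta>0 * of_real (N\<^sup>2) * (pker N (of_real (y - a)))\<^sup>2)"
    by (rule grow_mono[OF grow_times[OF grow_T p2]]) simp
  have F: "grow 6 (\<lambda>N y. 8 * (\<theta>0 * of_real (N\<^sup>2)) * (of_real (y - a))\<^sup>2 * pker N (of_real (y - a)) ^ 3)"
    by (rule grow_mono[OF grow_times[OF grow_times[OF grow_times[OF c grow_T] x2] p3]]) simp
  have G: "grow 6 (\<lambda>N y. (\<theta>0 * of_real (N\<^sup>2))\<^sup>2 * (of_real (y - a))\<^sup>2 * (pker N (of_real (y - a)))\<^sup>2)"
    by (rule grow_mono[OF grow_times[OF grow_times[OF T2 x2] p2]]) simp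
  show "grow 3 (\<lambda>N y. r2 N (of_real (y - a)))"
    unfolding r2_def Let_def
    by (rule grow_div_N[of 6], rule grow_add[OF grow_add[OF grow_diff[OF grow_add[OF C D] E] F] G]) simp
qed

lemma bump_le: "0 \<le> bump y" "bump y \<le> a\<^sup>2 / 4"
  using a by (simp_all add: bump_def max_def)

lemma grow_cutoff: "grow 0 (\<lambda>N y. cut0 y)" "grow 0 (\<lambda>N y. cut1 y)" "grow 0 (\<lambda>N y. cut2 y)"
proof -
  have c: "grow 0 (\<lambda>N y. of_real (bump y ^ n))" for n
  proof (rule grow_bounded)
    show "norm (complex_of_real (bump y ^ n)) \<le> (a\<^sup>2 / 4) ^ n" for y
      using bump_le[of y] power_mono[of "bump y" "a\<^sup>2 / 4" n] by (simp add: norm_power)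
  qed simp
  show "grow 0 (\<lambda>N y. cut0 y)" unfolding cut0_def by (rule c)
  have x: "grow 0 (\<lambda>N y. of_real (y - a))" by (rule grow_\<xi>) simp
  have k: "grow 0 (\<lambda>N y. r)" for r by (rule grow_const) simp
  have "cut1 y = - 8 * (of_real (y - a) * of_real (bump y ^ 3))" for y
    by (simp add: cut1_def algebra_simps)
  then show "grow 0 (\<lambda>N y. cut1 y)"
    using grow_mult[OF k grow_mult[OF x c], of 0 0 "-8"] by simp
  have "cut2 y = - 8 * of_real (bump y ^ 3) + 48 * (of_real (y - a) * (of_real (y - a) * of_real (bump y ^ 2)))" for y
    by (simp add: cut2_def power2_eq_square algebra_simps)
  then show "grow 0 (\<lambda>N y. cut2 y)"
    using grow_add[OF grow_mult[OF k c, of 0 "-8"] grow_mult[OF k grow_mult[OF x grow_mult[OF x c]], of 0 0 0 48]] by simp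
qed

lemma core_pos: "\<bar>y - a\<bar> \<le> a / 2 \<Longrightarrow> y > 0"
  using a by linarith

text \<open>Each difference is one order smaller than the quantity it belongs to (compare
  \<open>grow_UVc\<close>); this one order makes the residual bounded.\<close>

lemma grow_U_V:
  "grow (-3) (\<lambda>N y. of_real (U y - b * (y - a)\<^sup>2))"
  "grow (-3) (\<lambda>N y. of_real (V0 N y - b * (y - a)\<^sup>2))"
  "grow (-2) (\<lambda>N y. of_real (V1 N y - 2 * b * (y - a)))"
  "grow (-1) (\<lambda>N y. of_real (V2 N y - 2 * b))"
proof -
  have M4: "M * exp (- \<alpha> * y) / N ^ 4 \<le> M * (1 / N ^ 4)" if "N \<ge> 1" "y > 0" for N y :: real
    using M_exp_le[OF that(2)] divide_right_mono[of "M * exp (- \<alpha> * y)" M "N ^ 4"] by simp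
  show "grow (-3) (\<lambda>N y. of_real (U y - b * (y - a)\<^sup>2))"
  proof (rule grow_vanishing[where K = M and n = 3])
    fix N y :: real assume *: "N \<ge> 1" "\<bar>y - a\<bar> \<le> a / 2"
    have "M * \<bar>y - a\<bar> ^ 3 \<le> M * (\<bar>y - a\<bar> ^ 3 + 1 / N ^ 4)"
      using M_nonneg * by (intro mult_left_mono) auto
    then show "norm (complex_of_real (U y - b * (y - a)\<^sup>2)) \<le> M * (\<bar>y - a\<bar> ^ 3 + 1 / N ^ 4)"
      using U_taylor(1)[OF core_pos[OF *(2)]] unfolding norm_of_real by linarith
  qed (use M_nonneg in auto)
  have close: "norm (complex_of_real (v - p)) \<le> M * (d + 1 / N ^ 4)"
    if "N \<ge> 1" "y > 0" "\<bar>v - u\<bar> \<le> M * exp (- \<alpha> * y) / N ^ 4" "\<bar>u - p\<bar> \<le> M * d" for N y v u p d :: real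
    using that M4[OF that(1,2)] unfolding norm_of_real by (simp add: distrib_left)
  show "grow (-3) (\<lambda>N y. of_real (V0 N y - b * (y - a)\<^sup>2))"
  proof (rule grow_vanishing[where K = M and n = 3])
    fix N y :: real assume *: "N \<ge> 1" "\<bar>y - a\<bar> \<le> a / 2"
    show "norm (complex_of_real (V0 N y - b * (y - a)\<^sup>2)) \<le> M * (\<bar>y - a\<bar> ^ 3 + 1 / N ^ 4)"
      by (rule close[OF *(1) core_pos[OF *(2)] V_close(1)])
        (use * core_pos[OF *(2)] U_taylor(1)[OF core_pos[OF *(2)]] in auto)
  qed (use M_nonneg in auto)
  show "grow (-2) (\<lambda>N y. of_real (V1 N y - 2 * b * (y - a)))"
  proof (rule grow_vanishing[where K = M and n = 2])
    fix N y :: real assume *: "N \<ge> 1" "\<bar>y - a\<bar> \<le> a / 2"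
    show "norm (complex_of_real (V1 N y - 2 * b * (y - a))) \<le> M * (\<bar>y - a\<bar> ^ 2 + 1 / N ^ 4)"
      by (rule close[OF *(1) core_pos[OF *(2)] V_close(2)])
        (use * core_pos[OF *(2)] U_taylor(2)[OF core_pos[OF *(2)]] in auto)
  qed (use M_nonneg in auto)
  show "grow (-1) (\<lambda>N y. of_real (V2 N y - 2 * b))"
  proof (rule grow_vanishing[where K = M and n = 1])
    fix N y :: real assume *: "N \<ge> 1" "\<bar>y - a\<bar> \<le> a / 2"
    show "norm (complex_of_real (V2 N y - 2 * b)) \<le> M * (\<bar>y - a\<bar> ^ 1 + 1 / N ^ 4)"
      by (rule close[OF *(1) core_pos[OF *(2)] V_close(3)])
        (use * core_pos[OF *(2)] U_taylor(3)[OF core_pos[OF *(2)]] in auto)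
  qed (use M_nonneg in auto)
qed

lemma grow_phase_speed: "grow (-2) (\<lambda>N y. phase_speed N)"
  unfolding phase_speed_def by (rule grow_minus, rule grow_div_N[of 0]) (auto intro: grow_const)

lemma grow_UVc:
  "grow (-2) (\<lambda>N y. of_real (U y) - phase_speed N)" "grow (-2) (\<lambda>N y. of_real (V0 N y) - phase_speed N)"
  "grow (-1) (\<lambda>N y. of_real (V1 N y))" "grow 0 (\<lambda>N y. of_real (V2 N y))"
  "grow (-2) (\<lambda>N y. of_real (b * (y - a)\<^sup>2) - phase_speed N)"
proof -
  have q: "grow (-2) (\<lambda>N y. of_real (b * (y - a)\<^sup>2))"
  proof -
    have "grow (-2) (\<lambda>N y. of_real b * (of_real (y - a))\<^sup>2)"
      by (rule grow_mult[of 0 _ "-2"], rule grow_const, simp, rule grow_power[of "-1"])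
        (auto intro: grow_\<xi> simp del: of_real_diff)
    then show ?thesis by simp
  qed
  have l: "grow (-1) (\<lambda>N y. of_real (2 * b * (y - a)))"
    using grow_mult[OF grow_const[OF order_refl, of "of_real (2 * b)"] grow_\<xi>[OF order_refl], of "-1"] by simp
  have "grow (-2) (\<lambda>N y. of_real (U y - b * (y - a)\<^sup>2) + of_real (b * (y - a)\<^sup>2) - phase_speed N)"
    by (intro grow_diff grow_add q grow_phase_speed grow_mono[OF grow_U_V(1)]) simp
  then show "grow (-2) (\<lambda>N y. of_real (U y) - phase_speed N)" by simp
  have "grow (-2) (\<lambda>N y. of_real (V0 N y - b * (y - a)\<^sup>2) + of_real (b * (y - a)\<^sup>2) - phase_speed N)"
    by (intro grow_diff grow_add q grow_phase_speed grow_mono[OF grow_U_V(2)]) simp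
  then show "grow (-2) (\<lambda>N y. of_real (V0 N y) - phase_speed N)" by simp
  have "grow (-1) (\<lambda>N y. of_real (V1 N y - 2 * b * (y - a)) + of_real (2 * b * (y - a)))"
    by (intro grow_add l grow_mono[OF grow_U_V(3)]) simp
  then show "grow (-1) (\<lambda>N y. of_real (V1 N y))" by simp
  have "grow 0 (\<lambda>N y. of_real (V2 N y - 2 * b) + of_real (2 * b))"
    by (intro grow_add grow_const grow_mono[OF grow_U_V(4)]) simp_all
  then show "grow 0 (\<lambda>N y. of_real (V2 N y))" by simp
  show "grow (-2) (\<lambda>N y. of_real (b * (y - a)\<^sup>2) - phase_speed N)" by (intro grow_diff q grow_phase_speed)
qed

text \<open>The Gaussian absorbs the polynomial and two further powers, leaving the kernel 1 / (1 +
  (N (y - a))^2), whose primitive is an arctangent and whose total mass is \<pi> / N.\<close>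

lemma gauss_grow:
  assumes "grow l f"
  obtains C where "C > 0" "\<And>N y. N \<ge> 1 \<Longrightarrow> \<bar>y - a\<bar> \<le> a / 2 \<Longrightarrow>
    norm (Egauss N (of_real (y - a)) * f N y) \<le> C * N powr l / (1 + (N * (y - a))\<^sup>2)"
proof -
  obtain C m where C: "C \<ge> 0" "\<And>N y. N \<ge> 1 \<Longrightarrow> \<bar>y - a\<bar> \<le> a / 2 \<Longrightarrow>
      norm (f N y) \<le> C * N powr l * (1 + N * \<bar>y - a\<bar>) ^ m"
    using assms(1) unfolding grow_def by blast
  obtain K :: real where K: "K > 0" "\<And>z. z \<ge> 0 \<Longrightarrow> (1 + z) ^ (m + 2) * exp (- (z\<^sup>2 / 4)) \<le> K"
    using power_times_gauss_bounded[of "m + 2"] by blast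
  have main: "norm (Egauss N (of_real (y - a)) * f N y) \<le> ((C + 1) * K) * N powr l / (1 + (N * (y - a))\<^sup>2)"
    if *: "N \<ge> 1" "\<bar>y - a\<bar> \<le> a / 2" for N y
  proof -
    let ?z = "N * \<bar>y - a\<bar>"
    have z: "?z \<ge> 0" using * by simp
    have z2: "(N * (y - a))\<^sup>2 = ?z\<^sup>2" by (simp add: power_mult_distrib)
    have le: "1 + ?z\<^sup>2 \<le> (1 + ?z)\<^sup>2" using z by (simp add: power2_sum)
    have "norm (Egauss N (of_real (y - a)) * f N y) * (1 + ?z\<^sup>2)
        \<le> (exp (- (?z\<^sup>2 / 4)) * (C * N powr l * (1 + ?z) ^ m)) * (1 + ?z)\<^sup>2"
      unfolding norm_mult norm_Egauss z2
      by (rule mult_mono[OF mult_left_mono[OF C(2)[OF *]] le]) (use C(1) z in simp_all)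
    also have "\<dots> = C * N powr l * ((1 + ?z) ^ (m + 2) * exp (- (?z\<^sup>2 / 4)))"
      by (simp add: power_add power2_eq_square mult_ac)
    also have "\<dots> \<le> (C + 1) * N powr l * K"
    proof (rule mult_mono[OF _ K(2)[OF z]])
      show "C * N powr l \<le> (C + 1) * N powr l" by (rule mult_right_mono) simp_all
      show "0 \<le> (C + 1) * N powr l" using C(1) by simp
      show "0 \<le> (1 + ?z) ^ (m + 2) * exp (- (?z\<^sup>2 / 4))"
        by (rule mult_nonneg_nonneg[OF zero_le_power]) (use z in simp_all)
    qed
    finally have "norm (Egauss N (of_real (y - a)) * f N y) * (1 + ?z\<^sup>2) \<le> (C + 1) * K * N powr l"
      by (simp only: mult.assoc mult.commute[of "N powr l"])
    moreover have "0 < 1 + ?z\<^sup>2" by (intro add_pos_nonneg) auto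
    ultimately show ?thesis
      unfolding z2 by (simp only: pos_le_divide_eq)
  qed
  have "(C + 1) * K > 0" by (rule mult_pos_pos) (use C(1) K(1) in simp_all)
  then show ?thesis by (rule that[OF _ main])
qed

end

lemma arctan_bound:
  fixes f :: "real \<Rightarrow> complex"
  assumes f: "continuous_on UNIV f" and N: "N > 0" and C: "C \<ge> 0" and xy: "x \<le> y"
    and b: "\<And>s. s \<in> {x..y} \<Longrightarrow> norm (f s) \<le> C * N / (1 + (N * (s - p))\<^sup>2)"
  shows "norm (prim f y - prim f x) \<le> C * (arctan (N * (y - p)) - arctan (N * (x - p)))"
proof -
  have i1: "(f has_integral (prim f y - prim f x)) {x..y}"
    using xy by (intro fundamental_theorem_of_calculus has_vector_derivative_at_within[OF prim_has_vector_derivative[OF f]])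
  have i2: "((\<lambda>s. C * N / (1 + (N * (s - p))\<^sup>2)) has_integral
      (C * arctan (N * (y - p)) - C * arctan (N * (x - p)))) {x..y}"
  proof (rule fundamental_theorem_of_calculus[OF xy])
    fix s
    have "((\<lambda>s. C * arctan (N * (s - p))) has_real_derivative C * N / (1 + (N * (s - p))\<^sup>2)) (at s within {x..y})"
      by (auto intro!: derivative_eq_intros simp: field_simps)
    then show "((\<lambda>s. C * arctan (N * (s - p))) has_vector_derivative C * N / (1 + (N * (s - p))\<^sup>2)) (at s within {x..y})"
      by (simp add: has_real_derivative_iff_has_vector_derivative)
  qed
  have "norm (integral {x..y} f) \<le> integral {x..y} (\<lambda>s. C * N / (1 + (N * (s - p))\<^sup>2))"
    by (rule integral_norm_bound_integral[OF has_integral_integrable[OF i1] has_integral_integrable[OF i2] b])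
  then have "norm (prim f y - prim f x) \<le> C * arctan (N * (y - p)) - C * arctan (N * (x - p))"
    by (simp only: integral_unique[OF i1] integral_unique[OF i2])
  then show ?thesis by (simp add: right_diff_distrib)
qed

context shear_profile
begin

text \<open>The support lies in y <= 2 a, so the weight e^(\<alpha> y) costs only the constant
  factor in \<open>D\<close>.\<close>

lemma gauss_bound:
  assumes "grow l f" and F: "F = (\<lambda>N y. Egauss N (of_real (y - a)) * f N y)"
    and F0: "\<And>N y. \<bar>y - a\<bar> \<ge> a / 2 \<Longrightarrow> F N y = 0"
  obtains C where "C > 0" "\<And>N y. N \<ge> 1 \<Longrightarrow> norm (F N y) \<le> C * N powr l / (1 + (N * (y - a))\<^sup>2)"
    "\<And>N y. N \<ge> 1 \<Longrightarrow> exp (\<alpha> * y) * norm (F N y) \<le> C * N powr l"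
proof -
  obtain C where C: "C > 0" "\<And>N y. N \<ge> 1 \<Longrightarrow> \<bar>y - a\<bar> \<le> a / 2 \<Longrightarrow>
    norm (Egauss N (of_real (y - a)) * f N y) \<le> C * N powr l / (1 + (N * (y - a))\<^sup>2)"
    using gauss_grow[OF assms(1)] by blast
  have pos: "0 < 1 + (N * (y - a))\<^sup>2" for N y :: real by (intro add_pos_nonneg) auto
  have 1: "norm (F N y) \<le> C * N powr l / (1 + (N * (y - a))\<^sup>2)" if "N \<ge> 1" for N y
  proof (cases "\<bar>y - a\<bar> \<le> a / 2")
    case True
    then show ?thesis using C(2) F that by simp
  next
    case False
    then have "F N y = 0" using F0[of y N] by simp
    then show ?thesis using C(1) less_imp_le[OF pos[of N y]] by simp
  qed
  define D where "D = C * exp (\<alpha> * (2 * a))"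
  have CD: "C \<le> D" using C(1) \<alpha> a by (simp add: D_def)
  have 2: "exp (\<alpha> * y) * norm (F N y) \<le> D * N powr l" if "N \<ge> 1" for N y
  proof (cases "\<bar>y - a\<bar> \<le> a / 2")
    case True
    have "norm (F N y) \<le> C * N powr l / (1 + (N * (y - a))\<^sup>2)" by (rule 1[OF that])
    also have "\<dots> \<le> C * N powr l / 1" using C(1) pos[of N y] by (intro divide_left_mono) auto
    finally have n: "norm (F N y) \<le> C * N powr l" by simp
    have "y \<le> 2 * a" using True a by linarith
    then have "exp (\<alpha> * y) \<le> exp (\<alpha> * (2 * a))" using \<alpha> by simp
    from mult_mono[OF this n] show ?thesis by (simp add: D_def mult_ac)
  next
    case False
    then have "F N y = 0" using F0[of y N] by simp
    then show ?thesis using C(1) by (simp add: D_def)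
  qed
  have 3: "norm (F N y) \<le> D * N powr l / (1 + (N * (y - a))\<^sup>2)" if "N \<ge> 1" for N y
  proof -
    have "C * N powr l / (1 + (N * (y - a))\<^sup>2) \<le> D * N powr l / (1 + (N * (y - a))\<^sup>2)"
      using CD pos[of N y] by (intro divide_right_mono mult_right_mono) auto
    then show ?thesis using 1[OF that, of y] by linarith
  qed
  show ?thesis using C(1) CD by (intro that[of D, OF _ 3 2]) auto
qed

lemma \<chi>0_bound:
  obtains C where "C > 0" "\<And>N y. N \<ge> 1 \<Longrightarrow> norm (\<chi>0 N y) \<le> C * N / (1 + (N * (y - a))\<^sup>2)"
    "\<And>N y. N \<ge> 1 \<Longrightarrow> exp (\<alpha> * y) * norm (\<chi>0 N y) \<le> C * N"
proof -
  have g: "grow 1 (\<lambda>N y. cut0 y * r0 N (of_real (y - a)))"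
    by (rule grow_mult[OF grow_cutoff(1) grow_r(1)]) simp
  have F: "\<chi>0 = (\<lambda>N y. Egauss N (of_real (y - a)) * (cut0 y * r0 N (of_real (y - a))))"
    by (simp add: fun_eq_iff \<chi>0_def X0_def del: of_real_diff)
  obtain C where "C > 0" "\<And>N y. N \<ge> 1 \<Longrightarrow> norm (\<chi>0 N y) \<le> C * N powr 1 / (1 + (N * (y - a))\<^sup>2)"
    "\<And>N y. N \<ge> 1 \<Longrightarrow> exp (\<alpha> * y) * norm (\<chi>0 N y) \<le> C * N powr 1"
    by (rule gauss_bound[OF g], rule F, erule \<chi>_zero(1), rule that)
  then show ?thesis by (intro that[of C]) auto
qed

text \<open>\<open>\<chi>0\<close> has height N and width 1/N, so its integral is bounded uniformly
  in N.\<close>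

lemma \<psi>_bound:
  obtains C where "C > 0" "\<And>N y. N \<ge> 1 \<Longrightarrow> norm (\<psi> N y) \<le> C"
proof -
  obtain C where C: "C > 0" "\<And>N y. N \<ge> 1 \<Longrightarrow> norm (\<chi>0 N y) \<le> C * N / (1 + (N * (y - a))\<^sup>2)"
    "\<And>N y. N \<ge> 1 \<Longrightarrow> exp (\<alpha> * y) * norm (\<chi>0 N y) \<le> C * N"
    by (rule \<chi>0_bound, rule that)
  have main: "norm (\<psi> N y) \<le> C * pi" if N: "N \<ge> 1" for N y
  proof (cases "y \<le> a / 2")
    case True
    then show ?thesis using C(1) by (simp add: \<psi>_zero)
  next
    case False
    then have y: "0 \<le> y" using a by linarith
    have "norm (prim (\<chi>0 N) y - prim (\<chi>0 N) 0) \<le> C * (arctan (N * (y - a)) - arctan (N * (0 - a)))"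
      by (rule arctan_bound[OF \<chi>_continuous(1) _ _ y C(2)[OF N]]) (use N C(1) in auto)
    also have "\<dots> \<le> C * pi"
      using C(1) arctan_ubound[of "N * (y - a)"] arctan_lbound[of "N * (0 - a)"]
      by (intro mult_left_mono) linarith+
    finally show ?thesis by (simp add: \<psi>_def)
  qed
  show ?thesis by (rule that[OF _ main]) (use C(1) in simp_all)
qed

lemma norm_phase_speed: "N \<ge> 1 \<Longrightarrow> norm (phase_speed N) \<le> \<bar>b\<bar>"
proof -
  assume N: "N \<ge> 1"
  have "norm (phase_speed N) = \<bar>b\<bar> / N\<^sup>2"
    by (simp add: phase_speed_def norm_divide norm_mult \<theta>0_props norm_power)
  also have "\<dots> \<le> \<bar>b\<bar>" using N by (simp add: divide_le_eq mult_le_cancel_left1 one_le_power)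
  finally show ?thesis .
qed

lemma growth_eq:
  assumes "N > 0"
  shows "growth N = - (\<i> * of_real (N ^ 3 / b) * phase_speed N)"
    and "\<i> * growth N * of_real (N ^ 3 / b) * (of_real b)\<^sup>2 = of_real b * (\<theta>0\<^sup>2 * of_real (N ^ 4))"
proof -
  have z: "\<zeta>0 = \<i> * cnj \<theta>0" by (simp add: \<zeta>0_def \<theta>0_def complex_eq_iff)
  show "growth N = - (\<i> * of_real (N ^ 3 / b) * phase_speed N)"
    using assms b by (simp add: growth_def phase_speed_def z field_simps eval_nat_numeral)
  have "\<i> * growth N * of_real (N ^ 3 / b) * (of_real b)\<^sup>2 = of_real b * ((\<i> * \<zeta>0) * of_real (N ^ 4))"
    using b by (simp add: growth_def field_simps eval_nat_numeral)
  then show "\<i> * growth N * of_real (N ^ 3 / b) * (of_real b)\<^sup>2 = of_real b * (\<theta>0\<^sup>2 * of_real (N ^ 4))"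
    by (simp only: \<theta>0_props(4))
qed

text \<open>Everything in the residual that is localised in the critical layer, after the terms of size \<open>N\<close> have cancelled
  by \<open>inner_ode\<close>.\<close>
definition \<tau> :: "real \<Rightarrow> real \<Rightarrow> complex" where
  "\<tau> N y = (let x = of_real (y - a); k = of_real (N ^ 3 / b); Q = of_real (b * (y - a)\<^sup>2) - phase_speed N;
      D = of_real (U y - b * (y - a)\<^sup>2); D0 = of_real (V0 N y - b * (y - a)\<^sup>2);
      D1 = of_real (V1 N y - 2 * b * (y - a)); D2 = of_real (V2 N y - 2 * b);
      p0 = r0 N x; p1 = r1 N x; p2 = r2 N x; v = of_real (V0 N y) - phase_speed N in
    cut0 y * (\<i> * growth N * k * (D * v + Q * D0) * p0 - D0 * p2 - 3 * (D1 * p1) - 3 * (D2 * p0))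
    + \<i> * k * ((of_real (U y) - phase_speed N) * v) * (cut0 y * p0)
    - 3 * (of_real (V1 N y) * (cut1 y * p0)) - v * (cut2 y * p0 + 2 * (cut1 y * p1)))"

text \<open>The terms are sorted by whether they contain \<open>\<psi>\<close> or the spike. Since
  \<lambda> = - i k c, the transport part of the former is a multiple of (U - c) V' - U' (V - c) =
  (U - V) V' + (V - c) (V' - U'), with V the average of U: it measures the averaging error
  alone.\<close>

lemma residual_split:
  assumes N: "N > 0"
  shows "residual N y = (growth N + 1) * (\<i> * of_real (N ^ 3 / b)) *
        ((of_real (U y) - of_real (V0 N y)) * of_real (V1 N y)
          + (of_real (V0 N y) - phase_speed N) * (of_real (V1 N y) - of_real (U1 y))) * \<psi> N y
      - of_real (V3 N y) * \<psi> N y + Egauss N (of_real (y - a)) * \<tau> N y"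
proof -
  define x k where "x = complex_of_real (y - a)" and "k = complex_of_real (N ^ 3 / b)"
  define E p0 p1 p2 where "E = Egauss N x" and "p0 = r0 N x" and "p1 = r1 N x" and "p2 = r2 N x"
  define u u1 v v1 v2 v3 B where "u = complex_of_real (U y)" and "u1 = complex_of_real (U1 y)"
    and "v = complex_of_real (V0 N y)" and "v1 = complex_of_real (V1 N y)" and "v2 = complex_of_real (V2 N y)"
    and "v3 = complex_of_real (V3 N y)" and "B = complex_of_real b"
  define c L s where "c = phase_speed N" and "L = growth N" and "s = \<psi> N y"
  define Q where "Q = B * x\<^sup>2 - c"
  have L: "L = - (\<i> * k * c)" unfolding L_def k_def c_def by (rule growth_eq(1)[OF N])
  have Qq: "Q = B * (x\<^sup>2 + cnj \<theta>0 / of_real (N\<^sup>2))"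
    by (simp add: Q_def c_def phase_speed_def B_def algebra_simps)
  \<comment> \<open>\<open>inner_ode\<close> multiplied by b: the exact profile equation with U
    replaced by its parabola.\<close>
  have H: "\<i> * L * k * Q\<^sup>2 * p0 = Q * p2 + 6 * B * x * p1 + 6 * B * p0"
  proof -
    let ?q = "x\<^sup>2 + cnj \<theta>0 / of_real (N\<^sup>2)"
    have "\<i> * L * k * Q\<^sup>2 * p0 = (\<i> * L * k * B\<^sup>2) * ?q\<^sup>2 * p0"
      unfolding Qq by (simp only: power_mult_distrib mult_ac)
    also have "\<i> * L * k * B\<^sup>2 = B * (\<theta>0\<^sup>2 * of_real (N ^ 4))"
      unfolding L_def k_def B_def by (rule growth_eq(2)[OF N])
    also have "B * (\<theta>0\<^sup>2 * of_real (N ^ 4)) * ?q\<^sup>2 * p0 = B * (\<theta>0\<^sup>2 * of_real (N ^ 4) * ?q\<^sup>2 * p0)"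
      by (simp only: mult.assoc)
    also have "\<dots> = B * (?q * p2 + 6 * x * p1 + 6 * p0)"
      unfolding p0_def p1_def p2_def x_def by (simp only: inner_ode[OF N])
    also have "\<dots> = Q * p2 + 6 * B * x * p1 + 6 * B * p0"
      unfolding Qq by (simp add: algebra_simps)
    finally show ?thesis .
  qed
  have R: "residual N y = (L + 1) * (L * (v1 * s + (v - c) * (cut0 y * (E * p0)))
      + \<i> * k * (u * (v1 * s + (v - c) * (cut0 y * (E * p0))) - u1 * ((v - c) * s)))
      - (v3 * s + 3 * (v2 * (cut0 y * (E * p0))) + 3 * (v1 * (cut1 y * (E * p0) + cut0 y * (E * p1)))
        + (v - c) * (cut2 y * (E * p0) + 2 * (cut1 y * (E * p1)) + cut0 y * (E * p2)))"
    unfolding residual_def g0_def \<phi>_def g2_def \<chi>0_def \<chi>1_def \<chi>2_def X0_def X1_def X2_def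
      L_def k_def u_def u1_def v_def v1_def v2_def v3_def s_def c_def E_def p0_def p1_def p2_def x_def
    by (rule refl)
  have T: "\<tau> N y = cut0 y * (\<i> * L * k * ((u - B * x\<^sup>2) * (v - c) + Q * (v - B * x\<^sup>2)) * p0
      - (v - B * x\<^sup>2) * p2 - 3 * ((v1 - 2 * B * x) * p1) - 3 * ((v2 - 2 * B) * p0))
    + \<i> * k * ((u - c) * (v - c)) * (cut0 y * p0)
    - 3 * (v1 * (cut1 y * p0)) - (v - c) * (cut2 y * p0 + 2 * (cut1 y * p1))"
    unfolding \<tau>_def Let_def L_def k_def u_def v_def v1_def v2_def c_def p0_def p1_def p2_def x_def Q_def B_def
    by simp
  \<comment> \<open>\<open>\<tau>\<close> is written with deviations from the parabola, the residual
    without them; the two forms differ by the cutoff times the equation \<open>H\<close>.\<close>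
  have e: "cut0 y * (\<i> * L * k * ((u - B * x\<^sup>2) * (v - c) + Q * (v - B * x\<^sup>2)) * p0
      - (v - B * x\<^sup>2) * p2 - 3 * ((v1 - 2 * B * x) * p1) - 3 * ((v2 - 2 * B) * p0))
    = cut0 y * (\<i> * L * k * ((u - c) * (v - c)) * p0 - (v - c) * p2 - 3 * (v1 * p1) - 3 * (v2 * p0))"
  proof -
    have "\<i> * L * k * ((u - B * x\<^sup>2) * (v - c) + Q * (v - B * x\<^sup>2)) * p0
      = \<i> * L * k * ((u - c) * (v - c)) * p0 - \<i> * L * k * Q\<^sup>2 * p0"
      unfolding Q_def by (simp add: algebra_simps power2_eq_square)
    then show ?thesis
      unfolding H by (intro arg_cong[where f="\<lambda>z. cut0 y * z"]) (simp add: Q_def algebra_simps)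
  qed
  show ?thesis
    unfolding R T e unfolding L_def[symmetric] k_def[symmetric] u_def[symmetric] u1_def[symmetric]
      v_def[symmetric] v1_def[symmetric] v3_def[symmetric] s_def[symmetric] c_def[symmetric] x_def[symmetric] E_def[symmetric]
    unfolding L by (simp add: algebra_simps)
qed

end

section \<open>Uniform bounds for the residual and the quasi-mode\<close>

context shear_profile
begin

text \<open>\<open>growth\<close> counts 1 and k counts 3. The first bracket has order 1 + 3 - 5 + 1
  = 0; the deviations of orders -3, -2, -1 meet \<open>r2\<close>, \<open>r1\<close>,
  \<open>r0\<close> of orders 3, 2, 1; the 1 in \<lambda> + 1 contributes 3 - 4 + 1 = 0; and each
  derivative on the cutoff saves one order.\<close>

lemma grow_\<tau>: "grow 0 \<tau>"
proof -
  note c = grow_const[OF order_refl]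
  have k: "grow 3 (\<lambda>N y. of_real (N ^ 3 / b))"
    using grow_times[OF grow_power_N[of 3 3] c[of "of_real (1 / b)"]] by simp
  have L: "grow 1 (\<lambda>N y. growth N)"
    unfolding growth_def using grow_times[OF c[of \<zeta>0] grow_power_N[of 1 1]] by simp
  note r = grow_r and w = grow_cutoff and D = grow_U_V and v = grow_UVc
  have 1: "grow (-5) (\<lambda>N y. of_real (U y - b * (y - a)\<^sup>2) * (of_real (V0 N y) - phase_speed N)
      + (of_real (b * (y - a)\<^sup>2) - phase_speed N) * of_real (V0 N y - b * (y - a)\<^sup>2))"
    by (rule grow_add; rule grow_mono[OF grow_times[OF D(1) v(2)]] grow_mono[OF grow_times[OF v(5) D(2)]]; simp)
  have 2: "grow 0 (\<lambda>N y. cut0 y * (\<i> * growth N * of_real (N ^ 3 / b) * (of_real (U y - b * (y - a)\<^sup>2) * (of_real (V0 N y) - phase_speed N)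
      + (of_real (b * (y - a)\<^sup>2) - phase_speed N) * of_real (V0 N y - b * (y - a)\<^sup>2)) * r0 N (of_real (y - a))
      - of_real (V0 N y - b * (y - a)\<^sup>2) * r2 N (of_real (y - a))
      - 3 * (of_real (V1 N y - 2 * b * (y - a)) * r1 N (of_real (y - a)))
      - 3 * (of_real (V2 N y - 2 * b) * r0 N (of_real (y - a)))))"
    by (rule grow_mult[OF w(1) grow_diff[OF grow_diff[OF grow_diff[
          OF grow_mono[OF grow_times[OF grow_times[OF grow_times[OF grow_times[OF c L] k] 1] r(1)]]
             grow_mono[OF grow_times[OF D(2) r(3)]]]
             grow_mono[OF grow_times[OF c grow_times[OF D(3) r(2)]]]]
             grow_mono[OF grow_times[OF c grow_times[OF D(4) r(1)]]]], of 0]) simp_all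
  have 3: "grow 0 (\<lambda>N y. \<i> * of_real (N ^ 3 / b) * ((of_real (U y) - phase_speed N) * (of_real (V0 N y) - phase_speed N)) * (cut0 y * r0 N (of_real (y - a))))"
    by (rule grow_mono[OF grow_times[OF grow_times[OF grow_times[OF c k] grow_times[OF v(1,2)]] grow_times[OF w(1) r(1)]]]) simp
  have 4: "grow 0 (\<lambda>N y. 3 * (of_real (V1 N y) * (cut1 y * r0 N (of_real (y - a)))))"
    by (rule grow_mono[OF grow_times[OF c grow_times[OF v(3) grow_times[OF w(2) r(1)]]]]) simp
  have 5: "grow 0 (\<lambda>N y. (of_real (V0 N y) - phase_speed N) * (cut2 y * r0 N (of_real (y - a)) + 2 * (cut1 y * r1 N (of_real (y - a)))))"
    by (rule grow_mult[OF v(2) grow_add[OF grow_mono[OF grow_times[OF w(3) r(1)]] grow_mono[OF grow_times[OF c grow_times[OF w(2) r(2)]]]], of 2]) simp_all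
  have "\<tau> = (\<lambda>N y. cut0 y * (\<i> * growth N * of_real (N ^ 3 / b) * (of_real (U y - b * (y - a)\<^sup>2) * (of_real (V0 N y) - phase_speed N)
      + (of_real (b * (y - a)\<^sup>2) - phase_speed N) * of_real (V0 N y - b * (y - a)\<^sup>2)) * r0 N (of_real (y - a))
      - of_real (V0 N y - b * (y - a)\<^sup>2) * r2 N (of_real (y - a))
      - 3 * (of_real (V1 N y - 2 * b * (y - a)) * r1 N (of_real (y - a)))
      - 3 * (of_real (V2 N y - 2 * b) * r0 N (of_real (y - a))))
      + \<i> * of_real (N ^ 3 / b) * ((of_real (U y) - phase_speed N) * (of_real (V0 N y) - phase_speed N)) * (cut0 y * r0 N (of_real (y - a)))
      - 3 * (of_real (V1 N y) * (cut1 y * r0 N (of_real (y - a))))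
      - (of_real (V0 N y) - phase_speed N) * (cut2 y * r0 N (of_real (y - a)) + 2 * (cut1 y * r1 N (of_real (y - a)))))"
    unfolding \<tau>_def Let_def by (rule refl)
  then show ?thesis using grow_diff[OF grow_diff[OF grow_add[OF 2 3] 4] 5] by (simp only:)
qed

lemma weighted_bound:
  fixes z :: complex
  assumes "norm z \<le> K * (M * exp (- \<alpha> * y))" shows "exp (\<alpha> * y) * norm z \<le> K * M"
proof -
  have "exp (\<alpha> * y) * norm z \<le> exp (\<alpha> * y) * (K * (M * exp (- \<alpha> * y)))"
    using assms by (intro mult_left_mono) auto
  also have "\<dots> = K * M" by (simp add: exp_minus)
  finally show ?thesis .
qed

lemma residual_bound:
  obtains C where "\<And>N y. N \<ge> 1 \<Longrightarrow> exp (\<alpha> * y) * norm (residual N y) \<le> C"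
proof -
  obtain P where P: "P > 0" "\<And>N y. N \<ge> 1 \<Longrightarrow> norm (\<psi> N y) \<le> P" by (rule \<psi>_bound, rule that)
  have F0: "Egauss N (of_real (y - a)) * \<tau> N y = 0" if "\<bar>y - a\<bar> \<ge> a / 2" for N y
    using bump_zero[OF that] by (simp add: \<tau>_def Let_def cut0_def cut1_def cut2_def)
  obtain C where C: "C > 0"
    "\<And>N y. N \<ge> 1 \<Longrightarrow> norm (Egauss N (of_real (y - a)) * \<tau> N y) \<le> C * N powr 0 / (1 + (N * (y - a))\<^sup>2)"
    "\<And>N y. N \<ge> 1 \<Longrightarrow> exp (\<alpha> * y) * norm (Egauss N (of_real (y - a)) * \<tau> N y) \<le> C * N powr 0"
    by (rule gauss_bound[OF grow_\<tau>], rule refl, erule F0, rule that)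
  \<comment> \<open>The product of (\<lambda> + 1) k <= (2 / |b|) N^4, the averaging error and the
    bound \<open>P\<close> for \<open>\<psi>\<close>; the powers N^4 cancel.\<close>
  define K where "K = 2 / \<bar>b\<bar> * (2 * M + \<bar>b\<bar>) * P"
  have main: "exp (\<alpha> * y) * norm (residual N y) \<le> K * M + P * M + C" if N: "N \<ge> 1" for N y
  proof (cases "y \<le> a / 2")
    case True
    then show ?thesis using M_nonneg P(1) C(1) by (simp add: low_zero K_def)
  next
    case False
    then have y: "y > 0" and N0: "N > 0" using a N by linarith+
    let ?e = "M * exp (- \<alpha> * y)"
    have e: "?e \<le> M" "0 \<le> ?e" using M_exp_le[OF y] M_nonneg by auto
    note Vb = V_bound[OF N0 y] and Vc = V_close[OF N0 y]
    let ?B = "(complex_of_real (U y) - of_real (V0 N y)) * of_real (V1 N y)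
          + (of_real (V0 N y) - phase_speed N) * (of_real (V1 N y) - of_real (U1 y))"
    have c1: "norm (complex_of_real (U y) - of_real (V0 N y)) \<le> ?e / N ^ 4"
      using Vc(1) by (simp add: abs_minus_commute flip: of_real_diff)
    have c2: "norm (complex_of_real (V1 N y) - of_real (U1 y)) \<le> ?e / N ^ 4"
      using Vc(2) by (simp flip: of_real_diff)
    have c3: "norm (complex_of_real (V0 N y) - phase_speed N) \<le> M + \<bar>b\<bar>"
      using norm_triangle_ineq4[of "complex_of_real (V0 N y)" "phase_speed N"] norm_phase_speed[OF N] Vb(1) e(1)
      unfolding norm_of_real by linarith
    have c4: "norm (complex_of_real (V1 N y)) \<le> M" using Vb(2) e(1) unfolding norm_of_real by linarith
    have "norm ?B \<le> ?e / N ^ 4 * M + (M + \<bar>b\<bar>) * (?e / N ^ 4)"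
      by (rule norm_triangle_le, rule add_mono; unfold norm_mult; rule mult_mono)
        (use c1 c2 c3 c4 M_nonneg e N0 in auto)
    also have "\<dots> = (2 * M + \<bar>b\<bar>) * (?e / N ^ 4)"
    proof -
      have "X * M + (M + \<bar>b\<bar>) * X = (2 * M + \<bar>b\<bar>) * X" for X by (simp add: algebra_simps)
      then show ?thesis .
    qed
    finally have B: "norm ?B \<le> (2 * M + \<bar>b\<bar>) * (?e / N ^ 4)" .
    have G: "norm ((growth N + 1) * (\<i> * complex_of_real (N ^ 3 / b))) \<le> 2 / \<bar>b\<bar> * N ^ 4"
    proof -
      have "norm (growth N + 1) \<le> N + 1"
        using norm_triangle_ineq[of "growth N" 1] N by (simp add: growth_def norm_mult \<theta>0_props)
      then have "norm (growth N + 1) \<le> 2 * N" using N by linarith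
      then have "norm ((growth N + 1) * (\<i> * complex_of_real (N ^ 3 / b))) \<le> (2 * N) * (N ^ 3 / \<bar>b\<bar>)"
        unfolding norm_mult norm_of_real using N by (intro mult_mono) auto
      also have "\<dots> = 2 / \<bar>b\<bar> * N ^ 4" by (simp add: eval_nat_numeral)
      finally show ?thesis .
    qed
    have "norm ((growth N + 1) * (\<i> * of_real (N ^ 3 / b)) * ?B * \<psi> N y)
        \<le> (2 / \<bar>b\<bar> * N ^ 4) * ((2 * M + \<bar>b\<bar>) * (?e / N ^ 4)) * P"
      unfolding norm_mult[of _ "\<psi> N y"] norm_mult[of _ ?B]
      by (intro mult_mono G B P(2) N) (use e M_nonneg N0 in auto)
    also have "\<dots> = K * ?e" using N0 by (simp add: K_def)
    finally have 1: "exp (\<alpha> * y) * norm ((growth N + 1) * (\<i> * of_real (N ^ 3 / b)) * ?B * \<psi> N y) \<le> K * M"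
      by (rule weighted_bound)
    have "norm (complex_of_real (V3 N y) * \<psi> N y) \<le> P * ?e"
      unfolding norm_mult norm_of_real mult.commute[of P] by (intro mult_mono P(2) N Vb) (use e in auto)
    then have 2: "exp (\<alpha> * y) * norm (complex_of_real (V3 N y) * \<psi> N y) \<le> P * M"
      by (rule weighted_bound)
    have "norm (residual N y) \<le> norm ((growth N + 1) * (\<i> * of_real (N ^ 3 / b)) * ?B * \<psi> N y)
      + norm (complex_of_real (V3 N y) * \<psi> N y) + norm (Egauss N (of_real (y - a)) * \<tau> N y)"
      unfolding residual_split[OF N0]
      by (rule order_trans[OF norm_triangle_ineq add_right_mono[OF norm_triangle_ineq4]])
    then have "exp (\<alpha> * y) * norm (residual N y) \<le> exp (\<alpha> * y) * (norm ((growth N + 1) * (\<i> * of_real (N ^ 3 / b)) * ?B * \<psi> N y)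
      + norm (complex_of_real (V3 N y) * \<psi> N y) + norm (Egauss N (of_real (y - a)) * \<tau> N y))"
      by (rule mult_left_mono) simp
    also have "\<dots> \<le> K * M + P * M + C * N powr 0"
      unfolding distrib_left[of "exp (\<alpha> * y)"] by (rule add_mono[OF add_mono[OF 1 2] C(3)[OF N]])
    finally show ?thesis using N0 by simp
  qed
  show ?thesis by (rule that[OF main])
qed

text \<open>V - c and V' have orders -2 and -1, \<open>\<chi>0\<close> and \<open>\<chi>1\<close>
  have orders 1 and 2, so the spike terms in \<open>g0\<close> and \<open>g1\<close> are at most of
  order 0. Hence one y-derivative of the quasi-mode, as seen by the norm of the initial data, is
  still of size one.\<close>

lemma g_bound:
  obtains C where "C > 0" "\<And>N y. N \<ge> 1 \<Longrightarrow> exp (\<alpha> * y) * norm (g0 N y) \<le> C"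
    "\<And>N y. N \<ge> 1 \<Longrightarrow> exp (\<alpha> * y) * norm (g1 N y) \<le> C"
proof -
  obtain P where P: "P > 0" "\<And>N y. N \<ge> 1 \<Longrightarrow> norm (\<psi> N y) \<le> P" by (rule \<psi>_bound, rule that)
  note c = grow_const[OF order_refl] and r = grow_r and w = grow_cutoff and v = grow_UVc
  define f0 where "f0 = (\<lambda>N y. (complex_of_real (V0 N y) - phase_speed N) * (cut0 y * r0 N (of_real (y - a))))"
  define f1 where "f1 = (\<lambda>N y. 2 * (of_real (V1 N y) * (cut0 y * r0 N (of_real (y - a))))
      + (complex_of_real (V0 N y) - phase_speed N) * (cut1 y * r0 N (of_real (y - a)) + cut0 y * r1 N (of_real (y - a))))"
  have f0: "grow 0 f0"
    unfolding f0_def by (rule grow_mono[OF grow_times[OF v(2) grow_times[OF w(1) r(1)]]]) simp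
  have f1: "grow 0 f1"
    unfolding f1_def
    by (rule grow_add[OF grow_mono[OF grow_times[OF c grow_times[OF v(3) grow_times[OF w(1) r(1)]]]]
        grow_mult[OF v(2) grow_add[OF grow_mono[OF grow_times[OF w(2) r(1)]] grow_mono[OF grow_times[OF w(1) r(2)]]], of 2]]) simp_all
  define F0 where "F0 N y = (complex_of_real (V0 N y) - phase_speed N) * \<chi>0 N y" for N y
  define F1 where "F1 N y = 2 * (of_real (V1 N y) * \<chi>0 N y) + (complex_of_real (V0 N y) - phase_speed N) * \<chi>1 N y" for N y
  have F0: "F0 = (\<lambda>N y. Egauss N (of_real (y - a)) * f0 N y)" "F1 = (\<lambda>N y. Egauss N (of_real (y - a)) * f1 N y)"
    by (simp_all add: fun_eq_iff F0_def F1_def f0_def f1_def \<chi>0_def \<chi>1_def X0_def X1_def algebra_simps del: of_real_diff)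
  have Z: "\<bar>y - a\<bar> \<ge> a / 2 \<Longrightarrow> F0 N y = 0" "\<bar>y - a\<bar> \<ge> a / 2 \<Longrightarrow> F1 N y = 0" for N y
    by (simp_all add: F0_def F1_def \<chi>_zero)
  obtain C where C: "C > 0" "\<And>N y. N \<ge> 1 \<Longrightarrow> norm (F0 N y) \<le> C * N powr 0 / (1 + (N * (y - a))\<^sup>2)"
    "\<And>N y. N \<ge> 1 \<Longrightarrow> exp (\<alpha> * y) * norm (F0 N y) \<le> C * N powr 0"
    by (rule gauss_bound[OF f0], rule F0(1), erule Z(1), rule that)
  obtain D where D: "D > 0" "\<And>N y. N \<ge> 1 \<Longrightarrow> norm (F1 N y) \<le> D * N powr 0 / (1 + (N * (y - a))\<^sup>2)"
    "\<And>N y. N \<ge> 1 \<Longrightarrow> exp (\<alpha> * y) * norm (F1 N y) \<le> D * N powr 0"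
    by (rule gauss_bound[OF f1], rule F0(2), erule Z(2), rule that)
  have gen: "exp (\<alpha> * y) * norm (complex_of_real V * \<psi> N y + F) \<le> P * M + K"
    if "N \<ge> 1" "\<bar>V\<bar> \<le> M * exp (- \<alpha> * y)" "exp (\<alpha> * y) * norm F \<le> K" for N y V F K
  proof -
    have "norm (complex_of_real V * \<psi> N y) \<le> P * (M * exp (- \<alpha> * y))"
      unfolding norm_mult norm_of_real mult.commute[of P] by (intro mult_mono P(2) that) (use M_nonneg in auto)
    then have "exp (\<alpha> * y) * norm (complex_of_real V * \<psi> N y) \<le> P * M" by (rule weighted_bound)
    moreover have "exp (\<alpha> * y) * norm (complex_of_real V * \<psi> N y + F)
        \<le> exp (\<alpha> * y) * (norm (complex_of_real V * \<psi> N y) + norm F)"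
      by (intro mult_left_mono norm_triangle_ineq) simp
    ultimately show ?thesis using that(3) by (simp add: distrib_left)
  qed
  have pos: "P * M \<ge> 0" using P(1) M_nonneg by simp
  have 0: "exp (\<alpha> * y) * norm (g0 N y) \<le> P * M + (C + D)" if N: "N \<ge> 1" for N y
  proof (cases "y \<le> a / 2")
    case False
    then have y: "y > 0" and N0: "N > 0" using a N by linarith+
    have "g0 N y = of_real (V1 N y) * \<psi> N y + F0 N y" by (simp add: g0_def F0_def)
    then show ?thesis using gen[OF N V_bound(2)[OF N0 y], of "F0 N y" "C + D"] C(3)[OF N, of y] D(1) N0 by simp
  qed (use pos C(1) D(1) in \<open>simp add: low_zero\<close>)
  have 1: "exp (\<alpha> * y) * norm (g1 N y) \<le> P * M + (C + D)" if N: "N \<ge> 1" for N y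
  proof (cases "y \<le> a / 2")
    case False
    then have y: "y > 0" and N0: "N > 0" using a N by linarith+
    have "g1 N y = of_real (V2 N y) * \<psi> N y + F1 N y" by (simp add: g1_def F1_def)
    then show ?thesis using gen[OF N V_bound(3)[OF N0 y], of "F1 N y" "C + D"] D(3)[OF N, of y] C(1) N0 by simp
  qed (use pos C(1) D(1) in \<open>simp add: low_zero\<close>)
  show ?thesis by (rule that[OF _ 0 1]) (use pos C(1) D(1) in linarith)
qed

text \<open>The bound may depend on N, since it serves the existence of a solution for fixed N.
  Compactness covers [0, 2a]; beyond it the spike is absent and every term carries a factor
  \<open>\<psi>\<close>. The crude bound 2 M N^4 for \<open>V4\<close> reflects that no derivative
  of \<open>U3\<close> is at hand.\<close>

lemma residual'_bounded:
  assumes N: "N \<ge> 1"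
  obtains B where "\<And>y. norm (residual' N y) \<le> B"
proof -
  have N0: "N > 0" using N by simp
  obtain P where P: "P > 0" "\<And>N y. N \<ge> 1 \<Longrightarrow> norm (\<psi> N y) \<le> P" by (rule \<psi>_bound, rule that)
  have "compact (residual' N ` {0..2 * a})"
    by (intro compact_continuous_image continuous_on_subset[OF residual'_continuous[OF N0]]) auto
  from compact_imp_bounded[OF this]
  obtain B1 where "\<forall>x\<in>residual' N ` {0..2 * a}. norm x \<le> B1"
    unfolding bounded_iff by (elim exE)
  then have B1: "\<And>y. y \<in> {0..2 * a} \<Longrightarrow> norm (residual' N y) \<le> B1" by simp
  define k where "k = norm (complex_of_real (N ^ 3 / b))"
  define B2 where "B2 = norm (growth N + 1) * (norm (growth N) * (M * P) + k * (M * (M * P) + M * ((M + \<bar>b\<bar>) * P)))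
      + (2 * M * N ^ 4) * P"
  have far: "norm (residual' N y) \<le> B2" if y: "y \<ge> 2 * a" for y
  proof -
    have y0: "y > 0" and core: "\<bar>y - a\<bar> \<ge> a / 2" using y a by linarith+
    have e: "M * exp (- \<alpha> * y) \<le> M" by (rule M_exp_le[OF y0])
    have bd: "norm (complex_of_real (U y)) \<le> M" "norm (complex_of_real (U2 y)) \<le> M"
      "norm (complex_of_real (V2 N y)) \<le> M" "norm (complex_of_real (V0 N y)) \<le> M"
      using UM[of y] U2M[of y] V_bound[OF N0 y0] e y0 unfolding norm_of_real by linarith+
    have Vc: "norm (complex_of_real (V0 N y) - phase_speed N) \<le> M + \<bar>b\<bar>"
      using norm_triangle_ineq4[of "complex_of_real (V0 N y)" "phase_speed N"] norm_phase_speed[OF N] bd(4) by linarith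
    have y1: "y + 1 / N ^ 4 > 0" using y0 N0 by (intro add_pos_pos) auto
    have "\<bar>U3 (y + 1 / N ^ 4)\<bar> \<le> M" "\<bar>U3 y\<bar> \<le> M"
      by (rule order_trans[OF U3M M_exp_le]; use y0 y1 in linarith)+
    then have "N ^ 4 * \<bar>U3 (y + 1 / N ^ 4) - U3 y\<bar> \<le> N ^ 4 * (2 * M)"
      by (intro mult_left_mono) auto
    then have V4: "norm (complex_of_real (V4 N y)) \<le> 2 * M * N ^ 4"
      unfolding norm_of_real mollify_def abs_mult by (simp add: mult_ac)
    have p: "norm (\<psi> N y) \<le> P" by (rule P(2)[OF N])
    have R: "residual' N y = (growth N + 1) * (growth N * (of_real (V2 N y) * \<psi> N y) + \<i> * of_real (N ^ 3 / b) *
        (U y * (of_real (V2 N y) * \<psi> N y) - U2 y * ((of_real (V0 N y) - phase_speed N) * \<psi> N y))) - of_real (V4 N y) * \<psi> N y"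
      by (simp add: residual'_def g1_def g3_def \<phi>_def \<chi>_zero[OF core])
    have t1: "norm (of_real (V2 N y) * \<psi> N y) \<le> M * P"
      unfolding norm_mult by (intro mult_mono bd p) (use M_nonneg in auto)
    have t2: "norm (U y * (of_real (V2 N y) * \<psi> N y)) \<le> M * (M * P)"
      unfolding norm_mult[of "complex_of_real (U y)"] by (intro mult_mono bd t1) (use M_nonneg in auto)
    have t3: "norm (U2 y * ((of_real (V0 N y) - phase_speed N) * \<psi> N y)) \<le> M * ((M + \<bar>b\<bar>) * P)"
      unfolding norm_mult by (intro mult_mono bd p Vc) (use M_nonneg in auto)
    have t4: "norm (\<i> * of_real (N ^ 3 / b) * (U y * (of_real (V2 N y) * \<psi> N y) - U2 y * ((of_real (V0 N y) - phase_speed N) * \<psi> N y)))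
        \<le> k * (M * (M * P) + M * ((M + \<bar>b\<bar>) * P))"
      unfolding norm_mult[of "\<i> * of_real (N ^ 3 / b)"] norm_mult[of \<i>] k_def[symmetric] norm_ii mult_1_left
      by (intro mult_left_mono order_trans[OF norm_triangle_ineq4 add_mono[OF t2 t3]]) (simp add: k_def)
    have t5: "norm (growth N * (of_real (V2 N y) * \<psi> N y)) \<le> norm (growth N) * (M * P)"
      unfolding norm_mult[of "growth N"] by (intro mult_left_mono t1) auto
    have t6: "norm (complex_of_real (V4 N y) * \<psi> N y) \<le> 2 * M * N ^ 4 * P"
      unfolding norm_mult by (intro mult_mono V4 p) (use M_nonneg N0 in auto)
    show ?thesis
      unfolding R B2_def
      by (rule order_trans[OF norm_triangle_ineq4 add_mono[OF _ t6]], unfold norm_mult[of "growth N + 1"],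
          rule mult_left_mono[OF order_trans[OF norm_triangle_ineq add_mono[OF t5 t4]]]) simp
  qed
  have "norm (residual' N y) \<le> max 0 (max B1 B2)" for y
  proof -
    consider "y \<le> a / 2" | "y \<in> {0..2 * a}" | "y \<ge> 2 * a" using a by fastforce
    then show ?thesis
    proof cases
      case 1 then show ?thesis by (simp add: low_zero)
    next
      case 2 then show ?thesis using B1[of y] by linarith
    next
      case 3 then show ?thesis using far[of y] by linarith
    qed
  qed
  then show ?thesis by (rule that)
qed

end

section \<open>Lower bound for the quasi-mode\<close>

definition Ez :: "real \<Rightarrow> complex" where "Ez z = exp (- (\<theta>0 * of_real (z\<^sup>2)) / 2)"

lemma Ez_continuous: "continuous_on UNIV Ez"
  unfolding Ez_def by (intro continuous_intros) auto

lemma one_plus_square_neq_0: "complex_of_real (1 + s\<^sup>2) \<noteq> 0"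
proof -
  have "1 + s\<^sup>2 > 0" by (intro add_pos_nonneg) auto
  then show ?thesis by (subst of_real_eq_0_iff) simp
qed

lemma norm_exp_theta: "norm (exp (- (\<theta>0 * of_real r) / 2)) = exp (- (r / 4))"
  by (simp add: \<theta>0_def)

text \<open>The classical real-variable proof of the Gaussian integral works verbatim for the complex
  variance \<open>1/\<theta>0\<close>, since \<open>Re \<theta>0 > 0\<close>.\<close>
lemma gauss_identity:
  "\<theta>0 * (prim Ez x)\<^sup>2 + 2 * integral {0..1} (\<lambda>s. exp (- (\<theta>0 * of_real (x\<^sup>2 * (1 + s\<^sup>2))) / 2) / of_real (1 + s\<^sup>2))
    = of_real (pi / 2)"
proof -
  define h where "h x s = exp (- (\<theta>0 * of_real (x\<^sup>2 * (1 + s\<^sup>2))) / 2) / of_real (1 + s\<^sup>2)" for x s :: real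
  define h' where "h' x s = - \<theta>0 * of_real x * exp (- (\<theta>0 * of_real (x\<^sup>2 * (1 + s\<^sup>2))) / 2)" for x s :: real
  define H where "H x = integral (cbox 0 1) (h x)" for x
  note cs0 = one_plus_square_neq_0
  have dh: "((\<lambda>x. h x s) has_vector_derivative h' x s) (at x within UNIV)" for x s
  proof -
    define k where "k = complex_of_real (1 + s\<^sup>2)"
    have d: "((\<lambda>z. exp (- (\<theta>0 * (z\<^sup>2 * k)) / 2) / k) has_field_derivative
        (- (\<theta>0 * (2 * of_real x * k)) / 2) * exp (- (\<theta>0 * ((of_real x)\<^sup>2 * k)) / 2) / k) (at (of_real x))"
      using cs0[of s] by (auto intro!: derivative_eq_intros simp: k_def)
    have k: "complex_of_real (x\<^sup>2 * (1 + s\<^sup>2)) = (of_real x)\<^sup>2 * k" for x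
      unfolding k_def by (simp only: of_real_mult of_real_power)
    have "k \<noteq> 0" unfolding k_def by (rule cs0)
    then show ?thesis
      using has_vector_derivative_real_field[OF d, of UNIV] unfolding h_def h'_def k k_def[symmetric]
      by (simp add: mult_ac)
  qed
  have dH: "(H has_vector_derivative integral (cbox 0 1) (h' x)) (at x)" for x
    unfolding H_def
  proof (rule leibniz_rule_vector_derivative[where U = UNIV])
    show "((\<lambda>x. h x s) has_vector_derivative h' x s) (at x within UNIV)" for x s by (rule dh)
    show "h x integrable_on cbox 0 1" for x
      unfolding h_def by (intro integrable_continuous continuous_intros ballI cs0) simp_all
    show "continuous_on (UNIV \<times> cbox 0 1) (\<lambda>(x, s). h' x s)"
      unfolding h'_def case_prod_unfold by (intro continuous_intros) auto
  qed auto
  have G: "Ez x * prim Ez x = integral (cbox 0 1) (\<lambda>s. of_real x * exp (- (\<theta>0 * of_real (x\<^sup>2 * (1 + s\<^sup>2))) / 2))" for x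
  proof -
    have "Ez x * prim Ez x = integral {0..1} (\<lambda>s. Ez x * (x *\<^sub>R Ez (x * s)))"
      unfolding prim_def by (rule integral_mult_right[symmetric])
    also have "(\<lambda>s. Ez x * (x *\<^sub>R Ez (x * s))) = (\<lambda>s. of_real x * exp (- (\<theta>0 * of_real (x\<^sup>2 * (1 + s\<^sup>2))) / 2))"
      by (simp add: Ez_def scaleR_conv_of_real fun_eq_iff algebra_simps power_mult_distrib flip: exp_add)
        (simp add: add_divide_distrib diff_divide_distrib)
    finally show ?thesis by simp
  qed
  define T where "T x = \<theta>0 * (prim Ez x)\<^sup>2 + 2 * H x" for x
  have "(T has_vector_derivative 0) (at x within UNIV)" for x
  proof -
    have d: "(prim Ez has_vector_derivative Ez x) (at x)"
      by (rule prim_has_vector_derivative[OF Ez_continuous])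
    have "(T has_vector_derivative \<theta>0 * (prim Ez x * Ez x + Ez x * prim Ez x) + 2 * integral (cbox 0 1) (h' x)) (at x)"
      unfolding T_def power2_eq_square
      by (intro has_vector_derivative_add has_vector_derivative_mult_right has_vector_derivative_mult d dH)
    moreover have "integral (cbox 0 1) (h' x) = - \<theta>0 * (Ez x * prim Ez x)"
      unfolding G integral_mult_right[symmetric] h'_def by (simp add: mult_ac)
    ultimately show ?thesis by (simp add: algebra_simps)
  qed
  \<comment> \<open>At 0 the primitive vanishes and only 2 arctan 1 = \<pi>/2 is left of the
    constant.\<close>
  then have "T x = T 0"
    using has_vector_derivative_zero_constant[of UNIV T] by (metis UNIV_I convex_UNIV)
  moreover have "T 0 = of_real (pi / 2)"
  proof -
    have "((\<lambda>s. 1 / (1 + s\<^sup>2)) has_integral (arctan 1 - arctan 0)) {0..1::real}"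
      by (rule fundamental_theorem_of_calculus)
        (auto intro!: derivative_eq_intros simp: has_real_derivative_iff_has_vector_derivative[symmetric] divide_inverse)
    then have "((\<lambda>s. complex_of_real (1 / (1 + s\<^sup>2))) has_integral complex_of_real (arctan 1 - arctan 0)) {0..1::real}"
      by (rule has_integral_of_real)
    then have "H 0 = complex_of_real (pi / 4)"
      unfolding H_def h_def by (intro integral_unique) (simp add: arctan_one)
    then show ?thesis by (simp add: T_def mult.commute)
  qed
  ultimately have "T x = of_real (pi / 2)" by simp
  then show ?thesis unfolding T_def H_def h_def[abs_def] box_real .
qed

text \<open>For x >= 4 the correction in \<open>gauss_identity\<close> has modulus at most 2/5, so
  the squared modulus of the primitive is at least \<pi>/2 - 2/5 > 1.\<close>

lemma gauss_lower:
  assumes "x \<ge> 4"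
  shows "norm (prim Ez x) \<ge> 1"
proof -
  let ?H = "integral {0..1} (\<lambda>s. exp (- (\<theta>0 * of_real (x\<^sup>2 * (1 + s\<^sup>2))) / 2) / of_real (1 + s\<^sup>2))"
  note cs0 = one_plus_square_neq_0
  have "norm ?H \<le> exp (- (x\<^sup>2 / 4)) * (1 - 0)"
  proof (rule integral_bound)
    show "continuous_on {0..1} (\<lambda>s. exp (- (\<theta>0 * of_real (x\<^sup>2 * (1 + s\<^sup>2))) / 2) / complex_of_real (1 + s\<^sup>2))"
      by (intro continuous_intros ballI cs0) simp_all
    fix s :: real
    have 1: "1 \<le> 1 + s\<^sup>2" by simp
    have "x\<^sup>2 / 4 \<le> x\<^sup>2 * (1 + s\<^sup>2) / 4" using mult_left_mono[OF 1, of "x\<^sup>2"] by simp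
    then have "exp (- (x\<^sup>2 * (1 + s\<^sup>2) / 4)) \<le> exp (- (x\<^sup>2 / 4))" by simp
    then have "exp (- (x\<^sup>2 * (1 + s\<^sup>2) / 4)) / (1 + s\<^sup>2) \<le> exp (- (x\<^sup>2 / 4)) / 1"
      using 1 by (intro frac_le) auto
    then show "norm (exp (- (\<theta>0 * of_real (x\<^sup>2 * (1 + s\<^sup>2))) / 2) / complex_of_real (1 + s\<^sup>2)) \<le> exp (- (x\<^sup>2 / 4))"
      unfolding norm_divide norm_exp_theta norm_of_real using 1 by simp
  qed simp
  moreover have "x\<^sup>2 \<ge> 16" using power_mono[of 4 x 2] assms by simp
  then have "exp (- (x\<^sup>2 / 4)) \<le> exp (- 4)" by simp
  moreover have "exp (- 4) \<le> (1 / 5 :: real)"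
  proof -
    have "5 \<le> exp (4 :: real)" using exp_ge_add_one_self[of "4 :: real"] by linarith
    from le_imp_inverse_le[OF this] show ?thesis by (simp add: exp_minus)
  qed
  ultimately have H: "norm ?H \<le> 1 / 5" unfolding diff_0_right mult_1_right by linarith
  define I where "I = ?H"
  have "\<theta>0 * (prim Ez x)\<^sup>2 + 2 * I = of_real (pi / 2)"
    unfolding I_def by (rule gauss_identity)
  then have "norm (complex_of_real (pi / 2)) \<le> norm (\<theta>0 * (prim Ez x)\<^sup>2) + norm (2 * I)"
    using norm_triangle_ineq[of "\<theta>0 * (prim Ez x)\<^sup>2" "2 * I"] by (simp only:)
  moreover have "norm (complex_of_real (pi / 2)) = pi / 2" by (simp only: norm_of_real) simp
  moreover have "norm (\<theta>0 * (prim Ez x)\<^sup>2) = (norm (prim Ez x))\<^sup>2" by (simp add: norm_mult norm_power \<theta>0_props(5))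
  moreover have "norm (2 * I) = 2 * norm I" by (simp add: norm_mult)
  ultimately have "1 \<le> (norm (prim Ez x))\<^sup>2" using H pi_gt3 unfolding I_def[symmetric] by linarith
  then show ?thesis using power2_le_imp_le[of 1 "norm (prim Ez x)"] by simp
qed

text \<open>The spike in the inner variable z = N (y - a), see \<open>X0_scale\<close>.\<close>

definition \<chi>z :: "real \<Rightarrow> complex" where "\<chi>z z = Egauss 1 (of_real z) * r0 1 (of_real z)"

lemma \<chi>z_derivs:
  "(\<chi>z has_vector_derivative Egauss 1 (of_real z) * r1 1 (of_real z)) (at z)"
  "((\<lambda>z. Egauss 1 (of_real z) * r1 1 (of_real z)) has_vector_derivative Egauss 1 (of_real z) * r2 1 (of_real z)) (at z)"
  unfolding \<chi>z_def[abs_def]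
  using has_vector_derivative_real_field[OF Er_deriv(1)[of 1 z]] has_vector_derivative_real_field[OF Er_deriv(2)[of 1 z]]
  by simp_all

lemma \<chi>z_continuous: "continuous_on A \<chi>z"
  using \<chi>z_derivs(1) by (meson continuous_at_imp_continuous_on has_vector_derivative_continuous)

text \<open>Both sides are \<open>(q \<psi>)''\<close> for \<open>\<psi> = prim \<chi>z\<close>, so the limit of \<open>\<psi>\<close> at infinity is a nonzero multiple of a Gaussian integral.\<close>
lemma \<chi>z_integral_identity:
  "2 * prim \<chi>z z + (4 * of_real z * \<chi>z z
     + ((of_real z)\<^sup>2 + cnj \<theta>0) * (Egauss 1 (of_real z) * r1 1 (of_real z))) = \<theta>0\<^sup>2 * prim Ez z"
proof -
  define T where "T z = 2 * prim \<chi>z z + (4 * (of_real z * \<chi>z z)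
     + ((of_real z)\<^sup>2 + cnj \<theta>0) * (Egauss 1 (of_real z) * r1 1 (of_real z)))" for z
  have dz: "((\<lambda>z. (complex_of_real z)) has_vector_derivative 1) (at z)" for z
    using has_vector_derivative_of_real[of "\<lambda>z. z" 1 "at z"] by simp
  have dq: "((\<lambda>z. (complex_of_real z)\<^sup>2 + cnj \<theta>0) has_vector_derivative 2 * of_real z) (at z)" for z
    using has_vector_derivative_add[OF has_vector_derivative_mult[OF dz dz] has_vector_derivative_const[of "cnj \<theta>0"]]
    by (simp add: power2_eq_square)
  have "(T has_vector_derivative \<theta>0\<^sup>2 * Ez z) (at z)" for z
  proof -
    let ?E = "Egauss 1 (of_real z)" and ?q = "(complex_of_real z)\<^sup>2 + cnj \<theta>0"
    have "(T has_vector_derivative 2 * \<chi>z z + (4 * (of_real z * (?E * r1 1 (of_real z)) + 1 * \<chi>z z)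
        + (?q * (?E * r2 1 (of_real z)) + (2 * of_real z) * (?E * r1 1 (of_real z))))) (at z)"
      unfolding T_def
      by (intro has_vector_derivative_add has_vector_derivative_mult_right has_vector_derivative_mult dz dq \<chi>z_derivs
          prim_has_vector_derivative \<chi>z_continuous)
    also have "2 * \<chi>z z + (4 * (of_real z * (?E * r1 1 (of_real z)) + 1 * \<chi>z z)
        + (?q * (?E * r2 1 (of_real z)) + (2 * of_real z) * (?E * r1 1 (of_real z))))
      = ?E * (?q * r2 1 (of_real z) + 6 * of_real z * r1 1 (of_real z) + 6 * r0 1 (of_real z))"
      by (simp add: \<chi>z_def algebra_simps)
    also have "?q * r2 1 (of_real z) + 6 * of_real z * r1 1 (of_real z) + 6 * r0 1 (of_real z) = \<theta>0\<^sup>2 * (?q\<^sup>2 * r0 1 (of_real z))"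
      using inner_ode[of 1 z, symmetric] by (simp add: mult.assoc)
    \<comment> \<open>For N = 1, \<open>r0\<close> is exactly 1 / q^2, so that the pure Gaussian
      remains.\<close>
    also have "?q\<^sup>2 * r0 1 (of_real z) = 1"
      using qker_nz[of 1 z] by (simp add: r0_def pker_def power_divide)
    also have "?E = Ez z" by (simp add: Egauss_def Ez_def)
    finally show ?thesis by (simp add: mult_ac)
  qed
  from prim_unique[OF this, of z] have "prim (\<lambda>z. \<theta>0\<^sup>2 * Ez z) z = T z - T 0" .
  moreover have "T 0 = 0" by (simp add: T_def r1_def)
  ultimately show ?thesis by (simp add: T_def prim_mult_left mult.assoc)
qed

lemma \<chi>z_bound:
  obtains C where "C > 0" "\<And>z. norm (\<chi>z z) \<le> C / (1 + z\<^sup>2)"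
proof -
  obtain C :: real where C: "C > 0" "\<And>z. z \<ge> 0 \<Longrightarrow> (1 + z) ^ 2 * exp (- (z\<^sup>2 / 4)) \<le> C"
    by (rule power_times_gauss_bounded, rule that)
  have main: "norm (\<chi>z z) \<le> (4 * C) / (1 + z\<^sup>2)" for z
  proof -
    have p: "norm (pker 1 (of_real z)) \<le> 2" using norm_pker_le[of 1 z] by simp
    have n: "norm (\<chi>z z) \<le> exp (- (\<bar>z\<bar>\<^sup>2 / 4)) * 4"
      unfolding \<chi>z_def norm_mult norm_Egauss r0_def
      using power_mono[OF p, of 2] by (simp add: norm_power)
    have "1 + \<bar>z\<bar>\<^sup>2 \<le> (1 + \<bar>z\<bar>)\<^sup>2" by (simp add: power2_sum)
    from mult_mono[OF n this] have "norm (\<chi>z z) * (1 + \<bar>z\<bar>\<^sup>2) \<le> 4 * ((1 + \<bar>z\<bar>) ^ 2 * exp (- (\<bar>z\<bar>\<^sup>2 / 4)))"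
      by (simp add: mult_ac)
    also have "\<dots> \<le> 4 * C" using C(2)[of "\<bar>z\<bar>"] by simp
    finally have "norm (\<chi>z z) * (1 + z\<^sup>2) \<le> 4 * C" by simp
    moreover have "0 < 1 + z\<^sup>2" by (intro add_pos_nonneg) auto
    ultimately show ?thesis by (simp only: pos_le_divide_eq)
  qed
  show ?thesis by (rule that[OF _ main]) (use C(1) in simp)
qed

lemma \<chi>z_integral_lower:
  obtains Z where "\<And>z. z \<ge> Z \<Longrightarrow> norm (prim \<chi>z z) \<ge> 1 / 4"
proof -
  obtain C :: real where C: "C > 0" "\<And>z. z \<ge> 0 \<Longrightarrow> (1 + z) ^ 2 * exp (- (z\<^sup>2 / 4)) \<le> C"
    by (rule power_times_gauss_bounded, rule that)
  \<comment> \<open>The 4 is for \<open>gauss_lower\<close>. The boundary terms are at most (16 + 16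
    + 2) z = 34 z times the Gaussian, and z >= 68 C brings this below 1/2; then 2
    |\<open>prim \<chi>z z\<close>| >= 1 - 1/2.\<close>
  have main: "norm (prim \<chi>z z) \<ge> 1 / 4" if z: "z \<ge> max 4 (68 * C)" for z
  proof -
    let ?q = "(complex_of_real z)\<^sup>2 + cnj \<theta>0" and ?p = "pker 1 (of_real z)"
    have z0: "z \<ge> 0" "z \<ge> 4" using z by auto
    have p: "norm ?p \<le> 2" using norm_pker_le[of 1 z] by simp
    have qp: "?q * ?p = 1" using qker_nz[of 1 z] by (simp add: pker_def)
    have "?q * r1 1 (of_real z) = - 4 * of_real z * (?q * ?p) * ?p\<^sup>2 - \<theta>0 * of_real z * (?q * ?p) * ?p"
      by (simp add: r1_def Let_def power2_eq_square power3_eq_cube algebra_simps)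
    then have q1: "?q * r1 1 (of_real z) = - (4 * of_real z * ?p\<^sup>2 + \<theta>0 * of_real z * ?p)" by (simp add: qp)
    have p2: "norm (?p\<^sup>2) \<le> 4" using power_mono[OF p, of 2] by (simp add: norm_power)
    have n1: "norm (4 * of_real z * ?p\<^sup>2) \<le> 16 * z"
      using mult_left_mono[OF p2, of "4 * z"] z0 by (simp add: norm_mult)
    have n2: "norm (\<theta>0 * of_real z * ?p) \<le> 2 * z"
      using mult_left_mono[OF p, of z] z0 by (simp add: norm_mult \<theta>0_props)
    have "norm (4 * of_real z * r0 1 (of_real z) + ?q * r1 1 (of_real z)) \<le> 16 * z + (16 * z + 2 * z)"
      unfolding q1
      by (rule norm_triangle_le[OF add_mono])
        (use n1 norm_triangle_le[OF add_mono[OF n1 n2]] in \<open>simp_all only: norm_minus_cancel r0_def power_one of_real_1 div_by_1\<close>)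
    then have "norm (Egauss 1 (of_real z) * (4 * of_real z * r0 1 (of_real z) + ?q * r1 1 (of_real z)))
        \<le> exp (- (z\<^sup>2 / 4)) * (34 * z)"
      unfolding norm_mult norm_Egauss by (intro mult_mono) (use z0 in auto)
    also have "\<dots> \<le> 1 / 2"
    proof -
      have "68 * z * C \<le> z * (1 + z)" using z z0 mult_left_mono[of "68 * C" "1 + z" z] by (simp add: mult_ac)
      also have "\<dots> \<le> (1 + z) ^ 2" using z0 by (simp add: power2_eq_square algebra_simps)
      finally have 1: "68 * z * C \<le> (1 + z) ^ 2" .
      have "68 * z * C * exp (- (z\<^sup>2 / 4)) \<le> (1 + z) ^ 2 * exp (- (z\<^sup>2 / 4))"
        by (rule mult_right_mono[OF 1]) simp
      also have "\<dots> \<le> C" by (rule C(2)[OF z0(1)])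
      finally have "C * (68 * z * exp (- (z\<^sup>2 / 4))) \<le> C * 1" by (simp add: mult_ac)
      then have "68 * z * exp (- (z\<^sup>2 / 4)) \<le> 1" using C(1) by (simp only: mult_le_cancel_left_pos)
      then show ?thesis by (simp add: mult_ac)
    qed
    finally have s: "norm (4 * of_real z * \<chi>z z + ?q * (Egauss 1 (of_real z) * r1 1 (of_real z))) \<le> 1 / 2"
      by (simp add: \<chi>z_def algebra_simps)
    have "norm (\<theta>0\<^sup>2 * prim Ez z) = norm (prim Ez z)" by (simp add: norm_mult norm_power \<theta>0_props)
    then have "1 \<le> norm (\<theta>0\<^sup>2 * prim Ez z)" using gauss_lower[OF z0(2)] by simp
    also have "\<dots> \<le> norm (2 * prim \<chi>z z) + norm (4 * of_real z * \<chi>z z + ?q * (Egauss 1 (of_real z) * r1 1 (of_real z)))"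
      unfolding \<chi>z_integral_identity[symmetric] by (rule norm_triangle_ineq)
    finally show ?thesis using s by (simp add: norm_mult)
  qed
  show ?thesis by (rule that[OF main])
qed

lemma tendsto_const_over: "((\<lambda>N::real. K / N) \<longlongrightarrow> 0) at_top"
  by (rule tendsto_divide_0[OF tendsto_const filterlim_at_top_imp_at_infinity[OF filterlim_ident]])

lemma \<chi>z_even: "\<chi>z (- z) = \<chi>z z"
  by (simp add: \<chi>z_def Egauss_def r0_def pker_def)

context shear_profile
begin

lemma X0_scale:
  assumes N: "N > 0"
  shows "X0 N y = of_real N * \<chi>z (N * (y - a))"
proof -
  define x where "x = y - a"
  have "pker N (of_real x) = of_real (N\<^sup>2) * pker 1 (of_real (N * x))"
    using qker_nz[OF N, of x] qker_nz[of 1 "N * x"] N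
    by (simp add: pker_def field_simps power_mult_distrib)
  then have "r0 N (of_real x) = of_real N * r0 1 (of_real (N * x))"
    using N by (simp add: r0_def field_simps eval_nat_numeral)
  moreover have "Egauss N (of_real x) = Egauss 1 (of_real (N * x))"
    by (simp add: Egauss_def power_mult_distrib mult.assoc)
  ultimately show ?thesis by (simp add: X0_def \<chi>z_def x_def[symmetric] mult_ac)
qed

text \<open>s^4 - t^4 contains the factor (y - a)^2, worth N^(-2). Freezing the cutoff at its value
  at \<open>a\<close> therefore changes the spike of height N by a term whose integral is
  O(1/N).\<close>

lemma weight_defect:
  obtains C where "C > 0" "\<And>N y. N \<ge> 1 \<Longrightarrow> \<bar>y - a\<bar> \<le> a / 2 \<Longrightarrow>
    norm ((cut0 y - of_real ((a\<^sup>2 / 4) ^ 4)) * X0 N y) \<le> C / (1 + (N * (y - a))\<^sup>2)"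
proof -
  define t where "t = a\<^sup>2 / 4"
  define s where "s y = t - (y - a)\<^sup>2" for y
  have bump: "bump y = s y" if "\<bar>y - a\<bar> \<le> a / 2" for y
    using power_mono[OF that, of 2] by (simp add: bump_def s_def t_def power_divide)
  have "grow 0 (\<lambda>N y. of_real ((s y + t) * ((s y)\<^sup>2 + t\<^sup>2)))"
  proof (rule grow_bounded)
    fix y assume y: "\<bar>y - a\<bar> \<le> a / 2"
    have "0 \<le> s y" "s y \<le> t" using bump_le[of y] by (auto simp: bump[OF y] t_def)
    then have "(s y + t) * ((s y)\<^sup>2 + t\<^sup>2) \<le> (t + t) * (t\<^sup>2 + t\<^sup>2)"
      by (intro mult_mono add_mono power_mono) auto
    moreover have "0 \<le> (s y + t) * ((s y)\<^sup>2 + t\<^sup>2)"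
      using \<open>0 \<le> s y\<close> \<open>s y \<le> t\<close> by (intro mult_nonneg_nonneg) auto
    ultimately show "norm (complex_of_real ((s y + t) * ((s y)\<^sup>2 + t\<^sup>2))) \<le> (t + t) * (t\<^sup>2 + t\<^sup>2)"
      unfolding norm_of_real by linarith
  qed simp
  then have g: "grow 0 (\<lambda>N y. - (of_real (y - a))\<^sup>2 * of_real ((s y + t) * ((s y)\<^sup>2 + t\<^sup>2)) * r0 N (of_real (y - a)))"
    by (rule grow_mono[OF grow_times[OF grow_times[OF grow_minus[OF grow_power[OF grow_\<xi>[OF order_refl], OF order_refl, of 2]]] grow_r(1)]]) simp
  obtain C where C: "C > 0" "\<And>N y. N \<ge> 1 \<Longrightarrow> \<bar>y - a\<bar> \<le> a / 2 \<Longrightarrow>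
    norm (Egauss N (of_real (y - a)) * (- (of_real (y - a))\<^sup>2 * of_real ((s y + t) * ((s y)\<^sup>2 + t\<^sup>2)) * r0 N (of_real (y - a))))
      \<le> C * N powr 0 / (1 + (N * (y - a))\<^sup>2)"
    by (rule gauss_grow[OF g], rule that)
  have main: "norm ((cut0 y - of_real ((a\<^sup>2 / 4) ^ 4)) * X0 N y) \<le> C / (1 + (N * (y - a))\<^sup>2)"
    if "N \<ge> 1" "\<bar>y - a\<bar> \<le> a / 2" for N y
  proof -
    have e: "s y ^ 4 - t ^ 4 = - (y - a)\<^sup>2 * ((s y + t) * ((s y)\<^sup>2 + t\<^sup>2))"
      by (simp add: s_def algebra_simps eval_nat_numeral)
    have "cut0 y - of_real ((a\<^sup>2 / 4) ^ 4) = of_real (s y ^ 4 - t ^ 4)"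
      unfolding cut0_def bump[OF that(2)] t_def[symmetric] by (rule of_real_diff[symmetric])
    then have "cut0 y - of_real ((a\<^sup>2 / 4) ^ 4) = - (of_real (y - a))\<^sup>2 * of_real ((s y + t) * ((s y)\<^sup>2 + t\<^sup>2))"
      by (simp only: e of_real_mult of_real_minus of_real_power)
    then show ?thesis using C(2)[OF that] that(1) by (simp only: X0_def mult_ac) simp
  qed
  show ?thesis by (rule that[OF C(1) main])
qed

text \<open>Up to errors that vanish as N grows, \<open>\<psi> N y\<close> is \<omega> (F(N (y - a))
  + F(N a / 2)), the second sign coming from oddness of F. Both values of F approach the half-line
  integral of \<open>\<chi>z\<close>, of modulus at least 1/4, so they reinforce each other.\<close>

lemma \<psi>_lower:
  assumes y: "a < y" "y \<le> 3 * a / 2"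
  obtains c where "c > 0" "eventually (\<lambda>N. norm (\<psi> N y) \<ge> c) at_top"
proof -
  define \<omega> where "\<omega> = (a\<^sup>2 / 4) ^ 4"
  have \<omega>: "\<omega> > 0" using a by (simp add: \<omega>_def)
  define F where "F = prim \<chi>z"
  obtain Z where Z: "\<And>z. z \<ge> Z \<Longrightarrow> norm (prim \<chi>z z) \<ge> 1 / 4" by (rule \<chi>z_integral_lower, rule that)
  obtain C0 where C0: "C0 > 0" "\<And>z. norm (\<chi>z z) \<le> C0 / (1 + z\<^sup>2)" by (rule \<chi>z_bound, rule that)
  obtain C1 where C1: "C1 > 0" "\<And>N y. N \<ge> 1 \<Longrightarrow> \<bar>y - a\<bar> \<le> a / 2 \<Longrightarrow>
    norm ((cut0 y - of_real ((a\<^sup>2 / 4) ^ 4)) * X0 N y) \<le> C1 / (1 + (N * (y - a))\<^sup>2)"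
    by (rule weight_defect, rule that)
  have Fodd: "F (- z) = - F z" for z unfolding F_def by (rule prim_even) (rule \<chi>z_even)
  \<comment> \<open>1/2 is twice the 1/4 from \<open>\<chi>z_integral_lower\<close>; the arctangent
    term bounds the tail of \<open>\<chi>z\<close> beyond N (y - a), and the last term is the cost
    of freezing the cutoff.\<close>
  define L where "L N = \<omega> * (1 / 2 - C0 * (pi / 2 - arctan (N * (y - a)))) - C1 * pi / N" for N
  have low: "L N \<le> norm (\<psi> N y)" if N: "N \<ge> 1" "N * (a / 2) \<ge> Z" for N
  proof -
    have N0: "N > 0" using N by simp
    define D where "D y = (cut0 y - of_real \<omega>) * X0 N y" for y
    have X0c: "continuous_on UNIV (X0 N)" using has_vector_derivative_imp_continuous_on[OF X_deriv(1)[OF N0]] .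
    have Dc: "continuous_on UNIV D"
      unfolding D_def by (intro continuous_intros X0c has_vector_derivative_imp_continuous_on[OF cutoff_deriv(1)])
    have pX: "prim (X0 N) z = F (N * (z - a)) - F (N * (0 - a))" for z
    proof (rule prim_unique)
      fix s
      have "((\<lambda>z. N * (z - a)) has_vector_derivative N) (at s)"
        by (auto intro!: derivative_eq_intros simp: has_vector_derivative_def)
      from vector_diff_chain_at[OF this prim_has_vector_derivative[OF \<chi>z_continuous]]
      show "((\<lambda>z. F (N * (z - a))) has_vector_derivative X0 N s) (at s)"
        by (simp add: F_def o_def X0_scale[OF N0] scaleR_conv_of_real)
    qed
    have "\<chi>0 N = (\<lambda>y. of_real \<omega> * X0 N y + D y)"
      by (simp add: fun_eq_iff \<chi>0_def D_def algebra_simps)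
    then have p: "\<psi> N z = of_real \<omega> * prim (X0 N) z + prim D z" for z
      unfolding \<psi>_def by (simp add: prim_add continuous_on_mult_left[OF X0c] Dc prim_mult_left)
    have "\<psi> N y = \<psi> N y - \<psi> N (a / 2)" by (simp add: \<psi>_zero)
    also have "\<dots> = of_real \<omega> * (F (N * (y - a)) - F (N * (a / 2 - a))) + (prim D y - prim D (a / 2))"
      unfolding p pX by (simp add: algebra_simps)
    also have "N * (a / 2 - a) = - (N * (a / 2))" by (simp add: algebra_simps)
    finally have eq: "\<psi> N y = of_real \<omega> * (F (N * (y - a)) + F (N * (a / 2))) + (prim D y - prim D (a / 2))"
      by (simp only: Fodd diff_minus_eq_add)
    have "norm (prim D y - prim D (a / 2)) \<le> (C1 / N) * (arctan (N * (y - a)) - arctan (N * (a / 2 - a)))"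
    proof (rule arctan_bound[OF Dc N0])
      fix s assume "s \<in> {a / 2..y}"
      then have "\<bar>s - a\<bar> \<le> a / 2" using y unfolding atLeastAtMost_iff by linarith
      from C1(2)[OF N(1) this] show "norm (D s) \<le> (C1 / N) * N / (1 + (N * (s - a))\<^sup>2)"
        using N0 by (simp add: D_def \<omega>_def)
    qed (use C1(1) N0 y a in auto)
    also have "\<dots> \<le> (C1 / N) * pi"
      using arctan_ubound[of "N * (y - a)"] arctan_lbound[of "N * (a / 2 - a)"] C1(1) N0
      by (intro mult_left_mono) (linarith | simp)+
    finally have d: "norm (prim D y - prim D (a / 2)) \<le> C1 * pi / N" by simp
    have uv: "N * (y - a) \<le> N * (a / 2)" using y N0 by (intro mult_left_mono) auto
    have "norm (F (N * (a / 2)) - F (N * (y - a))) \<le> C0 * (arctan (1 * (N * (a / 2) - 0)) - arctan (1 * (N * (y - a) - 0)))"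
      unfolding F_def by (rule arctan_bound[OF \<chi>z_continuous _ _ uv]) (use C0 in auto)
    also have "\<dots> \<le> C0 * (pi / 2 - arctan (N * (y - a)))"
      using C0(1) arctan_ubound[of "N * (a / 2)"] by (intro mult_left_mono) auto
    finally have f: "norm (F (N * (a / 2)) - F (N * (y - a))) \<le> C0 * (pi / 2 - arctan (N * (y - a)))" .
    have "2 * norm (F (N * (a / 2))) = norm (2 * F (N * (a / 2)))" by (simp add: norm_mult)
    also have "\<dots> = norm ((F (N * (y - a)) + F (N * (a / 2))) + (F (N * (a / 2)) - F (N * (y - a))))"
      by (simp add: algebra_simps)
    also have "\<dots> \<le> norm (F (N * (y - a)) + F (N * (a / 2))) + norm (F (N * (a / 2)) - F (N * (y - a)))"
      by (rule norm_triangle_ineq)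
    finally have "1 / 2 - C0 * (pi / 2 - arctan (N * (y - a))) \<le> norm (F (N * (y - a)) + F (N * (a / 2)))"
      using Z[OF N(2)] f unfolding F_def by linarith
    then have "\<omega> * (1 / 2 - C0 * (pi / 2 - arctan (N * (y - a)))) \<le> norm (of_real \<omega> * (F (N * (y - a)) + F (N * (a / 2))))"
      unfolding norm_mult norm_of_real using \<omega> by simp
    moreover have "norm (of_real \<omega> * (F (N * (y - a)) + F (N * (a / 2)))) - norm (prim D y - prim D (a / 2)) \<le> norm (\<psi> N y)"
      unfolding eq by (rule norm_diff_ineq)
    ultimately show ?thesis using d unfolding L_def by linarith
  qed
  have "filterlim (\<lambda>N. N * (y - a)) at_top at_top"
    using y by (intro filterlim_at_top_mult_tendsto_pos[OF tendsto_const] filterlim_ident) auto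
  from filterlim_compose[OF tendsto_arctan_at_top this]
  have "(L \<longlongrightarrow> \<omega> * (1 / 2 - C0 * (pi / 2 - pi / 2)) - 0) at_top"
    unfolding L_def by (intro tendsto_intros tendsto_const_over)
  then have "eventually (\<lambda>N. L N > \<omega> / 4) at_top"
    by (rule order_tendstoD(1)) (use \<omega> in simp)
  moreover have "eventually (\<lambda>N. N \<ge> max 1 (Z / (a / 2))) at_top" by (rule eventually_ge_at_top)
  ultimately have "eventually (\<lambda>N. norm (\<psi> N y) \<ge> \<omega> / 4) at_top"
  proof eventually_elim
    case (elim N)
    then have "N \<ge> 1" "N * (a / 2) \<ge> Z" using a by (auto simp: pos_divide_le_eq)
    from low[OF this] elim(1) show ?case by linarith
  qed
  with \<omega> show ?thesis by (intro that[of "\<omega> / 4"]) auto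
qed

text \<open>At a fixed point slightly above \<open>a\<close> the spike is negligible for large N,
  and \<open>g0\<close> is close to U'(y) \<open>\<psi>\<close>.\<close>

lemma g0_lower:
  obtains y c N0 where "y > 0" "c > 0" "\<And>N. N \<ge> N0 \<Longrightarrow> norm (g0 N y) \<ge> c"
proof -
  \<comment> \<open>This keeps y in the range of \<open>\<psi>_lower\<close> and the Taylor
    remainder M d^2 below |b| d, half of the main term of U'(y).\<close>
  define d where "d = min (a / 2) (\<bar>b\<bar> / (M + 1))"
  define y where "y = a + d"
  have "d > 0" using a b M_nonneg by (simp add: d_def)
  moreover have "d \<le> a / 2" "d \<le> \<bar>b\<bar> / (M + 1)" unfolding d_def by (rule min.cobounded1 min.cobounded2)+
  ultimately have d: "d > 0" "d \<le> a / 2" "d \<le> \<bar>b\<bar> / (M + 1)" by blast+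
  have y: "a < y" "y \<le> 3 * a / 2" "y > 0" using d a by (auto simp: y_def)
  have "M * d \<le> (M + 1) * d" using d by simp
  also have "\<dots> \<le> \<bar>b\<bar>" using d(3) M_nonneg by (simp add: pos_le_divide_eq mult.commute)
  finally have Md: "M * d * d \<le> \<bar>b\<bar> * d" using d(1) by (intro mult_right_mono) auto
  have bd: "\<bar>b\<bar> * d > 0" using b d by simp
  have "\<bar>2 * b * d\<bar> = 2 * (\<bar>b\<bar> * d)" using d(1) by (simp add: abs_mult)
  moreover have "\<bar>U1 y - 2 * b * d\<bar> \<le> M * d * d"
    using U_taylor(2)[OF y(3)] by (simp add: y_def power2_eq_square)
  ultimately have U1: "\<bar>U1 y\<bar> > 0" using Md bd by linarith
  obtain c where c: "c > 0" "eventually (\<lambda>N. norm (\<psi> N y) \<ge> c) at_top" by (rule \<psi>_lower[OF y(1,2)], rule that)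
  obtain C where C: "C > 0" "\<And>N y. N \<ge> 1 \<Longrightarrow> norm (\<chi>0 N y) \<le> C * N / (1 + (N * (y - a))\<^sup>2)"
    "\<And>N y. N \<ge> 1 \<Longrightarrow> exp (\<alpha> * y) * norm (\<chi>0 N y) \<le> C * N" by (rule \<chi>0_bound, rule that)
  define K where "K = (M + \<bar>b\<bar>) * (C / d\<^sup>2)"
  define L where "L N = (\<bar>U1 y\<bar> - M / N) * c - K / N" for N
  have low: "L N \<le> norm (g0 N y)" if N: "N \<ge> 1" "norm (\<psi> N y) \<ge> c" "M / N < \<bar>U1 y\<bar>" for N
  proof -
    have N0: "N > 0" using N by simp
    have e: "M * exp (- \<alpha> * y) \<le> M" by (rule M_exp_le[OF y(3)])
    have "M * exp (- \<alpha> * y) / N ^ 4 \<le> M / N"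
      using e M_nonneg N(1) self_le_power[OF N(1), of 4] N0 by (intro frac_le) auto
    then have V1: "\<bar>V1 N y\<bar> \<ge> \<bar>U1 y\<bar> - M / N" using V_close(2)[OF N0 y(3)] by linarith
    have "(\<bar>U1 y\<bar> - M / N) * c \<le> \<bar>V1 N y\<bar> * norm (\<psi> N y)"
      using V1 N c(1) by (intro mult_mono) auto
    then have 1: "(\<bar>U1 y\<bar> - M / N) * c \<le> norm (of_real (V1 N y) * \<psi> N y)" by (simp add: norm_mult)
    have v: "norm (complex_of_real (V0 N y) - phase_speed N) \<le> M + \<bar>b\<bar>"
      using norm_triangle_ineq4[of "complex_of_real (V0 N y)" "phase_speed N"] norm_phase_speed[OF N(1)] V_bound(1)[OF N0 y(3)] e
      unfolding norm_of_real by linarith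
    have "norm (\<chi>0 N y) \<le> C * N / (1 + (N * d)\<^sup>2)" using C(2)[OF N(1), of y] by (simp add: y_def)
    also have "\<dots> \<le> C * N / (N * d)\<^sup>2" using C(1) N0 d(1) by (intro divide_left_mono mult_pos_pos add_pos_nonneg) auto
    also have "\<dots> = C / d\<^sup>2 / N" using N0 by (simp add: power2_eq_square)
    finally have x: "norm (\<chi>0 N y) \<le> C / d\<^sup>2 / N" .
    have "norm ((of_real (V0 N y) - phase_speed N) * \<chi>0 N y) \<le> (M + \<bar>b\<bar>) * (C / d\<^sup>2 / N)"
      unfolding norm_mult by (intro mult_mono v x) (use M_nonneg in auto)
    then have 2: "norm ((of_real (V0 N y) - phase_speed N) * \<chi>0 N y) \<le> K / N" by (simp add: K_def)
    have "norm (of_real (V1 N y) * \<psi> N y) - norm ((of_real (V0 N y) - phase_speed N) * \<chi>0 N y) \<le> norm (g0 N y)"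
      unfolding g0_def by (rule norm_diff_ineq)
    then show ?thesis using 1 2 unfolding L_def by linarith
  qed
  have "(L \<longlongrightarrow> (\<bar>U1 y\<bar> - 0) * c - 0) at_top"
    unfolding L_def by (intro tendsto_intros tendsto_const_over)
  then have "eventually (\<lambda>N. L N > \<bar>U1 y\<bar> * c / 2) at_top"
    by (rule order_tendstoD(1)) (use U1 c in simp)
  moreover have "eventually (\<lambda>N. M / N < \<bar>U1 y\<bar>) at_top"
    using order_tendstoD(2)[OF tendsto_const_over U1] .
  moreover have "eventually (\<lambda>N::real. N \<ge> 1) at_top" by (rule eventually_ge_at_top)
  ultimately have "eventually (\<lambda>N. norm (g0 N y) \<ge> \<bar>U1 y\<bar> * c / 2) at_top"
    using c(2)
  proof eventually_elim
    case (elim N)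
    from low[OF elim(3,4,2)] elim(1) show ?case by linarith
  qed
  then obtain N0 where "\<forall>N\<ge>N0. norm (g0 N y) \<ge> \<bar>U1 y\<bar> * c / 2" unfolding eventually_at_top_linorder by blast
  then show ?thesis using U1 c y(3) by (intro that[of y "\<bar>U1 y\<bar> * c / 2" N0]) auto
qed

end

section \<open>Norm inflation\<close>

lemma prim_decay_bound:
  assumes f: "continuous_on UNIV f" and t: "t \<ge> 0" and \<sigma>: "\<sigma> > 0" and B: "B \<ge> 0"
    and b: "\<And>s. 0 \<le> s \<Longrightarrow> s \<le> t \<Longrightarrow> norm (f s) \<le> B * exp (- \<sigma> * s)"
  shows "norm (prim f t) \<le> B / \<sigma>"
proof -
  have i: "((\<lambda>s. B * exp (- \<sigma> * s)) has_integral (- (B / \<sigma>) * exp (- \<sigma> * t) - - (B / \<sigma>) * exp (- \<sigma> * 0))) {0..t}"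
  proof (rule fundamental_theorem_of_calculus[OF t])
    fix s
    have "((\<lambda>s. - (B / \<sigma>) * exp (- \<sigma> * s)) has_real_derivative B * exp (- \<sigma> * s)) (at s within {0..t})"
      using \<sigma> by (auto intro!: derivative_eq_intros)
    then show "((\<lambda>s. - (B / \<sigma>) * exp (- \<sigma> * s)) has_vector_derivative B * exp (- \<sigma> * s)) (at s within {0..t})"
      by (simp add: has_real_derivative_iff_has_vector_derivative)
  qed
  have "norm (integral {0..t} f) \<le> integral {0..t} (\<lambda>s. B * exp (- \<sigma> * s))"
  proof (rule integral_norm_bound_integral)
    show "f integrable_on {0..t}"
      by (rule integrable_continuous_real) (rule continuous_on_subset[OF f subset_UNIV])
    show "(\<lambda>s. B * exp (- \<sigma> * s)) integrable_on {0..t}" using i by (rule has_integral_integrable)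
  qed (use b in auto)
  also have "\<dots> = B / \<sigma> - B / \<sigma> * exp (- \<sigma> * t)" using integral_unique[OF i] by simp
  also have "\<dots> \<le> B / \<sigma>" using B \<sigma> by simp
  finally show ?thesis by (simp add: prim_eq_integral[OF f t])
qed

text \<open>A cubic lower bound is enough: the quantity to be exceeded in
  \<open>norm_inflation_data\<close> grows like N^2.\<close>

lemma cube_le_exp:
  assumes "x \<ge> 0" shows "(x / 3) ^ 3 \<le> exp (x :: real)"
proof -
  have "x / 3 \<le> exp (x / 3)" using exp_ge_add_one_self[of "x / 3"] by linarith
  then have "(x / 3) ^ 3 \<le> exp (x / 3) ^ 3" using assms by (intro power_mono) auto
  also have "\<dots> = exp (real 3 * (x / 3))" by (rule exp_of_nat_mult[symmetric])
  finally show ?thesis by simp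
qed

context shear_profile
begin

text \<open>Exponential decay absorbs y^2 through x^2 <= e^(2x) with x = \<alpha> y / 2; this
  supplies the hypothesis on \<open>U2\<close> in \<open>mode_ivp\<close>.\<close>

lemma U2_square_bound:
  assumes "y \<ge> 0" shows "\<bar>U2 y\<bar> * y\<^sup>2 \<le> M * (4 / \<alpha>\<^sup>2)"
proof -
  have "\<alpha> * y / 2 \<le> exp (\<alpha> * y / 2)" using exp_ge_add_one_self[of "\<alpha> * y / 2"] by linarith
  then have "(\<alpha> * y / 2) ^ 2 \<le> exp (\<alpha> * y / 2) ^ 2" using assms \<alpha> by (intro power_mono) auto
  also have "\<dots> = exp (\<alpha> * y)" by (simp add: power2_eq_square flip: exp_add)
  finally have "y\<^sup>2 \<le> 4 / \<alpha>\<^sup>2 * exp (\<alpha> * y)"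
    using \<alpha> by (simp add: power_divide power_mult_distrib field_simps)
  then have "\<bar>U2 y\<bar> * y\<^sup>2 \<le> (M * exp (- \<alpha> * y)) * (4 / \<alpha>\<^sup>2 * exp (\<alpha> * y))"
    using U2M[OF assms] M_nonneg by (intro mult_mono) auto
  also have "\<dots> = M * (4 / \<alpha>\<^sup>2)" by (simp add: exp_minus)
  finally show ?thesis .
qed

lemma residual_solution:
  assumes N: "N \<ge> 1"
  obtains w wt where "mode_sol (N ^ 3 / b) U U1 w wt" "\<And>y. w 0 y = 0" "\<And>y. y \<ge> 0 \<Longrightarrow> wt 0 y = residual N y"
proof -
  have N0: "N > 0" using N by simp
  obtain B where B: "\<And>y. norm (residual' N y) \<le> B" by (rule residual'_bounded[OF N], rule that)
  define M' where "M' = M + M * (4 / \<alpha>\<^sup>2)"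
  have nn: "M * (4 / \<alpha>\<^sup>2) \<ge> 0" using M_nonneg by simp
  show ?thesis
  proof (rule mode_ivp[where M = M' and R = "residual N" and \<rho> = "residual' N" and B = B and k = "N ^ 3 / b"])
    show "continuous_on {0..} U2" by (rule U_continuous(3))
    show "\<bar>U y\<bar> \<le> M'" if "y \<ge> 0" for y
    proof -
      have "M * exp (- \<alpha> * y) \<le> M" using M_nonneg \<alpha> that by (simp add: mult_left_le)
      then show ?thesis using UM[OF that] nn unfolding M'_def by linarith
    qed
    show "\<bar>U2 y\<bar> * y\<^sup>2 \<le> M'" if "y \<ge> 0" for y
      using U2_square_bound[OF that] M_nonneg unfolding M'_def by linarith
    show "residual N 0 = 0" using low_zero(6)[of 0 N] a by simp
    show "thesis" if "mode_sol (N ^ 3 / b) U U1 w wt" "\<And>y. w 0 y = 0" "\<And>y. y \<ge> 0 \<Longrightarrow> wt 0 y = residual N y" for w wt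
      by (rule \<open>\<And>w wt. mode_sol (N ^ 3 / b) U U1 w wt \<Longrightarrow> (\<And>y. w 0 y = 0) \<Longrightarrow> (\<And>y. y \<ge> 0 \<Longrightarrow> wt 0 y = residual N y) \<Longrightarrow> thesis\<close>[OF that])
  qed (fact dU dU1 residual_deriv[OF N0] residual'_continuous[OF N0] B)+
qed

lemma g0_lipschitz:
  assumes N: "N \<ge> 1" and C: "\<And>y. exp (\<alpha> * y) * norm (g0 N y) \<le> C" "\<And>y. exp (\<alpha> * y) * norm (g1 N y) \<le> C"
  shows "norm (of_real (exp (\<alpha> * y)) * g0 N y - of_real (exp (\<alpha> * z)) * g0 N z) \<le> (\<alpha> + 1) * C * \<bar>y - z\<bar>"
proof -
  have N0: "N > 0" using N by simp
  define f where "f = (\<lambda>y. of_real (exp (\<alpha> * y)) * g0 N y)"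
  define f' where "f' = (\<lambda>y. of_real (exp (\<alpha> * y)) * g1 N y + of_real (\<alpha> * exp (\<alpha> * y)) * g0 N y)"
  have "(f has_derivative (\<lambda>h. h *\<^sub>R f' y)) (at y within UNIV)" for y
  proof -
    have "((\<lambda>y. complex_of_real (exp (\<alpha> * y))) has_vector_derivative of_real (\<alpha> * exp (\<alpha> * y))) (at y)"
      by (intro has_vector_derivative_of_real) (auto intro!: derivative_eq_intros)
    from has_vector_derivative_mult[OF this g_deriv(2)[OF N0]]
    show ?thesis by (simp add: f_def f'_def has_vector_derivative_def)
  qed
  moreover have "onorm (\<lambda>h. h *\<^sub>R f' y) \<le> (\<alpha> + 1) * C" for y
  proof (rule onorm_le)
    fix h :: real
    have "norm (f' y) \<le> norm (of_real (exp (\<alpha> * y)) * g1 N y) + norm (of_real (\<alpha> * exp (\<alpha> * y)) * g0 N y)"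
      unfolding f'_def by (rule norm_triangle_ineq)
    also have "\<dots> = exp (\<alpha> * y) * norm (g1 N y) + \<alpha> * (exp (\<alpha> * y) * norm (g0 N y))"
      using \<alpha> by (simp add: norm_mult)
    also have "\<dots> \<le> C + \<alpha> * C" using C \<alpha> by (intro add_mono mult_left_mono) auto
    finally have "norm (f' y) \<le> (\<alpha> + 1) * C" by (simp add: algebra_simps)
    from mult_right_mono[OF this, of "\<bar>h\<bar>"] show "norm (h *\<^sub>R f' y) \<le> (\<alpha> + 1) * C * norm h" by (simp add: mult.commute)
  qed
  ultimately have "norm (f y - f z) \<le> (\<alpha> + 1) * C * norm (y - z)"
    by (intro differentiable_bound[where S = UNIV]) auto
  then show ?thesis by (simp add: f_def)
qed

text \<open>Duhamel's formula acts separately at each y, so a bound on w along the single line y =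
  \<open>y1\<close> is enough. Integrated against e^(-s Re l) it gives X / Re l, and Re l = (sqrt 3
  / 2) N >= N / 2.\<close>

lemma amplified_solution:
  assumes N: "N \<ge> 1" and sol: "mode_sol (N ^ 3 / b) U U1 w wt" and w0: "\<And>y. w 0 y = 0"
    and wt0: "\<And>y. y \<ge> 0 \<Longrightarrow> wt 0 y = residual N y"
    and X: "\<And>t. 0 \<le> t \<Longrightarrow> t \<le> \<delta> \<Longrightarrow> norm (w t y1) \<le> X" and \<delta>: "\<delta> > 0" and X0: "X \<ge> 0"
    and le: "2 * X / N \<le> norm (g0 N y1)"
  obtains u ut where "mode_sol (N ^ 3 / b) U U1 u ut" "\<And>y. u 0 y = g0 N y" "\<And>y. ut 0 y = growth N * g0 N y"
    "exp (N * \<delta> / 2) * (norm (g0 N y1) - 2 * X / N) \<le> norm (u \<delta> y1)"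
proof -
  have N0: "N > 0" using N by simp
  define l where "l = growth N"
  have \<sigma>: "Re l \<ge> N / 2"
  proof -
    have "sqrt 3 \<ge> 1" by simp
    from mult_right_mono[OF this, of N] show ?thesis using N0 by (simp add: l_def growth_def \<zeta>0_def mult.commute)
  qed
  then have \<sigma>0: "Re l > 0" using N0 by linarith
  define u where "u = (\<lambda>t y. exp (l * of_real t) * (g0 N y - prim (\<lambda>s. exp (- l * of_real s) * w s y) t))"
  have p: "prim (g0 N) y = \<phi> N y" for y
    using prim_unique[OF g_deriv(1)[OF N0], of y] low_zero(1)[of 0 N] a by simp
  have ms: "mode_sol (N ^ 3 / b) U U1 u (\<lambda>t y. l * u t y - w t y)"
    unfolding u_def
  proof (rule mode_sol_duhamel[OF sol w0])
    show "wt 0 y = residual N y" if "y > 0" for y using wt0 that by simp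
    show "g0 N 0 = 0" using low_zero(2)[of 0 N] a by simp
    show "residual N y = (l + 1) * (l * g0 N y + \<i> * of_real (N ^ 3 / b) * (U y * g0 N y - U1 y * prim (g0 N) y)) - g2 N y" for y
      unfolding p l_def by (simp only: residual_def)
  qed (fact g_deriv[OF N0] g_continuous[OF N0])+
  have wc: "continuous_on UNIV (\<lambda>s. w s y1)"
  proof -
    have "cont2 w" using sol unfolding mode_sol_def by blast
    from cont2_compose[OF this, of UNIV "\<lambda>s. s" "\<lambda>_. y1"] show ?thesis by simp
  qed
  have "norm (prim (\<lambda>s. exp (- l * of_real s) * w s y1) \<delta>) \<le> X / Re l"
  proof (rule prim_decay_bound)
    show "continuous_on UNIV (\<lambda>s. exp (- l * of_real s) * w s y1)" by (intro continuous_intros wc)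
    show "norm (exp (- l * of_real s) * w s y1) \<le> X * exp (- Re l * s)" if "0 \<le> s" "s \<le> \<delta>" for s
      using mult_left_mono[OF X[OF that], of "exp (- (Re l * s))"] by (simp add: norm_mult mult.commute)
  qed (use \<delta> \<sigma>0 X0 in auto)
  also have "\<dots> \<le> X / (N / 2)" using \<sigma> N0 X0 by (intro divide_left_mono) auto
  finally have I: "norm (prim (\<lambda>s. exp (- l * of_real s) * w s y1) \<delta>) \<le> 2 * X / N" by (simp add: mult.commute)
  have "exp (N * \<delta> / 2) * (norm (g0 N y1) - 2 * X / N) \<le> norm (u \<delta> y1)"
  proof -
    have "norm (g0 N y1) - 2 * X / N \<le> norm (g0 N y1 - prim (\<lambda>s. exp (- l * of_real s) * w s y1) \<delta>)"
      using norm_triangle_ineq2[of "g0 N y1" "prim (\<lambda>s. exp (- l * of_real s) * w s y1) \<delta>"] I by linarith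
    moreover have "exp (N * \<delta> / 2) \<le> exp (Re l * \<delta>)" using mult_right_mono[OF \<sigma>, of \<delta>] \<delta> by simp
    ultimately have "exp (N * \<delta> / 2) * (norm (g0 N y1) - 2 * X / N)
        \<le> exp (Re l * \<delta>) * norm (g0 N y1 - prim (\<lambda>s. exp (- l * of_real s) * w s y1) \<delta>)"
      using le by (intro mult_mono) auto
    then show ?thesis by (simp add: u_def norm_mult)
  qed
  moreover have "u 0 y = g0 N y" for y by (simp add: u_def)
  ultimately show ?thesis
    by (intro that[of u "\<lambda>t y. l * u t y - w t y"] ms) (auto simp: w0 l_def)
qed

end

context shear_profile
begin

text \<open>Either the solution with data \<open>(0, residual)\<close>, which starts with size \<open>O(1)\<close>, grows beyond a multiple of
  \<open>k\<^sup>\<mu>\<close>, or Duhamel's formula keeps the solution starting from the quasi-mode within a relative distance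
  \<open>N\<^sup>3\<^sup>\<mu>\<^sup>-\<^sup>1\<close> of the growing quasi-mode.\<close>
lemma norm_inflation_data:
  assumes \<mu>: "0 \<le> \<mu>" "\<mu> < 1 / 3" and \<delta>: "\<delta> > 0"
  obtains k :: int and u ut c1 c2 c3 t0 y0 where
    "mode_sol (of_int k) U U1 u ut"
    "\<And>y. y \<ge> 0 \<Longrightarrow> exp (\<alpha> * y) * norm (u 0 y) \<le> c1"
    "\<And>y z. y \<ge> 0 \<Longrightarrow> z \<ge> 0 \<Longrightarrow>
      norm (of_real (exp (\<alpha> * y)) * u 0 y - of_real (exp (\<alpha> * z)) * u 0 z) \<le> c2 * \<bar>y - z\<bar>"
    "\<And>y. y \<ge> 0 \<Longrightarrow> exp (\<alpha> * y) * norm (ut 0 y) \<le> c3"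
    "c1 \<ge> 0" "c2 \<ge> 0" "c3 \<ge> 0"
    "(1 + (real_of_int k)\<^sup>2) powr (m / 2) * (c1 + c2 + c3) \<le> 1"
    "0 \<le> t0" "t0 \<le> \<delta>" "0 \<le> y0"
    "1 / \<delta> \<le> (1 + (real_of_int k)\<^sup>2) powr ((m - \<mu>) / 2) * (exp (\<alpha> * y0) * norm (u t0 y0))"
proof -
  obtain CR0 where CR0: "\<And>N y. N \<ge> 1 \<Longrightarrow> exp (\<alpha> * y) * norm (residual N y) \<le> CR0" by (rule residual_bound, rule that)
  \<comment> \<open>The maximum with 1 allows division by \<open>CR\<close>.\<close>
  define CR where "CR = max 1 CR0"
  have CR: "CR \<ge> 1" "CR > 0" "\<And>N y. N \<ge> 1 \<Longrightarrow> exp (\<alpha> * y) * norm (residual N y) \<le> CR"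
    using CR0 by (auto simp: CR_def le_max_iff_disj)
  obtain Cg where Cg: "Cg > 0" "\<And>N y. N \<ge> 1 \<Longrightarrow> exp (\<alpha> * y) * norm (g0 N y) \<le> Cg"
    "\<And>N y. N \<ge> 1 \<Longrightarrow> exp (\<alpha> * y) * norm (g1 N y) \<le> Cg" by (rule g_bound, rule that)
  obtain y1 c0 N0 where y1: "y1 > 0" and c0: "c0 > 0" "\<And>N. N \<ge> N0 \<Longrightarrow> norm (g0 N y1) \<ge> c0" by (rule g0_lower, rule that)
  \<comment> \<open>From 1 + k^2 <= (1 + 1/b^2) N^6: the constant in the comparison of (1 +
    k^2)^(\<mu>/2) with N^(3 \<mu>).\<close>
  define Bb where "Bb = (1 + 1 / b\<^sup>2) powr (\<mu> / 2)"
  have Bb: "Bb > 0" using add_pos_nonneg[of 1 "1 / b\<^sup>2"] by (simp add: Bb_def)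
  \<comment> \<open>Collects the constants of the final chain of inequalities, so that N^2
    \<open>Q\<close> c0 / 2 is what the exponential growth has to exceed.\<close>
  define Q where "Q = 2 * Cg * (\<alpha> + 3) * Bb / (c0 * \<delta>)"
  have Q: "Q \<ge> 0" using Cg \<alpha> Bb c0 \<delta> by (simp add: Q_def)
  have "((\<lambda>N. 2 * (Bb * CR / \<delta>) * N powr (3 * \<mu> - 1)) \<longlongrightarrow> 2 * (Bb * CR / \<delta>) * 0) at_top"
    using \<mu> by (intro tendsto_mult tendsto_const tendsto_neg_powr filterlim_ident) auto
  then have "eventually (\<lambda>N. 2 * (Bb * CR / \<delta>) * N powr (3 * \<mu> - 1) < c0 / 2) at_top"
    by (rule order_tendstoD(2)) (use c0 in simp)
  then have "eventually (\<lambda>N. 2 * (Bb * CR / \<delta>) * N powr (3 * \<mu> - 1) < c0 / 2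
      \<and> N \<ge> 1 \<and> N \<ge> N0 \<and> N \<ge> Q * (6 / \<delta>) ^ 3) at_top"
    by (intro eventually_conj eventually_ge_at_top)
  then obtain N1 where N1: "\<And>N. N \<ge> N1 \<Longrightarrow> 2 * (Bb * CR / \<delta>) * N powr (3 * \<mu> - 1) < c0 / 2"
    "\<And>N. N \<ge> N1 \<Longrightarrow> N \<ge> 1" "\<And>N. N \<ge> N1 \<Longrightarrow> N \<ge> N0" "\<And>N. N \<ge> N1 \<Longrightarrow> N \<ge> Q * (6 / \<delta>) ^ 3"
    unfolding eventually_at_top_linorder by blast
  \<comment> \<open>k = N^3 / b has to be an integer, so the integer \<open>n\<close> is chosen
    first and N is read off as a cube root; the sign of b goes into k.\<close>
  define n where "n = nat \<lceil>(max 1 N1) ^ 3 / \<bar>b\<bar>\<rceil>"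
  define N where "N = root 3 (real n * \<bar>b\<bar>)"
  have N3: "N ^ 3 = real n * \<bar>b\<bar>" by (simp add: N_def)
  have NN1: "N \<ge> N1"
  proof -
    have "(max 1 N1) ^ 3 / \<bar>b\<bar> \<le> real n" unfolding n_def by (rule real_nat_ceiling_ge)
    then have "(max 1 N1) ^ Suc 2 \<le> N ^ Suc 2" using b N3 by (simp add: pos_divide_le_eq)
    then have "max 1 N1 \<le> N" by (rule power_le_imp_le_base) (simp add: N_def)
    then show ?thesis by simp
  qed
  have N: "N \<ge> 1" "N > 0" using N1(2)[OF NN1] by auto
  define k where "k = (if b > 0 then int n else - int n)"
  have k: "real_of_int k = N ^ 3 / b" using b by (simp add: k_def N3)
  define K where "K = 1 + (real_of_int k)\<^sup>2"
  have K: "K \<ge> 1" "K > 0" by (auto simp: K_def add_pos_nonneg)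
  have Kpowr: "K powr p > 0" for p using K by simp
  have K\<mu>: "K powr (\<mu> / 2) \<le> Bb * N powr (3 * \<mu>)"
  proof -
    have "K = 1 + N ^ 6 / b\<^sup>2" by (simp add: K_def k power_divide flip: power_mult)
    also have "\<dots> \<le> N ^ 6 + N ^ 6 / b\<^sup>2" using one_le_power[OF N(1), of 6] by simp
    also have "\<dots> = (1 + 1 / b\<^sup>2) * N powr 6" using N by (simp add: algebra_simps powr_numeral)
    finally have "K powr (\<mu> / 2) \<le> ((1 + 1 / b\<^sup>2) * N powr 6) powr (\<mu> / 2)"
      using K \<mu> by (intro powr_mono2) auto
    also have "\<dots> = Bb * N powr (3 * \<mu>)" by (simp add: Bb_def powr_mult powr_powr)
    finally show ?thesis .
  qed
  have Kcancel: "K powr ((m - \<mu>) / 2) * K powr (- (m / 2)) = K powr (- (\<mu> / 2))"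
    by (simp add: diff_divide_distrib flip: powr_add)
  have Kone: "K powr (m / 2) * K powr (- (m / 2)) = 1" "K powr (- (\<mu> / 2)) * K powr (\<mu> / 2) = 1"
    using K by (simp_all flip: powr_add)
  obtain w wt where sol: "mode_sol (N ^ 3 / b) U U1 w wt" and w0: "\<And>y. w 0 y = 0"
    and wt0: "\<And>y. y \<ge> 0 \<Longrightarrow> wt 0 y = residual N y"
    by (rule residual_solution[OF N(1)], rule that)
  \<comment> \<open>The weighted size at which w, rescaled to admissible data, contributes
    1/\<delta> to the norm of order m - \<mu>.\<close>
  define X where "X = K powr (\<mu> / 2) * CR / \<delta>"
  have X: "X > 0" using Kpowr CR \<delta> by (simp add: X_def)
  show thesis
  proof (cases "\<exists>t y. 0 \<le> t \<and> t \<le> \<delta> \<and> 0 \<le> y \<and> X \<le> exp (\<alpha> * y) * norm (w t y)")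
    case True
    then obtain t0 y0 where ty: "0 \<le> t0" "t0 \<le> \<delta>" "0 \<le> y0" "X \<le> exp (\<alpha> * y0) * norm (w t0 y0)" by blast
    define s where "s = K powr (- (m / 2)) / CR"
    have s: "s > 0" using Kpowr CR by (simp add: s_def)
    have sCR: "s * CR = K powr (- (m / 2))" using CR by (simp add: s_def)
    show thesis
    proof (rule that[of k "\<lambda>t y. of_real s * w t y" "\<lambda>t y. of_real s * wt t y" 0 0 "s * CR" t0 y0])
      show "mode_sol (of_int k) U U1 (\<lambda>t y. of_real s * w t y) (\<lambda>t y. of_real s * wt t y)"
        unfolding k by (rule mode_sol_scale[OF sol])
      show "exp (\<alpha> * y) * norm (of_real s * wt 0 y) \<le> s * CR" if "y \<ge> 0" for y
        using mult_left_mono[OF CR(3)[OF N(1), of y], of s] s wt0[OF that] by (simp add: norm_mult mult_ac)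
      show "(1 + (real_of_int k)\<^sup>2) powr (m / 2) * (0 + 0 + s * CR) \<le> 1"
        unfolding sCR K_def[symmetric] using Kone by simp
      have "1 / \<delta> = K powr (- (\<mu> / 2)) * X / CR" using Kone(2) CR by (simp add: X_def)
      also have "\<dots> = K powr ((m - \<mu>) / 2) * s * X" unfolding Kcancel[symmetric] by (simp add: s_def)
      also have "\<dots> \<le> K powr ((m - \<mu>) / 2) * s * (exp (\<alpha> * y0) * norm (w t0 y0))"
        using ty(4) s by (intro mult_left_mono) auto
      finally show "1 / \<delta> \<le> (1 + (real_of_int k)\<^sup>2) powr ((m - \<mu>) / 2) * (exp (\<alpha> * y0) * norm (of_real s * w t0 y0))"
        unfolding K_def[symmetric] using s by (simp add: norm_mult mult_ac)
    qed (use w0 s CR ty in auto)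
  next
    case False
    have wX: "norm (w t y1) \<le> X" if "0 \<le> t" "t \<le> \<delta>" for t
    proof -
      have "exp (\<alpha> * y1) * norm (w t y1) < X" using False that y1 by (meson less_imp_le not_le)
      moreover have "1 * norm (w t y1) \<le> exp (\<alpha> * y1) * norm (w t y1)"
        using \<alpha> y1 by (intro mult_right_mono) auto
      ultimately show ?thesis by linarith
    qed
    have g1': "norm (g0 N y1) \<ge> c0" using c0(2)[OF N1(3)[OF NN1]] .
    have small: "2 * X / N \<le> c0 / 2"
    proof -
      have "2 * X / N \<le> 2 * (Bb * N powr (3 * \<mu>) * CR / \<delta>) / N"
        unfolding X_def using K\<mu> CR \<delta> N by (intro divide_right_mono mult_left_mono mult_right_mono) auto
      also have "\<dots> = 2 * (Bb * CR / \<delta>) * N powr (3 * \<mu> - 1)" using N by (simp add: powr_diff)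
      finally show ?thesis using N1(1)[OF NN1] by linarith
    qed
    then have le: "2 * X / N \<le> norm (g0 N y1)" using g1' c0 by linarith
    obtain u ut where u: "mode_sol (N ^ 3 / b) U U1 u ut" "\<And>y. u 0 y = g0 N y" "\<And>y. ut 0 y = growth N * g0 N y"
      "exp (N * \<delta> / 2) * (norm (g0 N y1) - 2 * X / N) \<le> norm (u \<delta> y1)"
      by (rule amplified_solution[OF N(1) sol w0 wt0 wX \<delta> less_imp_le[OF X] le], assumption+, rule that)
    \<comment> \<open>The data cost \<open>Cg\<close> for the sup norm, (\<alpha> + 1)
      \<open>Cg\<close> for the Lipschitz constant and N \<open>Cg\<close> for the velocity, which
      is \<open>growth N\<close> times \<open>g0\<close>.\<close>
    define s where "s = K powr (- (m / 2)) / (Cg * (\<alpha> + 2 + N))"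
    have pos: "Cg * (\<alpha> + 2 + N) > 0" using Cg \<alpha> N by simp
    have s: "s > 0" using Kpowr pos unfolding s_def by (rule divide_pos_pos)
    have sP: "s * (Cg * (\<alpha> + 2 + N)) = K powr (- (m / 2))"
    proof -
      have "z / P * P = z" if "P > 0" for z P :: real using that by simp
      from this[OF pos] show ?thesis unfolding s_def .
    qed
    have ng: "norm (growth N) = N" using N by (simp add: growth_def norm_mult \<theta>0_props)
    show thesis
    proof (rule that[of k "\<lambda>t y. of_real s * u t y" "\<lambda>t y. of_real s * ut t y" "s * Cg" "s * ((\<alpha> + 1) * Cg)" "s * (N * Cg)" \<delta> y1])
      show "mode_sol (of_int k) U U1 (\<lambda>t y. of_real s * u t y) (\<lambda>t y. of_real s * ut t y)"
        unfolding k by (rule mode_sol_scale[OF u(1)])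
      show "exp (\<alpha> * y) * norm (of_real s * u 0 y) \<le> s * Cg" for y
        using mult_left_mono[OF Cg(2)[OF N(1), of y], of s] s by (simp add: u(2) norm_mult mult_ac)
      show "norm (of_real (exp (\<alpha> * y)) * (of_real s * u 0 y) - of_real (exp (\<alpha> * z)) * (of_real s * u 0 z))
          \<le> s * ((\<alpha> + 1) * Cg) * \<bar>y - z\<bar>" for y z
      proof -
        have "of_real (exp (\<alpha> * y)) * (of_real s * u 0 y) - of_real (exp (\<alpha> * z)) * (of_real s * u 0 z)
          = of_real s * (of_real (exp (\<alpha> * y)) * g0 N y - of_real (exp (\<alpha> * z)) * g0 N z)"
          by (simp add: u(2) algebra_simps)
        then show ?thesis
          using mult_left_mono[OF g0_lipschitz[OF N(1) Cg(2)[OF N(1)] Cg(3)[OF N(1)], of y z], of s] s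
          by (simp only: norm_mult norm_of_real abs_of_pos mult.assoc less_imp_le)
      qed
      show "exp (\<alpha> * y) * norm (of_real s * ut 0 y) \<le> s * (N * Cg)" for y
        using mult_left_mono[OF Cg(2)[OF N(1), of y], of "s * N"] s N by (simp add: u(3) norm_mult ng mult_ac)
      have "s * Cg + s * ((\<alpha> + 1) * Cg) + s * (N * Cg) = s * (Cg * (\<alpha> + 2 + N))" by (simp add: algebra_simps)
      also note sP
      finally show "(1 + (real_of_int k)\<^sup>2) powr (m / 2) * (s * Cg + s * ((\<alpha> + 1) * Cg) + s * (N * Cg)) \<le> 1"
        unfolding K_def[symmetric] using Kone by simp
      have "c0 / 2 \<le> norm (g0 N y1) - 2 * X / N" using small g1' by linarith
      from order_trans[OF mult_left_mono[OF this exp_ge_zero] u(4)]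
      have "exp (N * \<delta> / 2) * (c0 / 2) \<le> norm (u \<delta> y1)" .
      moreover have "(N * \<delta> / 6) ^ 3 \<le> exp (N * \<delta> / 2)"
        using cube_le_exp[of "N * \<delta> / 2"] N \<delta> by simp
      then have "(N * \<delta> / 6) ^ 3 * (c0 / 2) \<le> exp (N * \<delta> / 2) * (c0 / 2)"
        using c0 by (intro mult_right_mono) auto
      moreover have "norm (u \<delta> y1) \<le> exp (\<alpha> * y1) * norm (u \<delta> y1)"
        using \<alpha> y1 by (simp add: mult_le_cancel_right1)
      ultimately have big: "(N * \<delta> / 6) ^ 3 * (c0 / 2) \<le> exp (\<alpha> * y1) * norm (u \<delta> y1)" by linarith
      \<comment> \<open>Since 3 \<mu> <= 1, both factors are at most linear in N.\<close>
      have "K powr (\<mu> / 2) * (Cg * (\<alpha> + 2 + N)) / \<delta> \<le> (Bb * N) * (Cg * ((\<alpha> + 3) * N)) / \<delta>"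
      proof (intro divide_right_mono mult_mono)
        have "N powr (3 * \<mu>) \<le> N powr 1" using \<mu> N by (intro powr_mono) auto
        from order_trans[OF K\<mu> mult_left_mono[OF this less_imp_le[OF Bb]]]
        show "K powr (\<mu> / 2) \<le> Bb * N" using N by simp
        have "\<alpha> + 2 \<le> (\<alpha> + 2) * N" using \<alpha> N by (simp add: mult_le_cancel_left1)
        then show "\<alpha> + 2 + N \<le> (\<alpha> + 3) * N" by (simp add: algebra_simps)
      qed (use Cg Bb N \<alpha> \<delta> in auto)
      also have "\<dots> = N\<^sup>2 * Q * (c0 / 2)" using c0 \<delta> by (simp add: Q_def power2_eq_square)
      also have "\<dots> \<le> N\<^sup>2 * (N * (\<delta> / 6) ^ 3) * (c0 / 2)"
      proof -
        have "Q * (6 / \<delta>) ^ 3 * (\<delta> / 6) ^ 3 \<le> N * (\<delta> / 6) ^ 3"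
          using N1(4)[OF NN1] \<delta> by (intro mult_right_mono) auto
        moreover have "Q * (6 / \<delta>) ^ 3 * (\<delta> / 6) ^ 3 = Q * ((6 / \<delta>) * (\<delta> / 6)) ^ 3"
          by (simp only: power_mult_distrib mult.assoc)
        ultimately have "Q \<le> N * (\<delta> / 6) ^ 3" using \<delta> by simp
        then show ?thesis using c0 by (intro mult_right_mono mult_left_mono) auto
      qed
      also have "\<dots> = (N * \<delta> / 6) ^ 3 * (c0 / 2)"
        by (simp add: power_mult_distrib power_divide power2_eq_square power3_eq_cube)
      also note big
      finally have main: "K powr (\<mu> / 2) * (Cg * (\<alpha> + 2 + N)) / \<delta> \<le> exp (\<alpha> * y1) * norm (u \<delta> y1)" .
      have "1 / \<delta> = K powr (- (\<mu> / 2)) * K powr (\<mu> / 2) / \<delta>" by (simp add: Kone)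
      also have "\<dots> = K powr ((m - \<mu>) / 2) * s * (K powr (\<mu> / 2) * (Cg * (\<alpha> + 2 + N)) / \<delta>)"
        unfolding Kcancel[symmetric] sP[symmetric] by (simp add: mult_ac)
      also have "\<dots> \<le> K powr ((m - \<mu>) / 2) * s * (exp (\<alpha> * y1) * norm (u \<delta> y1))"
        using main s by (intro mult_left_mono) auto
      finally show "1 / \<delta> \<le> (1 + (real_of_int k)\<^sup>2) powr ((m - \<mu>) / 2) * (exp (\<alpha> * y1) * norm (of_real s * u \<delta> y1))"
        unfolding K_def[symmetric] using s by (simp add: norm_mult mult_ac)
    qed (use s Cg \<alpha> N \<delta> y1 in auto)
  qed
qed

end

text \<open>The derivatives of U and of e^(\<alpha> y) U are given as two unrelated sequences.
  Uniqueness of one-sided derivatives and Leibniz's rule express \<open>E j\<close> as e^(\<alpha>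
  y) times a combination of the \<open>D i\<close> with i <= j; this triangular system is solved for
  e^(\<alpha> y) \<open>D j\<close>.\<close>

lemma W_inf_alpha_4_derivatives:
  assumes W: "W_inf_alpha 4 \<alpha> U" and \<alpha>: "\<alpha> > 0"
  obtains U1 U2 U3 M where
    "\<And>y. y \<ge> 0 \<Longrightarrow> (U has_real_derivative U1 y) (at y within {0..})"
    "\<And>y. y \<ge> 0 \<Longrightarrow> (U1 has_real_derivative U2 y) (at y within {0..})"
    "\<And>y. y \<ge> 0 \<Longrightarrow> (U2 has_real_derivative U3 y) (at y within {0..})"
    "continuous_on {0..} U3"
    "\<And>y. y \<ge> 0 \<Longrightarrow> \<bar>U y\<bar> \<le> M * exp (- \<alpha> * y)" "\<And>y. y \<ge> 0 \<Longrightarrow> \<bar>U1 y\<bar> \<le> M * exp (- \<alpha> * y)"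
    "\<And>y. y \<ge> 0 \<Longrightarrow> \<bar>U2 y\<bar> \<le> M * exp (- \<alpha> * y)" "\<And>y. y \<ge> 0 \<Longrightarrow> \<bar>U3 y\<bar> \<le> M * exp (- \<alpha> * y)"
proof -
  obtain D where D: "D 0 = U" "\<And>j y. j < 3 \<Longrightarrow> y \<ge> 0 \<Longrightarrow> (D j has_real_derivative D (Suc j) y) (at y within {0..})"
    "\<exists>C. C-lipschitz_on {0..} (D 3)"
    using W unfolding W_inf_alpha_def W_inf_def by auto
  obtain E where E: "E 0 = (\<lambda>y. exp (\<alpha> * y) * U y)"
    "\<And>j y. j < 3 \<Longrightarrow> y \<ge> 0 \<Longrightarrow> (E j has_real_derivative E (Suc j) y) (at y within {0..})"
    "\<And>j. j < 4 \<Longrightarrow> bounded (E j ` {0..})"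
    using W unfolding W_inf_alpha_def W_inf_def by auto
  define e where "e y = exp (\<alpha> * y)" for y
  have de: "(e has_real_derivative \<alpha> * e y) (at y within A)" for y A
    unfolding e_def by (auto intro!: derivative_eq_intros)
  \<comment> \<open>Uniqueness of a derivative within the closed half-line needs a nontrivial
    filter, also at the endpoint 0.\<close>
  have nb: "at y within {0..} \<noteq> bot" if "y \<ge> 0" for y :: real
  proof -
    have "{y<..} \<subseteq> {0..}" using that by auto
    from at_le[OF this, of y] show ?thesis
      using trivial_limit_at_right_real[of y] by (auto simp: bot_unique)
  qed
  have uniq: "E (Suc j) y = F' y" if "j < 3" "\<And>y. y \<ge> 0 \<Longrightarrow> E j y = F y"
    "\<And>y. y \<ge> 0 \<Longrightarrow> (F has_real_derivative F' y) (at y within {0..})" "y \<ge> 0" for j F F' y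
  proof -
    have "(F has_real_derivative E (Suc j) y) (at y within {0..})"
      by (rule has_field_derivative_transform_within[OF E(2)[OF that(1,4)], of 1]) (use that in auto)
    from has_field_derivative_unique[OF this that(3)[OF that(4)] nb[OF that(4)]] show ?thesis .
  qed
  define D0 D1 D2 D3 where "D0 = D 0" and "D1 = D 1" and "D2 = D 2" and "D3 = D 3"
  have dD: "(D0 has_real_derivative D1 y) (at y within {0..})" "(D1 has_real_derivative D2 y) (at y within {0..})"
    "(D2 has_real_derivative D3 y) (at y within {0..})" if "y \<ge> 0" for y
    using D(2)[of 0 y] D(2)[of 1 y] D(2)[of 2 y] that
    by (simp_all add: D0_def D1_def D2_def D3_def numeral_2_eq_2 numeral_3_eq_3)
  have E0: "E 0 y = e y * D0 y" for y by (simp add: E(1) e_def D0_def D(1))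
  have E1: "E (Suc 0) y = e y * (\<alpha> * D0 y + D1 y)" if "y \<ge> 0" for y
    by (rule uniq[where F = "\<lambda>y. e y * D0 y"]) (use E0 that in \<open>auto intro!: derivative_eq_intros de dD simp: algebra_simps\<close>)
  have E2: "E (Suc (Suc 0)) y = e y * (\<alpha>\<^sup>2 * D0 y + 2 * \<alpha> * D1 y + D2 y)" if "y \<ge> 0" for y
    by (rule uniq[where F = "\<lambda>y. e y * (\<alpha> * D0 y + D1 y)"])
      (use E1 that in \<open>auto intro!: derivative_eq_intros de dD simp: algebra_simps power2_eq_square\<close>)
  have E3: "E (Suc (Suc (Suc 0))) y = e y * (\<alpha> ^ 3 * D0 y + 3 * \<alpha>\<^sup>2 * D1 y + 3 * \<alpha> * D2 y + D3 y)" if "y \<ge> 0" for y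
    by (rule uniq[where F = "\<lambda>y. e y * (\<alpha>\<^sup>2 * D0 y + 2 * \<alpha> * D1 y + D2 y)"])
      (use E2 that in \<open>auto intro!: derivative_eq_intros de dD simp: algebra_simps power2_eq_square power3_eq_cube\<close>)
  have "\<exists>B. \<forall>y\<ge>0. \<bar>E j y\<bar> \<le> B" if "j < 4" for j
    using E(3)[OF that] unfolding bounded_iff by auto
  then obtain B where B: "\<And>j y. j < 4 \<Longrightarrow> y \<ge> 0 \<Longrightarrow> \<bar>E j y\<bar> \<le> B j" by metis
  have epos: "e y > 0" for y by (simp add: e_def)
  define M0 where "M0 = B 0"
  define M1 where "M1 = B 1 + \<alpha> * M0"
  define M2 where "M2 = B 2 + (\<alpha>\<^sup>2 * M0 + 2 * \<alpha> * M1)"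
  define M3 where "M3 = B 3 + (\<alpha> ^ 3 * M0 + 3 * \<alpha>\<^sup>2 * M1 + 3 * \<alpha> * M2)"
  have b0: "\<bar>e y * D0 y\<bar> \<le> M0" if "y \<ge> 0" for y using B[of 0 y] that by (simp add: E0 M0_def)
  have lin: "\<bar>c * x\<bar> \<le> c * K" if "\<bar>x\<bar> \<le> K" "c \<ge> 0" for c x K :: real
    using that by (simp add: abs_mult mult_left_mono)
  have b1: "\<bar>e y * D1 y\<bar> \<le> M1" if "y \<ge> 0" for y
  proof -
    have "e y * D1 y = E 1 y - \<alpha> * (e y * D0 y)" using E1[OF that] by (simp add: algebra_simps)
    then show ?thesis using B[of 1 y] lin[OF b0[OF that], of \<alpha>] that \<alpha> unfolding M1_def by simp
  qed
  have b2: "\<bar>e y * D2 y\<bar> \<le> M2" if "y \<ge> 0" for y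
  proof -
    have "e y * D2 y = E 2 y - \<alpha>\<^sup>2 * (e y * D0 y) - 2 * \<alpha> * (e y * D1 y)"
      using E2[OF that] by (simp add: algebra_simps numeral_2_eq_2)
    then show ?thesis using B[of 2 y] lin[OF b0[OF that], of "\<alpha>\<^sup>2"] lin[OF b1[OF that], of "2 * \<alpha>"] that \<alpha>
      unfolding M2_def by (simp; linarith?)
  qed
  have b3: "\<bar>e y * D3 y\<bar> \<le> M3" if "y \<ge> 0" for y
  proof -
    have "e y * D3 y = E 3 y - \<alpha> ^ 3 * (e y * D0 y) - 3 * \<alpha>\<^sup>2 * (e y * D1 y) - 3 * \<alpha> * (e y * D2 y)"
      using E3[OF that] by (simp add: algebra_simps numeral_3_eq_3)
    then show ?thesis using B[of 3 y] lin[OF b0[OF that], of "\<alpha> ^ 3"] lin[OF b1[OF that], of "3 * \<alpha>\<^sup>2"]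
        lin[OF b2[OF that], of "3 * \<alpha>"] that \<alpha>
      unfolding M3_def by (simp; linarith?)
  qed
  define M where "M = M0 + M1 + M2 + M3"
  have nn: "0 \<le> M0" "0 \<le> M1" "0 \<le> M2" "0 \<le> M3"
    using order_trans[OF abs_ge_zero b0[of 0]] order_trans[OF abs_ge_zero b1[of 0]]
      order_trans[OF abs_ge_zero b2[of 0]] order_trans[OF abs_ge_zero b3[of 0]] by simp_all
  have conv: "\<bar>x\<bar> \<le> M * exp (- \<alpha> * y)" if "\<bar>e y * x\<bar> \<le> M" for x y
  proof -
    have "\<bar>x\<bar> = \<bar>e y * x\<bar> * exp (- \<alpha> * y)" by (simp add: e_def abs_mult exp_minus)
    also have "\<dots> \<le> M * exp (- \<alpha> * y)" using that by (rule mult_right_mono) simp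
    finally show ?thesis .
  qed
  have c3: "continuous_on {0..} D3"
    using D(3) lipschitz_on_continuous_on by (auto simp: D3_def)
  show ?thesis
  proof (rule that[of D1 D2 D3 M])
    show "\<bar>U y\<bar> \<le> M * exp (- \<alpha> * y)" if "y \<ge> 0" for y
      using conv[of y "D0 y"] b0[OF that] nn by (simp add: M_def D0_def D(1))
    show "\<bar>D1 y\<bar> \<le> M * exp (- \<alpha> * y)" "\<bar>D2 y\<bar> \<le> M * exp (- \<alpha> * y)" "\<bar>D3 y\<bar> \<le> M * exp (- \<alpha> * y)" if "y \<ge> 0" for y
      using b1[OF that] b2[OF that] b3[OF that] nn by (intro conv; simp add: M_def)+
  qed (use dD c3 in \<open>simp_all add: D0_def D(1)\<close>)
qed

theorem theorem1p1:
  fixes \<alpha> :: real and Us :: "real \<Rightarrow> real" and a m \<mu> \<delta> :: real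
  assumes "\<alpha> > 0"
    and "W_inf_alpha 4 \<alpha> Us"
    and "a > 0" and "Us a = 0" and "deriv Us a = 0" and "deriv (deriv Us) a \<noteq> 0"
    and "m \<ge> 0" and "0 \<le> \<mu>" and "\<mu> < 1/3" and "\<delta> > 0"
  shows "\<exists>(uin :: real \<Rightarrow> real \<Rightarrow> complex) (utin :: real \<Rightarrow> real \<Rightarrow> complex)
            (u :: real \<Rightarrow> real \<Rightarrow> real \<Rightarrow> complex) (S :: (real \<times> real \<times> real) set).
     \<comment> \<open>data: 2\<pi>-periodic in x, analytic in x, small in H^m\<close>
     (\<forall>x y. uin (x + 2*pi) y = uin x y \<and> utin (x + 2*pi) y = utin x y) \<and>
     analytic_x (W1a_norm \<alpha>) uin \<and> analytic_x (W0a_norm \<alpha>) utin \<and>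
     Hm_norm m (W1a_norm \<alpha>) uin + Hm_norm m (W0a_norm \<alpha>) utin \<le> 1 \<and>
     \<comment> \<open>u is a global classical (C^2) solution on [0,\<infinity>) \<times> R \<times> [0,\<infinity>)\<close>
     C2_on S (\<lambda>(t, x, y). u t x y) \<and> {0..} \<times> UNIV \<times> {0..} \<subseteq> S \<and>
     (\<forall>t x y. u t (x + 2*pi) y = u t x y) \<and>
     (let v = (\<lambda>t x y. - integral {0..y} (\<lambda>z. pd_x u t x z));
          w = (\<lambda>t x y. pd_t u t x y + of_real (Us y) * pd_x u t x y + v t x y * of_real (deriv Us y))
      in (\<forall>t>0. \<forall>x. \<forall>y>0.
            pd_t w t x y + w t x y - pd_y (pd_y u) t x y = 0 \<and>
            pd_x u t x y + pd_y v t x y = 0) \<and>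
         (\<forall>x. \<forall>y\<ge>0. u 0 x y = uin x y \<and> pd_t u 0 x y = utin x y) \<and>
         (\<forall>t\<ge>0. \<forall>x. u t x 0 = 0 \<and> v t x 0 = 0)) \<and>
     \<comment> \<open>norm inflation\<close>
     (SUP t\<in>{0..\<delta>}. Hm_norm (m - \<mu>) (W0a_norm \<alpha>) (u t)) \<ge> ennreal (1 / \<delta>)"
proof -
  obtain U1 U2 U3 M where d:
    "\<And>y. y \<ge> 0 \<Longrightarrow> (Us has_real_derivative U1 y) (at y within {0..})"
    "\<And>y. y \<ge> 0 \<Longrightarrow> (U1 has_real_derivative U2 y) (at y within {0..})"
    "\<And>y. y \<ge> 0 \<Longrightarrow> (U2 has_real_derivative U3 y) (at y within {0..})"
    "continuous_on {0..} U3"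
    "\<And>y. y \<ge> 0 \<Longrightarrow> \<bar>Us y\<bar> \<le> M * exp (- \<alpha> * y)" "\<And>y. y \<ge> 0 \<Longrightarrow> \<bar>U1 y\<bar> \<le> M * exp (- \<alpha> * y)"
    "\<And>y. y \<ge> 0 \<Longrightarrow> \<bar>U2 y\<bar> \<le> M * exp (- \<alpha> * y)" "\<And>y. y \<ge> 0 \<Longrightarrow> \<bar>U3 y\<bar> \<le> M * exp (- \<alpha> * y)"
    by (rule W_inf_alpha_4_derivatives[OF assms(2,1)], rule that)
  have dUs: "deriv Us y = U1 y" if "y > 0" for y
    using d(1)[of y] that by (intro DERIV_imp_deriv) (simp add: at_Ici)
  \<comment> \<open>\<open>deriv\<close> is two-sided, so it is replaced by \<open>U1\<close> on the
    open half-line before the second derivative at \<open>a\<close> is taken.\<close>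
  have "(deriv Us has_real_derivative U2 a) (at a)"
  proof (rule has_field_derivative_transform_within_open[of U1 _ _ "{0<..}"])
    show "(U1 has_real_derivative U2 a) (at a)" using d(2)[of a] assms(3) by (simp add: at_Ici)
  qed (use assms(3) dUs in auto)
  then have "deriv (deriv Us) a = U2 a" by (rule DERIV_imp_deriv)
  then interpret shear_profile Us U1 U2 U3 \<alpha> a "U2 a / 2" M
    using assms dUs[OF assms(3)] d by unfold_locales auto
  show ?thesis
    by (rule norm_inflation_data[OF assms(8-10)], rule inflation_from_mode_sol, assumption, rule dUs, assumption+)
qed

end
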